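(* Let $n\ge 1$ be an integer, let $\alpha>0$ and $1<q\le 1+\frac{\alpha}{n}$ be real numbers, and let $\mathbb S=(0,+\infty)\times\mathbb R^n$. Let $\mathcal L=\sum_{i,j=1}^n\frac{\partial}{\partial x_i}\left[a_{ij}(t,x)\frac{\partial}{\partial x_j}\right]$, where the $a_{ij}$ are measurable and locally bounded in $\mathbb S$, $a_{ij}=a_{ji}$ a.e. in $\mathbb S$, and $0\le\sum_{i,j=1}^n a_{ij}(t,x)\xi_i\xi_j\le A(t,x)|\xi|^2$ for all $\xi\in\mathbb R^n$ and almost all $(t,x)\in\mathbb S$, with $A$ a measurable, non-negative, locally bounded function in $\mathbb S$. Suppose there is a constant $c>0$ such that $$\operatorname*{ess\,sup}_{(t,x)\in(0,+\infty)\times\{R/2<|x|<R\}}A(t,x)\le cR^{2-\alpha}\quad\text{for all }R>1 .$$ Let $(u,v)$ be an entire weak solution in $\mathbb S$ of the inequality $$u_t-\mathcal Lu-|u|^{q-1}u\ \ge\ v_t-\mathcal Lv-|v|^{q-1}v$$ such that $u\ge v$ (a.e.) in $\mathbb S$. Then $u=v$ (a.e.) in $\mathbb S$.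
   Context: For a bounded domain $\Pi\subset\mathbb S$ and $\hat q=\max\{1,q\}$, $W^{\mathcal L,q}(\Pi)$ denotes the completion of (the functions of finite norm in) $C^\infty(\Pi)$ with respect to the norm $$\|w\|_{W^{\mathcal L,q}(\Pi)}=\int_\Pi|w_t|\,dt\,dx+\left[\int_\Pi\sum_{i,j=1}^n a_{ij}(t,x)\frac{\partial w}{\partial x_i}\frac{\partial w}{\partial x_j}\,dt\,dx\right]^{1/2}+\left[\int_\Pi|w|^{\hat q}\,dt\,dx\right]^{1/\hat q}.$$ A function $w$ belongs to $W^{\mathcal L,q}_{\mathrm{loc}}(\mathbb S)$ if it belongs to $W^{\mathcal L,q}(\Pi)$ for every bounded domain $\Pi\subset\mathbb S$. For elements of the completion, $w_t$ and the expressions $\sum a_{ij}\frac{\partial\varphi}{\partial x_i}\frac{\partial w}{\partial x_j}$, $\sum a_{ij}\frac{\partial w}{\partial x_i}\frac{\partial w}{\partial x_j}$ are understood as limits along approximating sequences of smooth functions. A pair $(u,v)$ of measurable functions on $\mathbb S$ is an entire weak solution of $u_t-\mathcal Lu-|u|^{q-1}u\ge v_t-\mathcal Lv-|v|^{q-1}v$ in $\mathbb S$ if $u,v\in W^{\mathcal L,q}_{\mathrm{loc}}(\mathbb S)$ and, for every non-negative $\varphi\in C^\infty(\mathbb S)$ with compact support in $\mathbb S$, $$\int_{\mathbb S}\Big[u_t\varphi+\sum_{i,j=1}^n a_{ij}\frac{\partial\varphi}{\partial x_i}\frac{\partial u}{\partial x_j}-|u|^{q-1}u\,\varphi\Big]dt\,dx\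 \ge\ \int_{\mathbb S}\Big[v_t\varphi+\sum_{i,j=1}^n a_{ij}\frac{\partial\varphi}{\partial x_i}\frac{\partial v}{\partial x_j}-|v|^{q-1}v\,\varphi\Big]dt\,dx .$$ No condition is imposed on the behaviour of $u,v$ at $t=0$ or at infinity. *)

theory Defs
  imports "HOL-Analysis.Analysis" "HOL-Probability.Essential_Supremum"
begin

text \<open>
  Space-time points are pairs \<open>(t, x)\<close> of type \<open>real \<times> real ^ 'n\<close>, so the spatial dimension is
  \<open>n = CARD('n)\<close>.  All measure-theoretic notions refer to Lebesgue measure.
\<close>

definition halfspace :: "(real \<times> (real ^ 'n)) set"  (\<open>\<S>\<close>)
  where "\<S> = {0<..} \<times> UNIV"

definition bounded_domain :: "'a::euclidean_space set \<Rightarrow> bool"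
  where "bounded_domain P \<longleftrightarrow> open P \<and> connected P \<and> bounded P"

text \<open>Local boundedness of a measurable function: membership in the local \<open>L\<^sup>\<infinity>\<close> space.\<close>

definition locally_bounded_on :: "'a::euclidean_space set \<Rightarrow> ('a \<Rightarrow> real) \<Rightarrow> bool"
  where "locally_bounded_on S f \<longleftrightarrow>
    (\<forall>K. compact K \<and> K \<subseteq> S \<longrightarrow> (\<exists>M. AE z in lebesgue_on K. \<bar>f z\<bar> \<le> M))"

text \<open>The derivatives are taken at full neighbourhoods, so \<open>S\<close> is meant to be open.\<close>

primrec C_k_on :: "nat \<Rightarrow> 'a::euclidean_space set \<Rightarrow> ('a \<Rightarrow> real) \<Rightarrow> bool"
  where
    "C_k_on 0 S f \<longleftrightarrow> continuous_on S f"
  | "C_k_on (Suc k) S f \<longleftrightarrow>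
       (\<forall>z\<in>S. f differentiable (at z)) \<and>
       (\<forall>b\<in>Basis. C_k_on k S (\<lambda>z. frechet_derivative f (at z) b))"

definition C_infinity_on :: "'a::euclidean_space set \<Rightarrow> ('a \<Rightarrow> real) \<Rightarrow> bool"
  where "C_infinity_on S f \<longleftrightarrow> (\<forall>k. C_k_on k S f)"

definition test_function_on :: "'a::euclidean_space set \<Rightarrow> ('a \<Rightarrow> real) \<Rightarrow> bool"
  where "test_function_on S \<phi> \<longleftrightarrow> C_infinity_on S \<phi> \<and>
    compact (closure {z\<in>S. \<phi> z \<noteq> 0}) \<and> closure {z\<in>S. \<phi> z \<noteq> 0} \<subseteq> S"

definition deriv_t :: "(real \<times> (real ^ 'n) \<Rightarrow> real) \<Rightarrow> real \<times> (real ^ 'n) \<Rightarrow> real"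
  where "deriv_t f z = frechet_derivative f (at z) (1, 0)"

definition deriv_x :: "'n \<Rightarrow> (real \<times> (real ^ 'n) \<Rightarrow> real) \<Rightarrow> real \<times> (real ^ 'n) \<Rightarrow> real"
  where "deriv_x i f z = frechet_derivative f (at z) (0, axis i 1)"

definition a_form ::
  "('n::finite \<Rightarrow> 'n \<Rightarrow> real \<times> (real ^ 'n) \<Rightarrow> real) \<Rightarrow> (real \<times> (real ^ 'n) \<Rightarrow> real) \<Rightarrow>
   (real \<times> (real ^ 'n) \<Rightarrow> real) \<Rightarrow> real \<times> (real ^ 'n) \<Rightarrow> real"
  where "a_form a \<phi> w z = (\<Sum>i\<in>UNIV. \<Sum>j\<in>UNIV. a i j z * deriv_x i \<phi> z * deriv_x j w z)"

definition qhat :: "real \<Rightarrow> real"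
  where "qhat q = max 1 q"

text \<open>
  The Bochner integral of a non-integrable function is \<open>0\<close>, hence \<open>W_norm\<close> is only meaningful in
  conjunction with \<open>W_finite\<close>.
\<close>

definition W_finite ::
  "('n::finite \<Rightarrow> 'n \<Rightarrow> real \<times> (real ^ 'n) \<Rightarrow> real) \<Rightarrow> real \<Rightarrow> (real \<times> (real ^ 'n)) set \<Rightarrow>
   (real \<times> (real ^ 'n) \<Rightarrow> real) \<Rightarrow> bool"
  where "W_finite a q P w \<longleftrightarrow>
    set_integrable lebesgue P (\<lambda>z. \<bar>deriv_t w z\<bar>) \<and>
    set_integrable lebesgue P (a_form a w w) \<and>
    set_integrable lebesgue P (\<lambda>z. \<bar>w z\<bar> powr qhat q)"

definition W_norm ::
  "('n::finite \<Rightarrow> 'n \<Rightarrow> real \<times> (real ^ 'n) \<Rightarrow> real) \<Rightarrow> real \<Rightarrow> (real \<times> (real ^ 'n)) set \<Rightarrow>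
   (real \<times> (real ^ 'n) \<Rightarrow> real) \<Rightarrow> real"
  where "W_norm a q P w =
    (LINT z:P|lebesgue. \<bar>deriv_t w z\<bar>) +
    sqrt (LINT z:P|lebesgue. a_form a w w z) +
    (LINT z:P|lebesgue. \<bar>w z\<bar> powr qhat q) powr (1 / qhat q)"

definition W_Cauchy ::
  "('n::finite \<Rightarrow> 'n \<Rightarrow> real \<times> (real ^ 'n) \<Rightarrow> real) \<Rightarrow> real \<Rightarrow> (real \<times> (real ^ 'n)) set \<Rightarrow>
   (nat \<Rightarrow> real \<times> (real ^ 'n) \<Rightarrow> real) \<Rightarrow> bool"
  where "W_Cauchy a q P F \<longleftrightarrow>
    (\<forall>k. C_infinity_on P (F k) \<and> W_finite a q P (F k)) \<and>
    (\<forall>e>0. \<exists>N. \<forall>k\<ge>N. \<forall>m\<ge>N. W_norm a q P (\<lambda>z. F k z - F m z) < e)"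

definition converges_Lp ::
  "real \<Rightarrow> 'a::euclidean_space set \<Rightarrow> (nat \<Rightarrow> 'a \<Rightarrow> real) \<Rightarrow> ('a \<Rightarrow> real) \<Rightarrow> bool"
  where "converges_Lp p P F g \<longleftrightarrow>
    g \<in> borel_measurable (lebesgue_on P) \<and>
    (\<forall>k. set_integrable lebesgue P (\<lambda>z. \<bar>F k z - g z\<bar> powr p)) \<and>
    (\<lambda>k. LINT z:P|lebesgue. \<bar>F k z - g z\<bar> powr p) \<longlonglongrightarrow> 0"

text \<open>
  The matrix \<open>a\<close> may degenerate, so the form need not be closable and an element of the completion
  need not be determined by the function \<open>w\<close> alone.  An element is therefore represented by \<open>w\<close>
  together with \<open>wt\<close> and \<open>G\<close>, the limits of \<open>\<partial>\<^sub>t f\<^sub>k\<close> and \<open>(\<Sum>\<^sub>j a\<^sub>i\<^sub>j \<partial>\<^sub>j f\<^sub>k)\<^sub>i\<close> along a Cauchy sequence \<open>f\<^sub>k\<close>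
  of smooth functions; the limit defining \<open>G\<close> is tested against gradients of test functions.  For
  symmetric non-negative locally bounded \<open>a\<close>, every Cauchy sequence has such limits, they are
  unique almost everywhere, and \<open>(w, wt, G)\<close> determines its class in the completion (\<open>G\<close> determines
  the \<open>L\<^sup>2\<close> limit of \<open>a\<^sup>1\<^sup>/\<^sup>2 \<nabla>f\<^sub>k\<close>).
\<close>

definition W_element ::
  "('n::finite \<Rightarrow> 'n \<Rightarrow> real \<times> (real ^ 'n) \<Rightarrow> real) \<Rightarrow> real \<Rightarrow> (real \<times> (real ^ 'n)) set \<Rightarrow>
   (real \<times> (real ^ 'n) \<Rightarrow> real) \<Rightarrow> (real \<times> (real ^ 'n) \<Rightarrow> real) \<Rightarrow>
   (real \<times> (real ^ 'n) \<Rightarrow> real ^ 'n) \<Rightarrow> bool"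
  where "W_element a q P w wt G \<longleftrightarrow>
    (\<exists>F. W_Cauchy a q P F \<and>
      converges_Lp (qhat q) P F w \<and>
      converges_Lp 1 P (\<lambda>k. deriv_t (F k)) wt \<and>
      (\<forall>\<phi>. test_function_on \<S> \<phi> \<longrightarrow>
        converges_Lp 1 P (\<lambda>k. a_form a \<phi> (F k)) (\<lambda>z. \<Sum>i\<in>UNIV. deriv_x i \<phi> z * G z $ i)))"

text \<open>
  \<open>wt\<close> and \<open>G\<close> do not depend on the domain: the elements over different domains are restrictions of
  one another.
\<close>

definition W_loc ::
  "('n::finite \<Rightarrow> 'n \<Rightarrow> real \<times> (real ^ 'n) \<Rightarrow> real) \<Rightarrow> real \<Rightarrow>
   (real \<times> (real ^ 'n) \<Rightarrow> real) \<Rightarrow> (real \<times> (real ^ 'n) \<Rightarrow> real) \<Rightarrow>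
   (real \<times> (real ^ 'n) \<Rightarrow> real ^ 'n) \<Rightarrow> bool"
  where "W_loc a q w wt G \<longleftrightarrow>
    (\<forall>P. bounded_domain P \<and> P \<subseteq> \<S> \<longrightarrow> W_element a q P w wt G)"

definition weak_form ::
  "real \<Rightarrow> (real \<times> (real ^ 'n) \<Rightarrow> real) \<Rightarrow> (real \<times> (real ^ 'n) \<Rightarrow> real) \<Rightarrow>
   (real \<times> (real ^ 'n) \<Rightarrow> real ^ 'n) \<Rightarrow> (real \<times> (real ^ 'n::finite) \<Rightarrow> real) \<Rightarrow> real"
  where "weak_form q w wt G \<phi> =
    (LINT z:\<S>|lebesgue. wt z * \<phi> z + (\<Sum>i\<in>UNIV. deriv_x i \<phi> z * G z $ i)
       - \<bar>w z\<bar> powr (q - 1) * w z * \<phi> z)"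

definition entire_weak_solution ::
  "('n::finite \<Rightarrow> 'n \<Rightarrow> real \<times> (real ^ 'n) \<Rightarrow> real) \<Rightarrow> real \<Rightarrow>
   (real \<times> (real ^ 'n) \<Rightarrow> real) \<Rightarrow> (real \<times> (real ^ 'n) \<Rightarrow> real) \<Rightarrow> bool"
  where "entire_weak_solution a q u v \<longleftrightarrow>
    u \<in> borel_measurable (lebesgue_on \<S>) \<and> v \<in> borel_measurable (lebesgue_on \<S>) \<and>
    (\<exists>ut Gu vt Gv. W_loc a q u ut Gu \<and> W_loc a q v vt Gv \<and>
      (\<forall>\<phi>. test_function_on \<S> \<phi> \<and> (\<forall>z\<in>\<S>. 0 \<le> \<phi> z) \<longrightarrow>
        weak_form q u ut Gu \<phi> \<ge> weak_form q v vt Gv \<phi>))"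

end

theory Submission
  imports Defs "HOL-Real_Asymp.Real_Asymp"
begin

text \<open>
  Let \<open>w = u - v \<ge> 0\<close>.  Since \<open>\<bar>u\<bar>\<^sup>q\<^sup>-\<^sup>1u - \<bar>v\<bar>\<^sup>q\<^sup>-\<^sup>1v \<ge> 2\<^sup>-\<^sup>q w\<^sup>q\<close>, the function \<open>w\<close> satisfies
  \<open>w\<^sub>t - L w \<ge> 2\<^sup>-\<^sup>q w\<^sup>q\<close> weakly.  Test with \<open>h(w/\<mu>) \<zeta>\<close>, where \<open>h\<close> is smooth, decreasing, \<open>1 \<le> h \<le> 2\<close> and
  \<open>1/\<bar>h'\<bar>\<close> grows like \<open>\<bar>y\<bar>\<^sup>r\<close> with \<open>r = (1+q)/2 < q\<close>: completing the square, the good term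
  \<open>h'(w/\<mu>) \<zeta> (a\<nabla>w, \<nabla>w)\<close> absorbs the gradient of \<open>w\<close>, and a cutoff \<open>\<zeta>\<close> that increases near \<open>t = 0\<close>
  produces no bad term there.  With \<open>\<zeta>\<close> at scale \<open>\<bar>x\<bar> ~ R\<close>, \<open>t ~ R\<^sup>\<alpha>\<close>, with \<open>\<mu> = \<lambda> R powr (-\<alpha>/(q-1))\<close>, and with
  Young's inequality this becomes
  \<open>\<integral> w\<^sup>q \<zeta> \<le> C (\<lambda> + \<lambda>\<^sup>1\<^sup>-\<^sup>q \<integral>\<^sub>D w\<^sup>q \<zeta>)\<close>, where \<open>D\<close> lies outside \<open>{t < R\<^sup>\<alpha>/2, \<bar>x\<bar> < R/2}\<close> and \<open>C\<close> does not
  depend on \<open>R\<close>; this is where \<open>q \<le> 1 + \<alpha>/n\<close> enters.  A large \<open>\<lambda>\<close> shows that \<open>w\<^sup>q\<close> is integrable over the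
  half-space; then \<open>R \<rightarrow> \<infinity>\<close> gives \<open>\<integral> w\<^sup>q \<le> C\<lambda>\<close> for every \<open>\<lambda> > 0\<close>, including the critical exponent.

  Elements of the completion have no gradient of their own, so the test function is built from the
  smooth approximations \<open>F\<^sub>m\<close> of \<open>w\<close>; the error is controlled because \<open>F\<^sub>m\<close> is Cauchy in the energy seminorm
  while the test functions stay bounded in it.
\<close>

section \<open>Calculus of the classes C_k_on\<close>

lemma C_k_on_differentiable: "C_k_on (Suc k) S f \<Longrightarrow> z \<in> S \<Longrightarrow> f differentiable (at z)"
  by simp

lemma C_k_on_has_derivative:
  assumes "C_k_on (Suc k) S f" "z \<in> S"
  shows "(f has_derivative frechet_derivative f (at z)) (at z)"
  using assms frechet_derivative_works by auto

text \<open>Openness of \<open>S\<close> is what makes this work: the derivatives in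
  \<open>C_k_on\<close> are taken at full neighbourhoods, so agreement on \<open>S\<close> fixes
  them because every point of \<open>S\<close> is interior.\<close>

lemma C_k_on_cong:
  assumes "open S" "\<And>z. z \<in> S \<Longrightarrow> f z = g z" "C_k_on k S f"
  shows "C_k_on k S g"
  using assms(2,3)
proof (induction k arbitrary: f g)
  case 0
  then show ?case by (simp cong: continuous_on_cong)
next
  case (Suc k)
  have eq: "frechet_derivative f (at z) = frechet_derivative g (at z)" if "z \<in> S" for z
    using that Suc.prems by (intro frechet_derivative_transform_within_open[OF _ assms(1)]) auto
  have d: "g differentiable (at z)" if "z \<in> S" for z
    using that Suc.prems assms(1)
    by (metis C_k_on.simps(2) differentiable_def has_derivative_transform_within_open)
  have "C_k_on k S (\<lambda>z. frechet_derivative g (at z) b)" if "b \<in> Basis" for b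
    by (rule Suc.IH[of "\<lambda>z. frechet_derivative f (at z) b"]) (use that Suc.prems eq in auto)
  then show ?case
    using d by simp
qed

text \<open>By uniqueness of derivatives an explicit \<open>D\<close> coincides with
  \<open>frechet_derivative\<close> on \<open>S\<close>. This is the introduction rule behind most
  inductions on \<open>k\<close> below.\<close>

lemma C_k_on_SucI:
  assumes "open S"
    and "\<And>z. z \<in> S \<Longrightarrow> (f has_derivative D z) (at z)"
    and "\<And>b. b \<in> Basis \<Longrightarrow> C_k_on k S (\<lambda>z. D z b)"
  shows "C_k_on (Suc k) S f"
proof -
  have "frechet_derivative f (at z) = D z" if "z \<in> S" for z
    using frechet_derivative_at[OF assms(2)[OF that]] by simp
  then show ?thesis
    using assms by (auto simp: differentiable_def intro!: C_k_on_cong[OF assms(1) _ assms(3)])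
qed

lemma C_k_on_Suc_imp: "C_k_on (Suc k) S f \<Longrightarrow> C_k_on k S f"
proof (induction k arbitrary: f)
  case 0
  then show ?case
    by (auto intro!: continuous_at_imp_continuous_on differentiable_imp_continuous_within)
next
  case (Suc k)
  then show ?case by (metis C_k_on.simps(2))
qed

lemma C_k_on_imp_continuous: "C_k_on k S f \<Longrightarrow> continuous_on S f"
  by (induction k) (auto dest: C_k_on_Suc_imp simp del: C_k_on.simps(2))

lemma C_k_on_subset: "C_k_on k S f \<Longrightarrow> T \<subseteq> S \<Longrightarrow> C_k_on k T f"
  by (induction k arbitrary: f) (auto intro: continuous_on_subset)

lemma C_k_on_Un:
  "C_k_on k S f \<Longrightarrow> C_k_on k T f \<Longrightarrow> open S \<Longrightarrow> open T \<Longrightarrow> C_k_on k (S \<union> T) f"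
  by (induction k arbitrary: f) (auto intro: continuous_on_open_Un)

lemma C_k_on_const: "open S \<Longrightarrow> C_k_on k S (\<lambda>z. c)"
  by (induction k arbitrary: c)
     (simp, rule C_k_on_SucI[where D = "\<lambda>z h. 0"], auto)

lemma C_k_on_bounded_linear: "open S \<Longrightarrow> bounded_linear f \<Longrightarrow> C_k_on k S f"
proof (cases k)
  case 0
  assume "bounded_linear f"
  with 0 show ?thesis by (simp add: linear_continuous_on)
next
  case (Suc n)
  assume "open S" "bounded_linear f"
  with Suc show ?thesis
    using C_k_on_SucI[of S f "\<lambda>z. f" n] by (auto simp: C_k_on_const intro: bounded_linear_imp_has_derivative)
qed

lemma C_k_on_add: 
  "open S \<Longrightarrow> C_k_on k S f \<Longrightarrow> C_k_on k S g \<Longrightarrow> C_k_on k S (\<lambda>z. f z + g z)"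
proof (induction k arbitrary: f g)
  case 0
  then show ?case by (simp add: continuous_on_add)
next
  case (Suc k)
  show ?case
    by (rule C_k_on_SucI[OF Suc.prems(1) has_derivative_add[OF
          C_k_on_has_derivative[OF Suc.prems(2)] C_k_on_has_derivative[OF Suc.prems(3)]]])
       (use Suc in auto)
qed

lemma C_k_on_mult: 
  "open S \<Longrightarrow> C_k_on k S f \<Longrightarrow> C_k_on k S g \<Longrightarrow> C_k_on k S (\<lambda>z. f z * g z)"
proof (induction k arbitrary: f g)
  case 0
  then show ?case by (simp add: continuous_on_mult)
next
  case (Suc k)
  show ?case
    by (rule C_k_on_SucI[OF Suc.prems(1) has_derivative_mult[OF
          C_k_on_has_derivative[OF Suc.prems(2)] C_k_on_has_derivative[OF Suc.prems(3)]]])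
       (use Suc C_k_on_Suc_imp in \<open>auto intro!: C_k_on_add Suc.IH simp del: C_k_on.simps(2), auto\<close>)
qed

lemma C_k_on_power: "open S \<Longrightarrow> C_k_on k S f \<Longrightarrow> C_k_on k S (\<lambda>z. f z ^ n)"
  by (induction n) (auto intro: C_k_on_const C_k_on_mult)

lemma C_k_on_sum:
  "open S \<Longrightarrow> (\<And>i. i \<in> I \<Longrightarrow> C_k_on k S (f i)) \<Longrightarrow> C_k_on k S (\<lambda>z. \<Sum>i\<in>I. f i z)"
  by (induction I rule: infinite_finite_induct) (auto intro: C_k_on_const C_k_on_add)

lemma C_k_on_diff: 
  assumes "open S" "C_k_on k S f" "C_k_on k S g"
  shows "C_k_on k S (\<lambda>z. f z - g z)"
  using C_k_on_add[OF assms(1,2) C_k_on_mult[OF assms(1) C_k_on_const[OF assms(1), of k "-1"] assms(3)]]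
  by simp

text \<open>The induction generalises \<open>h\<close>: by the chain rule the derivative is that of
  \<open>f\<close> times \<open>h'\<close> composed with the same \<open>f\<close>, and the
  hypothesis is applied to \<open>h'\<close> after lowering the class of \<open>f\<close> by
  one.\<close>

lemma C_k_on_compose: 
  fixes h :: "real \<Rightarrow> real"
  assumes "open S" "open T" "f ` S \<subseteq> T" "C_k_on k S f" "C_k_on k T h"
  shows "C_k_on k S (\<lambda>z. h (f z))"
  using assms(4,5)
proof (induction k arbitrary: h)
  case 0
  then show ?case using assms(3) by (auto intro: continuous_on_compose2)
next
  case (Suc k)
  let ?h' = "\<lambda>y. frechet_derivative h (at y)"
  \<comment> \<open>A linear map on the reals is multiplication by its value at 1; this turns the
    derivative of \<open>h\<close> into a scalar function.\<close>
  have lin: "?h' y x = x * ?h' y 1" if "y \<in> T" for x y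
    using C_k_on_has_derivative[OF Suc.prems(2) that] 
    by (metis has_derivative_linear linear_scale mult.right_neutral real_scaleR_def)
  show ?case
  proof (rule C_k_on_SucI[OF assms(1), where D = "\<lambda>z b. frechet_derivative f (at z) b * ?h' (f z) 1"])
    fix z assume z: "z \<in> S"
    then have fz: "f z \<in> T" using assms(3) by auto
    show "((\<lambda>z. h (f z)) has_derivative (\<lambda>b. frechet_derivative f (at z) b * ?h' (f z) 1)) (at z)"
      using has_derivative_compose[OF C_k_on_has_derivative[OF Suc.prems(1) z]
         C_k_on_has_derivative[OF Suc.prems(2) fz]]
      unfolding lin[OF fz, of "frechet_derivative f (at z) _", symmetric] .
  next
    fix b :: 'a assume "b \<in> Basis"
    then have "C_k_on k S (\<lambda>z. frechet_derivative f (at z) b)"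
      using Suc.prems(1) by (simp only: C_k_on.simps)
    moreover have "C_k_on k T (\<lambda>y. ?h' y 1)"
      using Suc.prems(2) by (simp only: C_k_on.simps Basis_real_def ball_simps)
    then have "C_k_on k S (\<lambda>z. ?h' (f z) 1)"
      by (rule Suc.IH[OF C_k_on_Suc_imp[OF Suc.prems(1)]])
    ultimately show "C_k_on k S (\<lambda>z. frechet_derivative f (at z) b * ?h' (f z) 1)"
      by (rule C_k_on_mult[OF assms(1)])
  qed
qed

lemma C_k_on_SucI_real:
  fixes f :: "real \<Rightarrow> real"
  assumes "open S"
    and "\<And>x. x \<in> S \<Longrightarrow> (f has_real_derivative f' x) (at x)"
    and "C_k_on k S f'"
  shows "C_k_on (Suc k) S f"
  using assms by (intro C_k_on_SucI[where D = "\<lambda>x b. f' x * b"])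
    (auto simp: has_field_derivative_def)

lemma C_k_on_powr: "C_k_on k {0<..} (\<lambda>x::real. x powr p)"
proof (induction k arbitrary: p)
  case 0
  then show ?case by (auto intro!: continuous_intros)
next
  case (Suc k)
  show ?case
    by (rule C_k_on_SucI_real[where f' = "\<lambda>x. p * x powr (p - 1)"])
       (auto intro!: derivative_eq_intros C_k_on_mult C_k_on_const Suc)
qed

lemma C_k_on_compose_powr:
  assumes "open S" "C_k_on k S f" "\<And>z. z \<in> S \<Longrightarrow> 0 < f z"
  shows "C_k_on k S (\<lambda>z. f z powr p)"
  by (rule C_k_on_compose[OF assms(1) _ _ assms(2) C_k_on_powr]) (use assms in auto)

lemma C_k_on_ident: "open S \<Longrightarrow> C_k_on k S (\<lambda>x::real. x)"
  by (intro C_k_on_bounded_linear) (auto simp: bounded_linear_ident)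

section \<open>A smooth step and the test nonlinearity\<close>

definition flat_exp :: "nat \<Rightarrow> real \<Rightarrow> real"
  where "flat_exp n x = (if x > 0 then inverse x ^ n * exp (- inverse x) else 0)"

lemma flat_exp_tendsto_0: "(flat_exp n \<longlongrightarrow> 0) (at 0)"
proof -
  have "((\<lambda>x. inverse x ^ n / exp (inverse x)) \<longlongrightarrow> 0) (at_right (0::real))"
    using tendsto_power_div_exp_0[of n] filterlim_inverse_at_top_right
    by (rule filterlim_compose)
  then have "(flat_exp n \<longlongrightarrow> 0) (at_right 0)"
    by (rule tendsto_cong[THEN iffD1, rotated])
       (auto simp: eventually_at_filter flat_exp_def exp_minus field_simps)
  moreover have "(flat_exp n \<longlongrightarrow> 0) (at_left 0)"
    by (rule tendsto_eventually) (auto simp: eventually_at_filter flat_exp_def)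
  ultimately show ?thesis by (simp add: filterlim_split_at)
qed

text \<open>The powers of \<open>inverse x\<close> are carried along because a single flat function
  is not closed under differentiation whereas the linear span of this family is; smoothness then
  follows for all \<open>n\<close> at once.\<close>

lemma flat_exp_has_derivative:
  "(flat_exp n has_real_derivative flat_exp (n + 2) x - real n * flat_exp (n + 1) x) (at x)"
proof (cases x "0::real" rule: linorder_cases)
  case less
  have "((\<lambda>x. 0) has_real_derivative flat_exp (n + 2) x - real n * flat_exp (n + 1) x) (at x)"
    using less by (auto simp: flat_exp_def)
  then show ?thesis
    by (rule has_field_derivative_transform_within_open[where S = "{..<0}"])
       (use less in \<open>auto simp: flat_exp_def\<close>)
next
  case equal
  \<comment> \<open>At the origin the difference quotient of member \<open>n\<close> is member
    \<open>n + 1\<close>, so its limit is the one already computed.\<close>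
  have "((\<lambda>h. (flat_exp n h - flat_exp n 0) / (h - 0)) \<longlongrightarrow> 0) (at 0)"
    by (rule tendsto_cong[THEN iffD1, OF _ flat_exp_tendsto_0[of "n + 1"]])
       (auto simp: eventually_at_filter flat_exp_def field_simps)
  then show ?thesis
    using equal by (simp add: has_field_derivative_iff flat_exp_def)
next
  case greater
  let ?p = "inverse x"
  have D: "(inverse has_real_derivative - (?p\<^sup>2)) (at x)"
    using greater DERIV_inverse[of x UNIV] by (simp add: numeral_2_eq_2)
  have E: "((\<lambda>x. exp (- inverse x)) has_real_derivative exp (- ?p) * - (- ?p\<^sup>2)) (at x)"
    by (rule DERIV_chain2[OF DERIV_exp DERIV_minus[OF D]])
  \<comment> \<open>For \<open>n = 0\<close> the truncated subtraction gives a wrong exponent, but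
    the factor \<open>real n\<close> vanishes.\<close>
  have "real n * (?p ^ (n - Suc 0) * ?p\<^sup>2) = real n * ?p ^ (n + 1)"
    by (cases n) (auto simp: power2_eq_square)
  then have "((\<lambda>x. inverse x ^ n * exp (- inverse x)) has_real_derivative
      flat_exp (n + 2) x - real n * flat_exp (n + 1) x) (at x)"
    using greater
    by (intro DERIV_cong[OF DERIV_mult[OF DERIV_power[OF D, of n] E]])
       (auto simp: flat_exp_def algebra_simps power2_eq_square)
  then show ?thesis
    by (rule has_field_derivative_transform_within_open[where S = "{0<..}"])
       (use greater in \<open>auto simp: flat_exp_def\<close>)
qed

lemma C_k_on_flat_exp: "C_k_on k UNIV (flat_exp n)"
proof (induction k arbitrary: n)
  case 0
  then show ?case
    by (auto intro!: continuous_at_imp_continuous_on DERIV_isCont flat_exp_has_derivative)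
next
  case (Suc k)
  show ?case
    by (rule C_k_on_SucI_real[OF _ flat_exp_has_derivative])
       (auto intro!: C_k_on_diff C_k_on_mult C_k_on_const Suc)
qed

text \<open>The usual quotient \<open>f x / (f x + f (1 - x))\<close> for a flat \<open>f\<close>;
  the denominator is positive because \<open>x\<close> and \<open>1 - x\<close> are never both
  non-positive.\<close>

lemma smooth_step_exists:
  obtains g g' :: "real \<Rightarrow> real" and K :: real
  where "\<And>k. C_k_on k UNIV g" "\<And>x. x \<le> 0 \<Longrightarrow> g x = 0" "\<And>x. x \<ge> 1 \<Longrightarrow> g x = 1"
    "\<And>x. 0 \<le> g x" "\<And>x. g x \<le> 1" "\<And>x. (g has_real_derivative g' x) (at x)"
    "\<And>x. 0 \<le> g' x" "\<And>x. g' x \<le> K"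
    "\<And>x. x \<le> 0 \<or> 1 \<le> x \<Longrightarrow> g' x = 0"
proof -
  define f where "f = flat_exp 0"
  define d where "d x = f x + f (1 - x)" for x
  define g where "g x = f x / d x" for x
  define g' where "g' x = (flat_exp 2 x * f (1 - x) + f x * flat_exp 2 (1 - x)) / (d x)\<^sup>2" for x
  have f0: "0 \<le> f x" "0 \<le> flat_exp 2 x" for x by (auto simp: f_def flat_exp_def)
  have d0: "0 < d x" for x
    using f0(1)[of x] f0(1)[of "1 - x"] by (auto simp: d_def f_def flat_exp_def add_pos_nonneg add_nonneg_pos)
  have cf: "C_k_on k UNIV f" for k unfolding f_def by (rule C_k_on_flat_exp)
  have cf1: "C_k_on k UNIV (\<lambda>x. f (1 - x))" for k
    by (rule C_k_on_compose[OF _ _ _ _ cf])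
      (auto intro!: C_k_on_diff C_k_on_const C_k_on_ident)
  have cd: "C_k_on k UNIV d" for k
    unfolding d_def[abs_def] by (intro C_k_on_add cf cf1) auto
  have smooth: "C_k_on k UNIV g" for k
  proof -
    have "C_k_on k UNIV (\<lambda>x. f x * d x powr (-1))"
      by (intro C_k_on_mult C_k_on_compose_powr cf cd) (auto simp: d0)
    then show ?thesis
      by (rule C_k_on_cong[rotated 2]) (auto simp: g_def powr_minus_divide d0 less_imp_le)
  qed
  have df: "(f has_real_derivative flat_exp 2 x) (at x)" for x
    using flat_exp_has_derivative[of 0 x] by (simp add: f_def numeral_2_eq_2)
  have df1: "((\<lambda>x. f (1 - x)) has_real_derivative - flat_exp 2 (1 - x)) (at x)" for x
    by (rule DERIV_chain2[where f = f and g = "\<lambda>x. 1 - x", OF df, THEN DERIV_cong])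
       (auto intro!: derivative_eq_intros)
  have dg: "(g has_real_derivative g' x) (at x)" for x
    unfolding g_def[abs_def] g'_def d_def
    using d0[of x] by (auto intro!: derivative_eq_intros df df1 simp: d_def power2_eq_square algebra_simps)
  have g'0: "0 \<le> g' x" for x unfolding g'_def using f0 d0 by auto
  have out: "g' x = 0" if "x \<le> 0 \<or> 1 \<le> x" for x
    using that by (auto simp: g'_def f_def flat_exp_def)
  \<comment> \<open>The bound \<open>K\<close> for the slope comes from compactness of the unit
    interval, since \<open>g'\<close> vanishes outside it.\<close>
  have "continuous_on {0..1} g'"
    unfolding g'_def d_def f_def
    using d0 by (auto intro!: continuous_intros continuous_on_subset[OF C_k_on_imp_continuous[OF C_k_on_flat_exp]]
       continuous_on_compose2[OF C_k_on_imp_continuous[OF C_k_on_flat_exp]] simp: d_def f_def less_le)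
  then obtain K where K: "\<And>x. x \<in> {0..1} \<Longrightarrow> g' x \<le> K"
    by (metis compact_Icc compact_continuous_image compact_imp_bounded bounded_has_Sup(1) image_eqI empty_iff)
  have "g' x \<le> max K 0" for x
    using K[of x] out[of x] by (cases "x \<in> {0..1}") auto
  moreover have "g x = 0" if "x \<le> 0" for x using that by (simp add: g_def f_def flat_exp_def)
  moreover have "g x = 1" if "x \<ge> 1" for x
    using that by (simp add: g_def d_def f_def flat_exp_def)
  moreover have "g x \<le> 1" "0 \<le> g x" for x
    using d0[of x] f0(1)[of "1 - x"] f0(1)[of x] by (auto simp: g_def d_def field_simps)
  ultimately show thesis using that[of g g' "max K 0"] smooth dg g'0 out by blast
qed

text \<open>
  The derivative of \<open>h\<close> decays exactly like \<open>(1 + \<bar>y\<bar>) powr - (1 + \<nu>)\<close> on both half-lines: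
  the approximations of \<open>u - v\<close> may change sign.
\<close>

definition test_nonlinearity ::
    "real \<Rightarrow> (real \<Rightarrow> real) \<Rightarrow> (real \<Rightarrow> real) \<Rightarrow> (real \<Rightarrow> real) \<Rightarrow> real \<Rightarrow> bool"
  where "test_nonlinearity \<nu> h h' H K \<longleftrightarrow>
    (\<forall>k. C_k_on k UNIV h) \<and> (\<forall>k. C_k_on k UNIV H) \<and>
    (\<forall>y. (h has_real_derivative h' y) (at y)) \<and> (\<forall>y. (H has_real_derivative h y) (at y)) \<and>
    H 0 = 0 \<and> (\<forall>y. 1 \<le> h y \<and> h y \<le> 2) \<and> (\<forall>y. - \<nu> \<le> h' y \<and> h' y < 0) \<and>
    (\<forall>y. 1 \<le> - h' y * (K * (1 + \<bar>y\<bar>) powr (1 + \<nu>))) \<and> K > 0"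

text \<open>The function \<open>p = y + S\<close> with \<open>S = sqrt (1 + y^2)\<close> satisfies
  \<open>p' = p / S\<close> and \<open>p * (S - y) = 1\<close>, so \<open>p\<close> and its inverse
  are both at most \<open>2 * (1 + |y|)\<close>. Hence \<open>e = p powr \<nu>\<close> grows on one
  side and decays on the other at the same polynomial rate, and \<open>h = 1 + 1 / (1 + e)\<close>
  falls from 2 to 1 with the same decay of \<open>h'\<close> on both sides.\<close>

lemma test_nonlinearity_exists:
  fixes \<nu> :: real
  assumes "\<nu> > 0"
  shows "\<exists>h h' H K. test_nonlinearity \<nu> h h' H K"
proof -
  define S where "S y = (1 + y\<^sup>2) powr (1/2)" for y :: real
  define p where "p y = y + S y" for y
  define e where "e y = p y powr \<nu>" for y
  define h where "h y = 1 + (1 + e y) powr (-1)" for y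
  define h' where "h' y = - (\<nu> * e y / (S y * (1 + e y)\<^sup>2))" for y
  define K where "K = 4 * 2 powr \<nu> / \<nu>"
  have sq: "0 < 1 + y\<^sup>2" for y :: real by (simp add: add_pos_nonneg)
  have S2: "S y * S y = 1 + y\<^sup>2" for y
    unfolding S_def using sq[of y] by (simp flip: powr_add)
  have S0: "0 < S y" for y unfolding S_def using sq[of y] by (simp add: less_imp_neq[symmetric])
  have Sy: "\<bar>y\<bar> < S y" for y
    by (rule power2_less_imp_less) (use S0[of y] S2[of y] in \<open>auto simp: power2_eq_square less_imp_le\<close>)
  have S1: "1 \<le> S y" for y
    by (rule power2_le_imp_le) (use S0[of y] S2[of y] in \<open>auto simp: power2_eq_square less_imp_le\<close>)
  have S3: "S y \<le> 1 + \<bar>y\<bar>" for y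
    by (rule power2_le_imp_le) (use S2[of y] in \<open>auto simp: power2_eq_square algebra_simps\<close>)
  have p0: "0 < p y" for y using Sy[of y] by (auto simp: p_def)
  have e0: "0 < e y" for y using p0[of y] by (auto simp: e_def)
  have cS: "C_k_on k UNIV S" for k
    unfolding S_def[abs_def] power2_eq_square
    by (intro C_k_on_compose_powr C_k_on_add C_k_on_mult C_k_on_const C_k_on_ident)
      (auto simp: add_pos_nonneg)
  have ce: "C_k_on k UNIV e" for k
    unfolding e_def[abs_def] p_def
    by (intro C_k_on_compose_powr C_k_on_add C_k_on_ident cS)
      (use p0 in \<open>auto simp: p_def\<close>)
  have ch: "C_k_on k UNIV h" for k
    unfolding h_def[abs_def]
    by (intro C_k_on_compose_powr C_k_on_add C_k_on_const ce)
      (use e0 in \<open>auto simp: add_pos_pos\<close>)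
  have dS: "(S has_real_derivative y / S y) (at y)" for y
  proof -
    have "(S has_real_derivative 1/2 * (1 + y\<^sup>2) powr (1/2 - 1) * (2 * y)) (at y)"
      unfolding S_def[abs_def] using sq[of y] 
      by (auto intro!: derivative_eq_intros simp: )
    moreover have "(1 + y\<^sup>2) powr (1/2 - 1) = inverse (S y)"
      unfolding S_def by (simp add: powr_minus[symmetric])
    ultimately show ?thesis by (simp add: field_simps)
  qed
  have dp: "(p has_real_derivative p y / S y) (at y)" for y
    unfolding p_def[abs_def] using S0[of y]
    by (auto intro!: derivative_eq_intros dS simp: field_simps)
  have de: "(e has_real_derivative \<nu> * e y / S y) (at y)" for y
  proof -
    have "(e has_real_derivative \<nu> * p y powr (\<nu> - 1) * (p y / S y)) (at y)"
      unfolding e_def[abs_def] by (rule DERIV_fun_powr[OF dp p0, THEN DERIV_cong]) simp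
    moreover have "p y powr (\<nu> - 1) * p y = e y"
      unfolding e_def using p0[of y] by (simp add: powr_diff)
    ultimately show ?thesis by (metis mult.assoc times_divide_eq_right)
  qed
  have dh: "(h has_real_derivative h' y) (at y)" for y
  proof -
    have "((\<lambda>y. 1 + inverse (1 + e y)) has_real_derivative h' y) (at y)"
      using e0[of y] S0[of y]
      by (auto intro!: derivative_eq_intros de simp: h'_def field_simps power2_eq_square)
    moreover have "h = (\<lambda>y. 1 + inverse (1 + e y))"
      using e0 by (auto simp: h_def fun_eq_iff powr_minus less_imp_le add_nonneg_nonneg)
    ultimately show ?thesis by simp
  qed
  have h12: "1 \<le> h y" "h y \<le> 2" for y
  proof -
    show "1 \<le> h y" by (simp add: h_def)
    show "h y \<le> 2" using e0[of y] by (simp add: h_def powr_minus field_simps add_pos_pos less_imp_le)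
  qed
  have h'neg: "h' y < 0" for y unfolding h'_def using e0[of y] S0[of y] assms by (auto simp: zero_less_mult_iff)
  have h'b: "- \<nu> \<le> h' y" for y
  proof -
    have "e y \<le> 1 * (1 + e y)\<^sup>2" using e0[of y] by (simp add: power2_eq_square algebra_simps)
    also have "\<dots> \<le> S y * (1 + e y)\<^sup>2" using S1[of y] by (intro mult_right_mono) auto
    finally show ?thesis unfolding h'_def using assms S0[of y] e0[of y] 
      by (simp add: divide_le_eq add_pos_pos zero_less_mult_iff)
  qed
  have bnd: "1 \<le> - h' y * (K * (1 + \<bar>y\<bar>) powr (1 + \<nu>))" for y
  proof -
    define m where "m = (2 * (1 + \<bar>y\<bar>)) powr \<nu>"
    have p_le: "p y \<le> 2 * (1 + \<bar>y\<bar>)" using S3[of y] by (auto simp: p_def)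
    have "p y * (S y - y) = 1" using S2[of y] by (simp add: p_def power2_eq_square algebra_simps)
    then have "inverse (p y) = S y - y" by (metis inverse_unique)
    then have pi: "inverse (p y) \<le> 2 * (1 + \<bar>y\<bar>)" using S3[of y] by auto
    have e_le: "e y \<le> m" unfolding e_def m_def using p_le p0[of y] assms by (intro powr_mono2) auto
    have "inverse (e y) = inverse (p y) powr \<nu>" unfolding e_def using p0[of y] by (simp add: inverse_powr)
    also have "\<dots> \<le> m" unfolding m_def using pi p0[of y] assms by (intro powr_mono2) auto
    finally have ei_le: "inverse (e y) \<le> m" .
    have m1: "1 \<le> m" unfolding m_def using assms by (intro ge_one_powr_ge_zero) auto
    \<comment> \<open>After division by \<open>e\<close> the square becomes
      \<open>e + 2 + 1 / e\<close>, which is symmetric in \<open>e\<close> and \<open>1 / e\<close>.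
      Both are at most \<open>m\<close>, and \<open>1 \<le> m\<close> covers the 2, whence the
      factor 4.\<close>
    have "(1 + e y)\<^sup>2 = e y * (e y + 2 + inverse (e y))"
      using e0[of y] by (simp add: power2_eq_square field_simps)
    also have "\<dots> \<le> e y * (4 * m)"
      using e_le ei_le m1 e0[of y] by (intro mult_left_mono) auto
    finally have 1: "(1 + e y)\<^sup>2 \<le> 4 * m * e y" by (simp add: mult_ac)
    have "S y * (1 + e y)\<^sup>2 \<le> (1 + \<bar>y\<bar>) * (4 * m * e y)"
      using S3[of y] 1 S0[of y] by (intro mult_mono) auto
    also have "m = 2 powr \<nu> * (1 + \<bar>y\<bar>) powr \<nu>" unfolding m_def by (subst powr_mult) auto
    also have "(1 + \<bar>y\<bar>) * (4 * (2 powr \<nu> * (1 + \<bar>y\<bar>) powr \<nu>) * e y) =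
       \<nu> * e y * (K * (1 + \<bar>y\<bar>) powr (1 + \<nu>))"
      using assms by (simp add: K_def powr_add)
    finally show ?thesis unfolding h'_def using e0[of y] S0[of y] 
      by (simp add: le_divide_eq add_pos_pos zero_less_mult_iff)
  qed
  have conth: "continuous_on UNIV h" using C_k_on_imp_continuous[OF ch] .
  \<comment> \<open>Continuity of \<open>h\<close> yields an antiderivative on the whole line; it is
    then shifted so that \<open>H 0 = 0\<close>, which makes \<open>H\<close> non-negative on
    non-negative arguments.\<close>
  obtain H0 where H0: "\<And>y. (H0 has_vector_derivative h y) (at y)"
    using einterval_antiderivative[of "-\<infinity>" "\<infinity>" h] conth
    by (auto simp: continuous_on_eq_continuous_at)
  define H where "H y = H0 y - H0 0" for y
  have dH: "(H has_real_derivative h y) (at y)" for y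
    unfolding H_def[abs_def] using H0[of y]
    by (auto intro!: derivative_eq_intros simp: has_real_derivative_iff_has_vector_derivative)
  have cH: "C_k_on k UNIV H" for k
    by (rule C_k_on_Suc_imp, rule C_k_on_SucI_real[OF _ dH ch]) auto
  have "test_nonlinearity \<nu> h h' H K"
    using ch cH dh dH h12 h'neg h'b bnd assms by (auto simp: test_nonlinearity_def H_def K_def)
  then show ?thesis by blast
qed

section \<open>Derivatives, integration by parts and quadratic forms\<close>

lemma frechet_derivative_mult:
  fixes f g :: "'a::euclidean_space \<Rightarrow> real"
  assumes "f differentiable (at z)" "g differentiable (at z)"
  shows "frechet_derivative (\<lambda>z. f z * g z) (at z) b =
    f z * frechet_derivative g (at z) b + frechet_derivative f (at z) b * g z"
  using frechet_derivative_at[OF has_derivative_mult[OF assms[unfolded frechet_derivative_works]]]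
  by metis

lemma frechet_derivative_diff:
  fixes f g :: "'a::euclidean_space \<Rightarrow> real"
  assumes "f differentiable (at z)" "g differentiable (at z)"
  shows "frechet_derivative (\<lambda>z. f z - g z) (at z) b =
    frechet_derivative f (at z) b - frechet_derivative g (at z) b"
  using frechet_derivative_at[OF has_derivative_diff[OF assms[unfolded frechet_derivative_works]]]
  by metis

lemma frechet_derivative_compose_real:
  fixes f :: "'a::euclidean_space \<Rightarrow> real"
  assumes "f differentiable (at z)" "(h has_real_derivative d) (at (f z))"
  shows "frechet_derivative (\<lambda>z. h (f z)) (at z) b = d * frechet_derivative f (at z) b"
  using frechet_derivative_at[OF has_derivative_compose[OF assms(1)[unfolded frechet_derivative_works]
      assms(2)[unfolded has_field_derivative_def]]]
  by metis

lemma frechet_derivative_eq_0: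
  fixes f :: "'a::euclidean_space \<Rightarrow> real"
  assumes "open U" "z \<in> U" "\<And>y. y \<in> U \<Longrightarrow> f y = c"
  shows "frechet_derivative f (at z) b = 0"
proof -
  have "frechet_derivative f (at z) = frechet_derivative (\<lambda>_. c) (at z)"
    by (rule sym, rule frechet_derivative_transform_within_open[OF _ assms(1,2)]) (use assms in auto)
  then show ?thesis by simp
qed

lemma deriv_t_Basis: "(1, 0) \<in> (Basis :: (real \<times> (real ^ 'n)) set)"
  and deriv_x_Basis: "(0, axis i 1) \<in> (Basis :: (real \<times> (real ^ 'n)) set)"
  by (auto simp: Basis_prod_def Basis_vec_def)

lemma C_k_on_imp_continuous_deriv:
  assumes "C_k_on (Suc k) S f"
  shows "continuous_on S (deriv_t f)" "continuous_on S (deriv_x i f)"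
proof -
  have "C_k_on k S (\<lambda>z. frechet_derivative f (at z) b)" if "b \<in> Basis" for b
    using assms that by (simp only: C_k_on.simps)
  from C_k_on_imp_continuous[OF this[OF deriv_t_Basis]] C_k_on_imp_continuous[OF this[OF deriv_x_Basis]]
  show "continuous_on S (deriv_t f)" "continuous_on S (deriv_x i f)"
    by (simp_all add: deriv_t_def[abs_def] deriv_x_def[abs_def])
qed

text \<open>The open sets \<open>P\<close> and \<open>- K\<close> cover the space, and
  \<open>f\<close> is zero on the second. So smoothness has to be known on \<open>P\<close> only, as
  is the case for functions built from approximating sequences.\<close>

lemma C_k_on_extend:
  fixes f :: "'a::euclidean_space \<Rightarrow> real"
  assumes "open P" "C_k_on k P f" "closed K" "K \<subseteq> P" "\<And>z. z \<notin> K \<Longrightarrow> f z = 0"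
  shows "C_k_on k UNIV f"
proof -
  have "C_k_on k (- K) f"
    by (rule C_k_on_cong[OF _ _ C_k_on_const[of _ _ 0]]) (use assms in auto)
  then have "C_k_on k (P \<union> - K) f" using assms by (intro C_k_on_Un) auto
  moreover have "P \<union> - K = UNIV" using assms by auto
  ultimately show ?thesis by simp
qed

lemma open_halfspace: "open \<S>"
  unfolding halfspace_def by (auto intro!: open_Times)

lemma test_function_onI:
  assumes "open P" "C_infinity_on P f" "compact K" "K \<subseteq> P" "P \<subseteq> \<S>" "\<And>z. z \<notin> K \<Longrightarrow> f z = 0"
  shows "test_function_on \<S> f"
proof -
  have "C_k_on k \<S> f" for k
    using assms C_k_on_extend[of P k f K] C_k_on_subset[of k UNIV f \<S>]
    by (auto simp: C_infinity_on_def compact_imp_closed)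
  moreover have cl: "closure {z\<in>\<S>. f z \<noteq> 0} \<subseteq> K"
    using assms by (intro closure_minimal) (auto simp: compact_imp_closed)
  moreover have "compact (closure {z\<in>\<S>. f z \<noteq> 0})"
    using compact_Int_closed[OF assms(3) closed_closure[of "{z\<in>\<S>. f z \<noteq> 0}"]] unfolding Int_absorb1[OF cl] .
  ultimately show ?thesis
    using assms(4,5) by (auto simp: test_function_on_def C_infinity_on_def)
qed

text \<open>Fubini, then the fundamental theorem of calculus on each line parallel to the time axis.
  This is the only integration by parts of the proof; it later removes the time derivative of
  \<open>H (F m z / \<mu>) * \<zeta> z\<close>.\<close>

lemma integral_deriv_t_eq_0:
  fixes g :: "real \<times> (real ^ 'n) \<Rightarrow> real"
  assumes g: "C_k_on 1 UNIV g" and K: "compact K" and out: "\<And>z. z \<notin> K \<Longrightarrow> g z = 0"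
  shows "integrable lebesgue (deriv_t g)" "(LINT z|lebesgue. deriv_t g z) = 0"
proof -
  have cont: "continuous_on UNIV (deriv_t g)"
    by (rule C_k_on_imp_continuous_deriv[OF g[unfolded One_nat_def]])
  have dg: "(g has_derivative frechet_derivative g (at z)) (at z)" for z
    by (rule C_k_on_has_derivative[OF g[unfolded One_nat_def]]) simp
  have zero: "deriv_t g z = 0" if "z \<notin> K" for z
    unfolding deriv_t_def
    by (rule frechet_derivative_eq_0[of "- K" _ _ 0]) (use that K out in \<open>auto simp: compact_imp_closed\<close>)
  have "integrable lborel (\<lambda>z. indicator K z *\<^sub>R deriv_t g z)"
    by (rule borel_integrable_compact[OF K]) (use cont continuous_on_subset in blast)
  also have "(\<lambda>z. indicator K z *\<^sub>R deriv_t g z) = deriv_t g"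
    using zero by (auto simp: indicator_def fun_eq_iff)
  finally have int: "integrable lborel (deriv_t g)" .
  have meas: "deriv_t g \<in> borel_measurable lborel"
    using int by auto
  show "integrable lebesgue (deriv_t g)"
    using int meas by (simp add: integrable_completion)
  obtain b where b: "\<And>z. z \<in> K \<Longrightarrow> norm z \<le> b"
    using K compact_imp_bounded bounded_iff by metis
  \<comment> \<open>The added 1 makes \<open>B\<close> strictly larger than every time in
    \<open>K\<close>, so \<open>g\<close> vanishes at the end points \<open>B\<close> and
    \<open>- B\<close> themselves.\<close>
  define B where "B = max b 0 + 1"
  have B_pos: "0 < B" by (simp add: B_def)
  have B: "\<bar>t\<bar> < B" if "(t, x) \<in> K" for t x
    using b[OF that] norm_fst_le[of "(t,x)"] norm_fst_le[of t x] by (auto simp: B_def)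
  have inner: "(\<integral>t. deriv_t g (t, x) \<partial>lborel) = 0" for x
  proof -
    have eq: "(\<lambda>t. deriv_t g (t, x)) = (\<lambda>t. indicator {-B..B} t *\<^sub>R deriv_t g (t, x))"
      using zero B by (force simp: indicator_def fun_eq_iff)
    have "(\<integral>t. indicator {-B..B} t *\<^sub>R deriv_t g (t, x) \<partial>lborel) = g (B, x) - g (-B, x)"
    proof (rule integral_FTC_atLeastAtMost)
      fix t
      have "((\<lambda>t. g (t, x)) has_derivative (\<lambda>h. frechet_derivative g (at (t, x)) (h, 0))) (at t within {-B..B})"
        by (rule has_derivative_compose[OF _ dg]) (auto intro!: derivative_eq_intros)
      moreover have "frechet_derivative g (at (t, x)) (h, 0) = h *\<^sub>R deriv_t g (t, x)" for h
        using linear_scale[OF has_derivative_linear[OF dg[of "(t,x)"]], of h "(1, 0)"] by (simp add: deriv_t_def)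
      ultimately show "((\<lambda>t. g (t, x)) has_vector_derivative deriv_t g (t, x)) (at t within {-B..B})"
        by (simp add: has_vector_derivative_def)
    next
      show "continuous_on {-B..B} (\<lambda>t. deriv_t g (t, x))"
        by (rule continuous_on_compose2[OF cont]) (auto intro!: continuous_intros)
    next
      show "- B \<le> B" using B_pos by simp
    qed
    also have "\<dots> = 0"
    proof -
      have "(B, x) \<notin> K" "(- B, x) \<notin> K" using B[of B x] B[of "- B" x] B_pos by auto
      then show ?thesis using out by simp
    qed
    finally show ?thesis using eq by simp
  qed
  have "integrable (lborel \<Otimes>\<^sub>M lborel) (case_prod (\<lambda>t x. deriv_t g (t, x)))"
    using int by (simp add: lborel_prod)
  from lborel_pair.integral_snd[OF this]
  have "(\<integral>z. deriv_t g z \<partial>lborel) = 0"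
    by (simp add: inner lborel_prod)
  then show "(LINT z|lebesgue. deriv_t g z) = 0"
    using meas by (simp add: integral_completion)
qed

section \<open>Quadratic forms with the coefficients frozen at a point\<close>

definition bform :: "('n::finite \<Rightarrow> 'n \<Rightarrow> real) \<Rightarrow> real ^ 'n \<Rightarrow> real ^ 'n \<Rightarrow> real"
  where "bform m X Y = (\<Sum>i\<in>UNIV. \<Sum>j\<in>UNIV. m i j * X $ i * Y $ j)"

definition grad_x :: "(real \<times> (real ^ 'n) \<Rightarrow> real) \<Rightarrow> real \<times> (real ^ 'n) \<Rightarrow> real ^ 'n"
  where "grad_x f z = (\<chi> i. deriv_x i f z)"

lemma a_form_eq_bform: "a_form a f g z = bform (\<lambda>i j. a i j z) (grad_x f z) (grad_x g z)"
  by (simp add: a_form_def bform_def grad_x_def)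

lemma bform_linear:
  "bform m (X + Y) Z = bform m X Z + bform m Y Z"
  "bform m Z (X + Y) = bform m Z X + bform m Z Y"
  "bform m (X - Y) Z = bform m X Z - bform m Y Z"
  "bform m Z (X - Y) = bform m Z X - bform m Z Y"
  "bform m (r *\<^sub>R X) Z = r * bform m X Z"
  "bform m Z (r *\<^sub>R X) = r * bform m Z X"
  by (simp_all add: bform_def algebra_simps sum.distrib sum_subtractf sum_distrib_left)

definition psd :: "('n::finite \<Rightarrow> 'n \<Rightarrow> real) \<Rightarrow> bool"
  where "psd m \<longleftrightarrow> (\<forall>i j. m i j = m j i) \<and> (\<forall>\<xi>. 0 \<le> bform m \<xi> \<xi>)"

lemma bform_commute: "psd m \<Longrightarrow> bform m X Y = bform m Y X"
  unfolding bform_def psd_def by (subst sum.swap) (simp add: mult_ac)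

lemma bform_nonneg: "psd m \<Longrightarrow> 0 \<le> bform m X X"
  by (simp add: psd_def)

text \<open>Non-negativity of the form at \<open>r *\<^sub>R X + s *\<^sub>R Y\<close>. It takes the
  place of the Cauchy-Schwarz inequality, and degenerate matrices need no separate case.\<close>

lemma bform_square:
  assumes "psd m"
  shows "0 \<le> r\<^sup>2 * bform m X X + 2 * r * s * bform m X Y + s\<^sup>2 * bform m Y Y"
  using bform_nonneg[OF assms, of "r *\<^sub>R X + s *\<^sub>R Y"] bform_commute[OF assms, of Y X]
  by (simp add: bform_linear power2_eq_square algebra_simps)

text \<open>The square with coefficients \<open>2 * e\<close> and 1, and the one with
  \<open>2 * e\<close> and -1, bound the mixed term from both sides.\<close>

lemma bform_young:
  assumes "psd m" "e > 0"
  shows "\<bar>bform m X Y\<bar> \<le> e * bform m X X + bform m Y Y / (4 * e)"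
proof -
  let ?a = "bform m X X" and ?b = "bform m X Y" and ?c = "bform m Y Y"
  have 1: "0 \<le> 4 * e\<^sup>2 * ?a + 4 * e * ?b + ?c" "0 \<le> 4 * e\<^sup>2 * ?a - 4 * e * ?b + ?c"
    using bform_square[OF assms(1), of "2 * e" X 1 Y] bform_square[OF assms(1), of "2 * e" X "-1" Y]
    by (simp_all add: power2_eq_square)
  have "4 * e * \<bar>?b\<bar> \<le> 4 * e\<^sup>2 * ?a + ?c"
    using 1 by (cases "0 \<le> ?b") auto
  also have "\<dots> = 4 * e * (e * ?a + ?c / (4 * e))"
    using assms(2) by (simp add: power2_eq_square distrib_left)
  finally show ?thesis
    by (rule mult_left_le_imp_le) (use assms(2) in simp)
qed

text \<open>By the parallelogram identity the forms at \<open>X + Y\<close> and \<open>X - Y\<close>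
  add up to the right-hand side, and each of them is non-negative.\<close>

lemma bform_add_le:
  assumes "psd m"
  shows "bform m (X + Y) (X + Y) \<le> 2 * bform m X X + 2 * bform m Y Y"
    and "bform m (X - Y) (X - Y) \<le> 2 * bform m X X + 2 * bform m Y Y"
  using bform_nonneg[OF assms, of "X - Y"] bform_nonneg[OF assms, of "X + Y"]
  unfolding bform_linear by linarith+

section \<open>Approximation of weak terms\<close>

text \<open>On one bounded open set the measure \<open>M\<close> is finite, so constants are
  integrable. The matrix is symmetric and non-negative only almost everywhere, which is why
  inequalities for \<open>a_form\<close> below hold in the \<open>AE\<close> sense.\<close>

locale degenerate_form =
  fixes a :: "'n::finite \<Rightarrow> 'n \<Rightarrow> real \<times> (real ^ 'n) \<Rightarrow> real"
    and P :: "(real \<times> (real ^ 'n)) set"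
  assumes open_P: "open P" and bounded_P: "bounded P" and P_sub: "P \<subseteq> \<S>"
    and meas_a: "\<And>i j. a i j \<in> borel_measurable (lebesgue_on P)"
    and psd_a: "AE z in lebesgue_on P. psd (\<lambda>i j. a i j z)"
begin

abbreviation M where "M \<equiv> lebesgue_on P"

lemma lmeasurable_P: "P \<in> lmeasurable"
  by (rule lmeasurable_open[OF bounded_P open_P])

lemma finite_measure_M: "finite_measure M"
  by (rule finite_measure_lebesgue_on[OF lmeasurable_P])

lemma set_integrable_iff: "set_integrable lebesgue P f \<longleftrightarrow> integrable M f" for f :: "_ \<Rightarrow> real"
  using fmeasurableD[OF lmeasurable_P] by (simp add: set_integrable_def integrable_restrict_space)

lemma set_integral_eq: "(LINT z:P|lebesgue. f z) = (LINT z|M. f z)" for f :: "_ \<Rightarrow> real"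
  using fmeasurableD[OF lmeasurable_P] by (simp add: set_lebesgue_integral_def integral_restrict_space)

lemma AE_P: "AE z in M. z \<in> P \<and> psd (\<lambda>i j. a i j z)"
  using psd_a AE_space[of M] by eventually_elim (simp add: space_restrict_space)

lemma measurable_cont: "continuous_on P f \<Longrightarrow> f \<in> borel_measurable M" for f :: "_ \<Rightarrow> real"
  by (intro continuous_imp_measurable_on_sets_lebesgue fmeasurableD[OF lmeasurable_P])

lemma measurable_a_form:
  assumes "C_k_on (Suc 0) P f" "C_k_on (Suc 0) P g"
  shows "a_form a f g \<in> borel_measurable M"
  unfolding a_form_def[abs_def]
  by (intro borel_measurable_sum borel_measurable_times meas_a measurable_cont
      C_k_on_imp_continuous_deriv[OF assms(1)] C_k_on_imp_continuous_deriv[OF assms(2)])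

lemma grad_x_diff:
  assumes "C_k_on (Suc 0) P f" "C_k_on (Suc 0) P g" "z \<in> P"
  shows "grad_x (\<lambda>z. f z - g z) z = grad_x f z - grad_x g z"
  using assms by (auto simp: grad_x_def vec_eq_iff deriv_x_def frechet_derivative_diff)

lemma a_form_diff:
  assumes "C_k_on (Suc 0) P f" "C_k_on (Suc 0) P g" "z \<in> P"
  shows "a_form a \<phi> (\<lambda>z. f z - g z) z = a_form a \<phi> f z - a_form a \<phi> g z"
  using assms by (simp add: a_form_eq_bform grad_x_diff bform_linear)

text \<open>The pointwise Young inequality, integrated. With \<open>e = 1\<close> it also dominates
  the mixed term and so gives integrability; the free \<open>e\<close> serves the case where one
  energy is merely bounded and the other one small.\<close>

lemma
  assumes "C_k_on (Suc 0) P f" "C_k_on (Suc 0) P g"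
    and "integrable M (a_form a f f)" "integrable M (a_form a g g)"
  shows integrable_a_form: "integrable M (a_form a f g)"
    and integral_a_form_young: "e > 0 \<Longrightarrow>
      \<bar>LINT z|M. a_form a f g z\<bar> \<le> e * (LINT z|M. a_form a f f z) + (LINT z|M. a_form a g g z) / (4 * e)"
proof -
  have young: "AE z in M. \<bar>a_form a f g z\<bar> \<le> e * a_form a f f z + a_form a g g z / (4 * e)" if "e > 0" for e
    using AE_P unfolding a_form_eq_bform by eventually_elim (blast intro: bform_young[OF _ that])
  have int: "integrable M (\<lambda>z. e * a_form a f f z + a_form a g g z / (4 * e))" for e
    using assms by auto
  show 1: "integrable M (a_form a f g)"
    by (rule Bochner_Integration.integrable_bound[OF int[of 1] measurable_a_form[OF assms(1,2)]])
       (use young[OF zero_less_one] in \<open>eventually_elim, auto\<close>)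
  show "\<bar>LINT z|M. a_form a f g z\<bar> \<le> e * (LINT z|M. a_form a f f z) + (LINT z|M. a_form a g g z) / (4 * e)"
    if "e > 0"
  proof -
    have "\<bar>LINT z|M. a_form a f g z\<bar> \<le> (LINT z|M. \<bar>a_form a f g z\<bar>)"
      by (rule integral_abs_bound)
    also have "\<dots> \<le> (LINT z|M. e * a_form a f f z + a_form a g g z / (4 * e))"
      by (rule integral_mono_AE) (use 1 int young[OF that] in auto)
    also have "\<dots> = e * (LINT z|M. a_form a f f z) + (LINT z|M. a_form a g g z) / (4 * e)"
      using assms by simp
    finally show ?thesis .
  qed
qed

lemma
  assumes "C_k_on (Suc 0) P f" "C_k_on (Suc 0) P g"
    and "integrable M (a_form a f f)" "integrable M (a_form a g g)"
  shows integrable_a_form_diff: "integrable M (a_form a (\<lambda>z. f z - g z) (\<lambda>z. f z - g z))"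
    and integral_a_form_diff: "(LINT z|M. a_form a (\<lambda>z. f z - g z) (\<lambda>z. f z - g z) z) \<le>
      2 * (LINT z|M. a_form a f f z) + 2 * (LINT z|M. a_form a g g z)"
proof -
  let ?d = "\<lambda>z. f z - g z"
  have le: "AE z in M. 0 \<le> a_form a ?d ?d z \<and> a_form a ?d ?d z \<le> 2 * a_form a f f z + 2 * a_form a g g z"
    using AE_P
    by eventually_elim (use assms in \<open>simp add: a_form_eq_bform grad_x_diff bform_add_le bform_nonneg\<close>)
  have int: "integrable M (\<lambda>z. 2 * a_form a f f z + 2 * a_form a g g z)"
    using assms by auto
  have cd: "C_k_on (Suc 0) P ?d" using C_k_on_diff[OF open_P assms(1,2)] .
  show 1: "integrable M (a_form a ?d ?d)"
    by (rule Bochner_Integration.integrable_bound[OF int measurable_a_form[OF cd cd]])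
       (use le in \<open>eventually_elim, auto\<close>)
  have "(LINT z|M. a_form a ?d ?d z) \<le> (LINT z|M. 2 * a_form a f f z + 2 * a_form a g g z)"
    by (rule integral_mono_AE) (use 1 int le in auto)
  then show "(LINT z|M. a_form a ?d ?d z) \<le> 2 * (LINT z|M. a_form a f f z) + 2 * (LINT z|M. a_form a g g z)"
    using assms by simp
qed

section \<open>Energy bounds along Cauchy sequences\<close>

lemma W_Cauchy_D:
  assumes "W_Cauchy a q P F"
  shows "C_k_on j P (F k)" "integrable M (deriv_t (F k))" "integrable M (a_form a (F k) (F k))"
    "integrable M (\<lambda>z. \<bar>F k z\<bar> powr qhat q)"
    and "e > 0 \<Longrightarrow> \<exists>N. \<forall>k\<ge>N. \<forall>m\<ge>N.
      (LINT z|M. a_form a (\<lambda>z. F k z - F m z) (\<lambda>z. F k z - F m z) z) < e"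
proof -
  have F: "C_infinity_on P (F k)" "W_finite a q P (F k)" for k
    using assms by (auto simp: W_Cauchy_def)
  show C: "C_k_on j P (F k)" for j k using F by (simp add: C_infinity_on_def)
  have "deriv_t (F k) \<in> borel_measurable M"
    using C[of "Suc 0"] by (intro measurable_cont C_k_on_imp_continuous_deriv)
  moreover have "integrable M (\<lambda>z. \<bar>deriv_t (F k) z\<bar>)"
    using F by (simp add: W_finite_def set_integrable_iff)
  ultimately show "integrable M (deriv_t (F k))"
    by (auto intro!: integrable_norm_cancel[of M "deriv_t (F k)"])
  show "integrable M (a_form a (F k) (F k))" "integrable M (\<lambda>z. \<bar>F k z\<bar> powr qhat q)"
    using F by (simp_all add: W_finite_def set_integrable_iff)
  assume "e > 0"
  \<comment> \<open>The threshold is \<open>sqrt e\<close> because \<open>W_norm\<close> contains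
    the square root of the energy and its other terms are non-negative.\<close>
  then obtain N where N: "\<And>k m. k \<ge> N \<Longrightarrow> m \<ge> N \<Longrightarrow> W_norm a q P (\<lambda>z. F k z - F m z) < sqrt e"
    using assms by (metis W_Cauchy_def real_sqrt_gt_zero)
  have "(LINT z|M. a_form a (\<lambda>z. F k z - F m z) (\<lambda>z. F k z - F m z) z) < e" if "k \<ge> N" "m \<ge> N" for k m
  proof -
    let ?d = "\<lambda>z. F k z - F m z"
    have "0 \<le> (LINT z:P|lebesgue. \<bar>deriv_t ?d z\<bar>)"
      unfolding set_integral_eq by (rule Bochner_Integration.integral_nonneg) simp
    then have "sqrt (LINT z|M. a_form a ?d ?d z) \<le> W_norm a q P ?d"
      unfolding W_norm_def set_integral_eq by simp
    then have "sqrt (LINT z|M. a_form a ?d ?d z) < sqrt e" using N[OF that] by (rule le_less_trans)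
    then show ?thesis by simp
  qed
  then show "\<exists>N. \<forall>k\<ge>N. \<forall>m\<ge>N.
      (LINT z|M. a_form a (\<lambda>z. F k z - F m z) (\<lambda>z. F k z - F m z) z) < e" by blast
qed

lemma W_Cauchy_bounded:
  assumes "W_Cauchy a q P F"
  obtains B where "\<And>k. (LINT z|M. a_form a (F k) (F k) z) \<le> B"
proof -
  note F = W_Cauchy_D[OF assms]
  obtain N where N: "\<And>k m. k \<ge> N \<Longrightarrow> m \<ge> N \<Longrightarrow>
      (LINT z|M. a_form a (\<lambda>z. F k z - F m z) (\<lambda>z. F k z - F m z) z) < 1"
    using F(5)[of 1] by auto
  let ?I = "\<lambda>k. LINT z|M. a_form a (F k) (F k) z"
  \<comment> \<open>The maximum covers the indices up to \<open>N\<close>. The next summand is the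
    parallelogram bound for later ones, where the energy of \<open>F k - F N\<close> is below
    1.\<close>
  define B where "B = Max (?I ` {..N}) + (2 + 2 * ?I N) + \<bar>?I N\<bar> * 2"
  have nn: "0 \<le> ?I k" for k
    by (rule integral_nonneg_AE)
       (use AE_P in \<open>eventually_elim, auto simp: a_form_eq_bform bform_nonneg\<close>)
  have "?I 0 \<le> Max (?I ` {..N})" by (intro Max_ge) auto
  then have Max: "0 \<le> Max (?I ` {..N})" using nn[of 0] by linarith
  have "?I k \<le> B" for k
  proof (cases "k \<le> N")
    case True
    then have "?I k \<le> Max (?I ` {..N})" by (intro Max_ge) auto
    then show ?thesis using nn[of N] by (simp add: B_def)
  next
    case False
    have "(LINT z|M. a_form a (F k) (F k) z) \<le>
        (LINT z|M. 2 * a_form a (\<lambda>z. F k z - F N z) (\<lambda>z. F k z - F N z) z + 2 * a_form a (F N) (F N) z)"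
    proof (rule integral_mono_AE)
      show "AE z in M. a_form a (F k) (F k) z \<le>
          2 * a_form a (\<lambda>z. F k z - F N z) (\<lambda>z. F k z - F N z) z + 2 * a_form a (F N) (F N) z"
        using AE_P
      proof eventually_elim
        case (elim z)
        then show ?case
          using bform_add_le(1)[of "\<lambda>i j. a i j z" "grad_x (F k) z - grad_x (F N) z" "grad_x (F N) z"]
          by (simp add: a_form_eq_bform grad_x_diff[OF F(1) F(1)])
      qed
    qed (use F integrable_a_form_diff[OF F(1,1,3,3)] in auto)
    also have "\<dots> = 2 * (LINT z|M. a_form a (\<lambda>z. F k z - F N z) (\<lambda>z. F k z - F N z) z) + 2 * ?I N"
      using F integrable_a_form_diff[OF F(1,1,3,3)] by simp
    also have "\<dots> \<le> 2 * 1 + 2 * ?I N" using N[of k N] False by simp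
    also have "\<dots> \<le> B"
      using nn[of N] Max by (simp add: B_def)
    finally show ?thesis .
  qed
  then show thesis by (rule that)
qed

lemma converges_Lp_1:
  assumes "converges_Lp 1 P F g" "\<And>k. integrable M (F k)"
  shows "integrable M g" "(\<lambda>k. LINT z|M. \<bar>F k z - g z\<bar>) \<longlonglongrightarrow> 0"
proof -
  have g: "g \<in> borel_measurable M" and i: "\<And>k. integrable M (\<lambda>z. \<bar>F k z - g z\<bar>)"
    and l: "(\<lambda>k. LINT z|M. \<bar>F k z - g z\<bar>) \<longlonglongrightarrow> 0"
    using assms(1) by (simp_all add: converges_Lp_def set_integrable_iff set_integral_eq)
  have "integrable M (\<lambda>z. F 0 z - g z)"
    using i[of 0] g assms(2)[of 0] integrable_norm_cancel[of M "\<lambda>z. F 0 z - g z"] by simp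
  from Bochner_Integration.integrable_diff[OF assms(2)[of 0] this] show "integrable M g" by simp
  show "(\<lambda>k. LINT z|M. \<bar>F k z - g z\<bar>) \<longlonglongrightarrow> 0" by (rule l)
qed

end

lemma powr_add_le:
  fixes x y :: real
  assumes "0 \<le> q"
  shows "\<bar>x + y\<bar> powr q \<le> 2 powr q * (\<bar>x\<bar> powr q + \<bar>y\<bar> powr q)"
proof -
  let ?m = "max \<bar>x\<bar> \<bar>y\<bar>"
  have "\<bar>x + y\<bar> powr q \<le> (2 * ?m) powr q"
    using assms by (intro powr_mono2) auto
  also have "\<dots> = 2 powr q * ?m powr q" by (simp add: powr_mult)
  also have "\<dots> \<le> 2 powr q * (\<bar>x\<bar> powr q + \<bar>y\<bar> powr q)"
    by (intro mult_left_mono) (auto simp: max_def)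
  finally show ?thesis .
qed

context degenerate_form
begin

section \<open>Passing to the limit in the weak form\<close>

lemma L1_tendsto_integral:
  fixes f :: "nat \<Rightarrow> _ \<Rightarrow> real"
  assumes "\<And>k. integrable M (f k)" "integrable M g" "(\<lambda>k. LINT z|M. \<bar>f k z - g z\<bar>) \<longlonglongrightarrow> 0"
  shows "(\<lambda>k. LINT z|M. f k z) \<longlonglongrightarrow> (LINT z|M. g z)"
proof -
  have "(\<lambda>k. (LINT z|M. f k z) - (LINT z|M. g z)) \<longlonglongrightarrow> 0"
  proof (rule tendsto_rabs_zero_cancel, rule tendsto_sandwich[OF _ _ tendsto_const assms(3)])
    show "\<forall>\<^sub>F k in sequentially. \<bar>(LINT z|M. f k z) - (LINT z|M. g z)\<bar> \<le> (LINT z|M. \<bar>f k z - g z\<bar>)"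
      using assms integral_abs_bound[of M "\<lambda>z. f _ z - g z"] by (intro always_eventually) simp
  qed auto
  then show ?thesis by (simp add: LIM_zero_iff)
qed

lemma integrable_mult_bounded:
  fixes f \<phi> :: "_ \<Rightarrow> real"
  assumes "integrable M f" "\<phi> \<in> borel_measurable M" "\<And>z. z \<in> P \<Longrightarrow> \<bar>\<phi> z\<bar> \<le> C"
  shows "integrable M (\<lambda>z. f z * \<phi> z)"
proof (rule Bochner_Integration.integrable_bound[where f = "\<lambda>z. C * f z"])
  show "AE z in M. norm (f z * \<phi> z) \<le> norm (C * f z)"
    using AE_P
  proof eventually_elim
    case (elim z)
    then have "\<bar>\<phi> z\<bar> \<le> \<bar>C\<bar>" using assms(3)[of z] by auto
    then show ?case by (simp add: abs_mult mult.commute mult_right_mono)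
  qed
qed (use assms in auto)

lemma test_function_P:
  assumes "test_function_on \<S> \<phi>"
  shows "C_k_on k P \<phi>" "\<phi> \<in> borel_measurable M"
proof -
  show C: "C_k_on k P \<phi>" for k
    using assms C_k_on_subset[OF _ P_sub] by (auto simp: test_function_on_def C_infinity_on_def)
  show "\<phi> \<in> borel_measurable M"
    by (rule measurable_cont[OF C_k_on_imp_continuous[OF C]])
qed

text \<open>The test functions vary with \<open>m\<close>, while the convergence defining
  \<open>G\<close> is known for one test function at a time. For the time term the uniform bound
  \<open>C\<close> and convergence in the mean suffice. For the gradient term \<open>m\<close> is
  fixed and \<open>F k\<close> is compared with \<open>F m\<close>: by Young's inequality the
  difference is at most \<open>d\<close> times the energy of \<open>\<phi> m\<close> plus the energy
  of \<open>F k - F m\<close> divided by \<open>4 * d\<close>, which is small for all large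
  \<open>k\<close> and \<open>m\<close>.\<close>

lemma approx_weak_terms:
  assumes F: "W_Cauchy a q P F"
    and wt: "converges_Lp 1 P (\<lambda>k. deriv_t (F k)) wt"
    and G: "\<And>\<phi>. test_function_on \<S> \<phi> \<Longrightarrow>
        converges_Lp 1 P (\<lambda>k. a_form a \<phi> (F k)) (\<lambda>z. \<Sum>i\<in>UNIV. deriv_x i \<phi> z * G z $ i)"
    and \<phi>: "\<And>m. test_function_on \<S> (\<phi> m)" "\<And>m z. z \<in> P \<Longrightarrow> \<bar>\<phi> m z\<bar> \<le> C"
      "\<And>m. integrable M (a_form a (\<phi> m) (\<phi> m))" "\<And>m. (LINT z|M. a_form a (\<phi> m) (\<phi> m) z) \<le> B"
  shows "integrable M (\<lambda>z. wt z * \<phi> m z)"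
    and "integrable M (\<lambda>z. \<Sum>i\<in>UNIV. deriv_x i (\<phi> m) z * G z $ i)"
    and "integrable M (\<lambda>z. deriv_t (F k) z * \<phi> m z)"
    and "integrable M (a_form a (\<phi> m) (F k))"
    and "(\<lambda>m. (LINT z|M. wt z * \<phi> m z) + (LINT z|M. (\<Sum>i\<in>UNIV. deriv_x i (\<phi> m) z * G z $ i)) -
      ((LINT z|M. deriv_t (F m) z * \<phi> m z) + (LINT z|M. a_form a (\<phi> m) (F m) z))) \<longlonglongrightarrow> 0"
proof -
  note FD = W_Cauchy_D[OF F]
  note \<phi>P = test_function_P[OF \<phi>(1)]
  note wt1 = converges_Lp_1[OF wt FD(2)]
  show i1: "integrable M (\<lambda>z. wt z * \<phi> m z)" for m
    by (rule integrable_mult_bounded[OF wt1(1) \<phi>P(2) \<phi>(2)])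
  show i3: "integrable M (\<lambda>z. deriv_t (F k) z * \<phi> m z)" for k m
    by (rule integrable_mult_bounded[OF FD(2) \<phi>P(2) \<phi>(2)])
  show i4: "integrable M (a_form a (\<phi> m) (F k))" for k m
    by (rule integrable_a_form[OF \<phi>P(1) FD(1) \<phi>(3) FD(3)])
  note G1 = converges_Lp_1[OF G[OF \<phi>(1)] i4]
  show i2: "integrable M (\<lambda>z. \<Sum>i\<in>UNIV. deriv_x i (\<phi> m) z * G z $ i)" for m
    by (rule G1(1))
  have "(\<lambda>m. (LINT z|M. wt z * \<phi> m z) - (LINT z|M. deriv_t (F m) z * \<phi> m z)) \<longlonglongrightarrow> 0"
  proof (rule tendsto_rabs_zero_cancel, rule tendsto_sandwich[OF _ _ tendsto_const])
    have "(\<lambda>m. C * (LINT z|M. \<bar>deriv_t (F m) z - wt z\<bar>)) \<longlonglongrightarrow> C * 0"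
      by (intro tendsto_mult_left wt1(2))
    then show "(\<lambda>m. C * (LINT z|M. \<bar>deriv_t (F m) z - wt z\<bar>)) \<longlonglongrightarrow> 0" by simp
    have "\<bar>(LINT z|M. wt z * \<phi> m z) - (LINT z|M. deriv_t (F m) z * \<phi> m z)\<bar> \<le>
        C * (LINT z|M. \<bar>deriv_t (F m) z - wt z\<bar>)" for m
    proof -
      have "\<bar>(LINT z|M. wt z * \<phi> m z) - (LINT z|M. deriv_t (F m) z * \<phi> m z)\<bar> =
          \<bar>LINT z|M. wt z * \<phi> m z - deriv_t (F m) z * \<phi> m z\<bar>"
        using i1 i3 by simp
      also have "\<dots> \<le> (LINT z|M. \<bar>wt z * \<phi> m z - deriv_t (F m) z * \<phi> m z\<bar>)"
        by (rule integral_abs_bound)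
      also have "\<dots> \<le> (LINT z|M. C * \<bar>deriv_t (F m) z - wt z\<bar>)"
      proof (rule integral_mono_AE)
        show "integrable M (\<lambda>z. C * \<bar>deriv_t (F m) z - wt z\<bar>)"
          using FD(2) wt1(1) by auto
        show "AE z in M. \<bar>wt z * \<phi> m z - deriv_t (F m) z * \<phi> m z\<bar> \<le> C * \<bar>deriv_t (F m) z - wt z\<bar>"
          using AE_P
        proof eventually_elim
          case (elim z)
          have "\<bar>wt z * \<phi> m z - deriv_t (F m) z * \<phi> m z\<bar> = \<bar>\<phi> m z\<bar> * \<bar>deriv_t (F m) z - wt z\<bar>"
            by (subst abs_minus_commute) (simp add: algebra_simps flip: abs_mult)
          also have "\<dots> \<le> C * \<bar>deriv_t (F m) z - wt z\<bar>"
            using \<phi>(2) elim by (intro mult_right_mono) auto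
          finally show ?case .
        qed
      qed (use i1 i3 in auto)
      finally show ?thesis by simp
    qed
    then show "\<forall>\<^sub>F m in sequentially. \<bar>(LINT z|M. wt z * \<phi> m z) - (LINT z|M. deriv_t (F m) z * \<phi> m z)\<bar> \<le>
        C * (LINT z|M. \<bar>deriv_t (F m) z - wt z\<bar>)" by simp
  qed auto
  moreover have "(\<lambda>m. (LINT z|M. (\<Sum>i\<in>UNIV. deriv_x i (\<phi> m) z * G z $ i)) - (LINT z|M. a_form a (\<phi> m) (F m) z))
      \<longlonglongrightarrow> 0"
  proof (rule LIMSEQ_I)
    fix r :: real assume "0 < r"
    \<comment> \<open>A limit preserves weak inequalities only, so the target is
      \<open>e < r\<close>. The choice of \<open>d\<close> gives \<open>d * B \<le> e / 2\<close>,
      and the threshold \<open>2 * d * e\<close> below makes the other Young term at most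
      \<open>e / 2\<close>.\<close>
    define e where "e = r / 2"
    define d where "d = e / (2 * (\<bar>B\<bar> + 1))"
    have e: "0 < e" "e < r" and d: "0 < d"
      using \<open>0 < r\<close> by (auto simp: e_def d_def)
    have dB: "d * B \<le> e / 2"
    proof -
      have "d * B \<le> d * (\<bar>B\<bar> + 1)" using d by (intro mult_left_mono) auto
      also have "\<dots> = e / 2" by (simp add: d_def field_simps)
      finally show ?thesis .
    qed
    obtain N where N: "\<And>k m. k \<ge> N \<Longrightarrow> m \<ge> N \<Longrightarrow>
        (LINT z|M. a_form a (\<lambda>z. F k z - F m z) (\<lambda>z. F k z - F m z) z) < 2 * d * e"
      using FD(5)[of "2 * d * e"] d e by auto
    have le_e: "\<bar>(LINT z|M. (\<Sum>i\<in>UNIV. deriv_x i (\<phi> m) z * G z $ i)) - (LINT z|M. a_form a (\<phi> m) (F m) z)\<bar> \<le> e"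
      if m: "m \<ge> N" for m
    proof (rule tendsto_upperbound)
      \<comment> \<open>Here \<open>m\<close> is fixed and \<open>k\<close> tends to infinity, so
        the convergence to \<open>G\<close> is used for the single test function
        \<open>\<phi> m\<close>.\<close>
      show "(\<lambda>k. \<bar>(LINT z|M. a_form a (\<phi> m) (F k) z) - (LINT z|M. a_form a (\<phi> m) (F m) z)\<bar>) \<longlonglongrightarrow>
          \<bar>(LINT z|M. (\<Sum>i\<in>UNIV. deriv_x i (\<phi> m) z * G z $ i)) - (LINT z|M. a_form a (\<phi> m) (F m) z)\<bar>"
        by (intro tendsto_intros L1_tendsto_integral i4 G1)
      have "\<bar>(LINT z|M. a_form a (\<phi> m) (F k) z) - (LINT z|M. a_form a (\<phi> m) (F m) z)\<bar> \<le> e" if k: "k \<ge> N" for k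
      proof -
        let ?d = "\<lambda>z. F k z - F m z"
        have "(LINT z|M. a_form a (\<phi> m) (F k) z) - (LINT z|M. a_form a (\<phi> m) (F m) z) =
            (LINT z|M. a_form a (\<phi> m) (F k) z - a_form a (\<phi> m) (F m) z)"
          using i4 by simp
        also have "\<dots> = (LINT z|M. a_form a (\<phi> m) ?d z)"
          by (rule Bochner_Integration.integral_cong[OF refl])
             (auto simp: space_restrict_space a_form_diff[OF FD(1) FD(1)])
        finally have "\<bar>(LINT z|M. a_form a (\<phi> m) (F k) z) - (LINT z|M. a_form a (\<phi> m) (F m) z)\<bar> =
            \<bar>LINT z|M. a_form a (\<phi> m) ?d z\<bar>" by simp
        also have "\<dots> \<le> d * (LINT z|M. a_form a (\<phi> m) (\<phi> m) z) + (LINT z|M. a_form a ?d ?d z) / (4 * d)"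
          by (rule integral_a_form_young[OF \<phi>P(1) C_k_on_diff[OF open_P FD(1) FD(1)] \<phi>(3)
             integrable_a_form_diff[OF FD(1,1,3,3)] d])
        also have "\<dots> \<le> d * B + (2 * d * e) / (4 * d)"
          using N[OF k m] d \<phi>(4)[of m] by (intro add_mono mult_left_mono divide_right_mono) auto
        also have "\<dots> \<le> e"
          using dB d by simp
        finally show ?thesis .
      qed
      then show "\<forall>\<^sub>F k in sequentially.
          \<bar>(LINT z|M. a_form a (\<phi> m) (F k) z) - (LINT z|M. a_form a (\<phi> m) (F m) z)\<bar> \<le> e"
        by (auto simp: eventually_sequentially)
    qed simp
    show "\<exists>no. \<forall>n\<ge>no. norm ((LINT z|M. (\<Sum>i\<in>UNIV. deriv_x i (\<phi> n) z * G z $ i)) -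
        (LINT z|M. a_form a (\<phi> n) (F n) z) - 0) < r"
      using le_less_trans[OF le_e e(2)] by auto
  qed
  ultimately show "(\<lambda>m. (LINT z|M. wt z * \<phi> m z) + (LINT z|M. (\<Sum>i\<in>UNIV. deriv_x i (\<phi> m) z * G z $ i)) -
      ((LINT z|M. deriv_t (F m) z * \<phi> m z) + (LINT z|M. a_form a (\<phi> m) (F m) z))) \<longlonglongrightarrow> 0"
    by (rule tendsto_eq_rhs[OF tendsto_cong[THEN iffD1, OF _ tendsto_add], rotated]) (auto simp: algebra_simps)
qed

lemma converges_Lq:
  assumes "1 < q" "converges_Lp (qhat q) P F w" "\<And>k. C_k_on 0 P (F k)"
    "\<And>k. integrable M (\<lambda>z. \<bar>F k z\<bar> powr qhat q)"
  shows "w \<in> borel_measurable M" "integrable M (\<lambda>z. \<bar>w z\<bar> powr q)"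
    "integrable M (\<lambda>z. \<bar>F k z - w z\<bar> powr q)"
    "(\<lambda>k. LINT z|M. \<bar>F k z - w z\<bar> powr q) \<longlonglongrightarrow> 0"
proof -
  have q: "qhat q = q" using assms(1) by (simp add: qhat_def)
  show w: "w \<in> borel_measurable M" and i: "integrable M (\<lambda>z. \<bar>F k z - w z\<bar> powr q)"
    and "(\<lambda>k. LINT z|M. \<bar>F k z - w z\<bar> powr q) \<longlonglongrightarrow> 0" for k
    using assms(2) by (simp_all add: converges_Lp_def set_integrable_iff set_integral_eq q)
  show "integrable M (\<lambda>z. \<bar>w z\<bar> powr q)"
  proof (rule Bochner_Integration.integrable_bound)
    show "integrable M (\<lambda>z. 2 powr q * (\<bar>F 0 z\<bar> powr q + \<bar>F 0 z - w z\<bar> powr q))"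
      using i assms(4) by (simp add: q)
    have "\<bar>w z\<bar> powr q \<le> 2 powr q * (\<bar>F 0 z\<bar> powr q + \<bar>F 0 z - w z\<bar> powr q)" for z
      using powr_add_le[of q "F 0 z" "w z - F 0 z"] assms(1) by (simp add: abs_minus_commute)
    then show "AE z in M. norm (\<bar>w z\<bar> powr q) \<le> norm (2 powr q * (\<bar>F 0 z\<bar> powr q + \<bar>F 0 z - w z\<bar> powr q))"
      by (auto intro!: order_trans[OF _ abs_ge_self])
  qed (use w in measurable)
qed

text \<open>The test function and its derivatives vanish off \<open>K\<close>, so \<open>P\<close>
  may replace the half-space; the single integral of \<open>weak_form\<close> then splits because
  its three terms are integrable separately.\<close>

lemma weak_form_eq:
  assumes "1 < q" "w \<in> borel_measurable M" "integrable M (\<lambda>z. \<bar>w z\<bar> powr q)"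
    and "test_function_on \<S> \<phi>" "\<And>z. z \<in> P \<Longrightarrow> \<bar>\<phi> z\<bar> \<le> C"
    and "closed K" "K \<subseteq> P" "\<And>z. z \<notin> K \<Longrightarrow> \<phi> z = 0"
    and "integrable M (\<lambda>z. wt z * \<phi> z)"
    and "integrable M (\<lambda>z. \<Sum>i\<in>UNIV. deriv_x i \<phi> z * G z $ i)"
  shows "integrable M (\<lambda>z. \<bar>w z\<bar> powr (q - 1) * w z * \<phi> z)"
    and "weak_form q w wt G \<phi> = (LINT z|M. wt z * \<phi> z) +
      (LINT z|M. (\<Sum>i\<in>UNIV. deriv_x i \<phi> z * G z $ i)) - (LINT z|M. \<bar>w z\<bar> powr (q - 1) * w z * \<phi> z)"
proof -
  have "integrable M (\<lambda>z. \<bar>w z\<bar> powr (q - 1) * w z)"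
  proof (rule Bochner_Integration.integrable_bound[OF assms(3)])
    have "\<bar>w z\<bar> powr (q - 1) * \<bar>w z\<bar> = \<bar>w z\<bar> powr q" for z
      by (cases "w z = 0") (simp_all add: powr_diff)
    then show "AE z in M. norm (\<bar>w z\<bar> powr (q - 1) * w z) \<le> norm (\<bar>w z\<bar> powr q)"
      by (auto simp: abs_mult)
  qed (use assms(2) in measurable)
  then show i: "integrable M (\<lambda>z. \<bar>w z\<bar> powr (q - 1) * w z * \<phi> z)"
    by (rule integrable_mult_bounded[OF _ test_function_P(2)[OF assms(4)] assms(5)])
  have zero: "deriv_x i \<phi> z = 0" if "z \<notin> K" for z i
    unfolding deriv_x_def
    by (rule frechet_derivative_eq_0[of "- K" _ _ 0]) (use that assms in auto)
  let ?f = "\<lambda>z. wt z * \<phi> z + (\<Sum>i\<in>UNIV. deriv_x i \<phi> z * G z $ i) - \<bar>w z\<bar> powr (q - 1) * w z * \<phi> z"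
  have "indicator \<S> z *\<^sub>R ?f z = indicator P z *\<^sub>R ?f z" for z
  proof (cases "z \<in> K")
    case True
    then have "z \<in> P" "z \<in> \<S>" using assms(7) P_sub by auto
    then show ?thesis by simp
  next
    case False
    then show ?thesis using zero assms(8) by simp
  qed
  then have "weak_form q w wt G \<phi> = (LINT z:P|lebesgue. ?f z)"
    unfolding weak_form_def set_lebesgue_integral_def by (simp only:)
  also have "\<dots> = (LINT z|M. wt z * \<phi> z) +
      (LINT z|M. (\<Sum>i\<in>UNIV. deriv_x i \<phi> z * G z $ i)) - (LINT z|M. \<bar>w z\<bar> powr (q - 1) * w z * \<phi> z)"
    unfolding set_integral_eq
    by (subst Bochner_Integration.integral_diff[OF Bochner_Integration.integrable_add[OF assms(9,10)] i],
        subst Bochner_Integration.integral_add[OF assms(9,10)]) simp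
  finally show "weak_form q w wt G \<phi> = (LINT z|M. wt z * \<phi> z) +
      (LINT z|M. (\<Sum>i\<in>UNIV. deriv_x i \<phi> z * G z $ i)) - (LINT z|M. \<bar>w z\<bar> powr (q - 1) * w z * \<phi> z)" .
qed

end

section \<open>Pointwise inequalities\<close>

text \<open>For equal signs even the constant 1 works, by superadditivity of the \<open>q\<close>-th
  power on non-negative numbers. Opposite signs turn the right-hand side into a sum of powers, which
  costs the factor \<open>2 powr (- q)\<close>.\<close>

lemma powr_diff_ge:
  fixes u v q :: real
  assumes "1 < q" "v \<le> u"
  shows "2 powr (- q) * (u - v) powr q \<le> \<bar>u\<bar> powr (q - 1) * u - \<bar>v\<bar> powr (q - 1) * v"
proof -
  have super: "a powr q + b powr q \<le> (a + b) powr q" if "0 \<le> a" "0 \<le> b" for a b :: real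
  proof -
    have *: "x powr q = x * x powr (q - 1)" if "0 \<le> x" for x :: real
      using that by (cases "x = 0") (simp_all add: powr_diff)
    have "a powr q + b powr q \<le> a * (a + b) powr (q - 1) + b * (a + b) powr (q - 1)"
      using that assms by (simp add: *) (intro add_mono mult_left_mono powr_mono2; simp)
    also have "\<dots> = (a + b) powr q" using that by (simp add: * distrib_right)
    finally show ?thesis .
  qed
  have pw: "\<bar>x\<bar> powr (q - 1) * x = (if 0 \<le> x then x powr q else - ((- x) powr q))" for x
    by (cases "x = 0") (simp_all add: powr_diff)
  have c1: "2 powr (- q) * t \<le> t" if "0 \<le> t" for t
    using that assms by (intro mult_left_le_one_le) (auto simp: powr_minus_divide ge_one_powr_ge_zero)
  consider "0 \<le> v" | "v < 0" "u < 0" | "v < 0" "0 \<le> u" by linarith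
  then show ?thesis
  proof cases
    case 1
    then show ?thesis using super[of v "u - v"] c1[of "(u - v) powr q"] assms unfolding pw by simp
  next
    case 2
    then show ?thesis using super[of "- u" "u - v"] c1[of "(u - v) powr q"] assms unfolding pw by simp
  next
    case 3
    have "\<bar>u + - v\<bar> powr q \<le> 2 powr q * (\<bar>u\<bar> powr q + \<bar>- v\<bar> powr q)"
      by (rule powr_add_le) (use assms in simp)
    then show ?thesis using 3 assms unfolding pw by (simp add: powr_minus field_simps)
  qed
qed

text \<open>Below the level \<open>m\<close> the first term suffices; above it
  \<open>(y / m) powr (q - 1)\<close> is at least 1. The level remains a free parameter.\<close>

lemma young_powr:
  fixes m y q :: real
  assumes "0 < m" "0 \<le> y" "1 \<le> q"
  shows "y \<le> m + m powr (1 - q) * y powr q"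
proof (cases "y \<le> m")
  case True
  then show ?thesis using assms by (simp add: add_increasing2)
next
  case False
  then have "m powr (1 - q) * y powr q = y * (y / m) powr (q - 1)"
    using assms by (simp add: powr_divide powr_diff)
  moreover have "y * 1 \<le> y * (y / m) powr (q - 1)"
    using assms False by (intro mult_left_mono ge_one_powr_ge_zero) auto
  ultimately show ?thesis using assms by simp
qed

text \<open>Differentiating a cutoff \<open>t ^ s\<close> costs one or two powers of
  \<open>t\<close>, and a large \<open>s\<close> pays for them. With
  \<open>z = y * t powr (s / q)\<close> one has \<open>z powr q = y powr q * t ^ s\<close>, and both
  left-hand sides are controlled by \<open>z\<close> and \<open>m\<close>. The condition on
  \<open>s\<close> amounts to \<open>s * r \<le> (s - 2) * q\<close> for
  \<open>r = (1 + q) / 2\<close>, which is what the second bound needs.\<close>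

lemma weight_bounds:
  fixes m y q t :: real and s :: nat
  assumes "0 < m" "0 \<le> y" "1 < q" "0 \<le> t" "t \<le> 1" and s: "4 * q / (q - 1) \<le> real s"
  shows "y * t ^ (s - 1) \<le> m + m powr (1 - q) * (y powr q * t ^ s)"
    and "m * (1 + y / m) powr ((1 + q) / 2) * t ^ (s - 2) \<le>
      2 powr q * (m + m powr (1 - q) * (y powr q * t ^ s))"
proof -
  let ?r = "(1 + q) / 2"
  have s': "4 * q \<le> real s * (q - 1)" using s assms by (simp add: divide_le_eq)
  have "4 < real s"
  proof -
    have "4 * (q - 1) < real s * (q - 1)" using s' by simp
    then show ?thesis using assms by (simp only: mult_less_cancel_right)
  qed
  then have s4: "4 < s" by simp
  define z where "z = y * t powr (real s / q)"
  have z0: "0 \<le> z" using assms by (simp add: z_def)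
  have zq: "z powr q = y powr q * t ^ s"
  proof (cases "t = 0")
    case False
    then show ?thesis using assms by (simp add: z_def powr_mult powr_powr powr_realpow)
  qed (use s4 assms in \<open>auto simp: z_def power_0_left\<close>)
  have tz: "t powr p \<le> t powr (real s / q)" if "real s / q \<le> p" for p
    using that assms by (cases "t = 0") (auto intro: powr_mono')
  \<comment> \<open>Positivity of \<open>k\<close> matters at \<open>t = 0\<close>, where
    \<open>0 ^ 0\<close> is 1 but \<open>0 powr 0\<close> is 0.\<close>
  have tn: "t ^ k = t powr real k" if "0 < k" for k
    using that assms by (cases "t = 0") (auto simp: powr_realpow)
  have "real s \<le> q * (real s - 1)" using s' assms by (simp add: algebra_simps)
  then have "real s / q \<le> real (s - 1)"
    using s4 assms by (simp add: divide_le_eq mult.commute of_nat_diff)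
  then have "y * t ^ (s - 1) \<le> z"
    unfolding z_def using tz s4 assms by (intro mult_left_mono) (auto simp: tn simp del: of_nat_diff)
  also have "z \<le> m + m powr (1 - q) * z powr q"
    by (rule young_powr) (use assms z0 in auto)
  finally show "y * t ^ (s - 1) \<le> m + m powr (1 - q) * (y powr q * t ^ s)"
    by (simp add: zq)
  have r: "1 < ?r" "?r < q" using assms by (auto simp: field_simps)
  have "?r \<noteq> 0" using r by linarith
  then have e: "x / ?r * ?r = x" for x
    using nonzero_divide_eq_eq[of ?r x "x / ?r"] by simp
  have "t ^ (s - 2) = (t powr (real (s - 2) / ?r)) powr ?r"
    unfolding powr_powr using s4 e[of "real (s - 2)"] by (simp only: tn zero_less_diff)
  then have "(1 + y / m) powr ?r * t ^ (s - 2) = ((1 + y / m) * t powr (real (s - 2) / ?r)) powr ?r"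
    using assms by (simp add: powr_mult)
  also have "\<dots> \<le> (1 + z / m) powr ?r"
  proof (intro powr_mono2)
    have "real s * ?r \<le> real (s - 2) * q"
      using s' s4 by (simp add: of_nat_diff field_simps)
    then have "real s / q \<le> real (s - 2) / ?r"
      using r assms by (simp add: divide_le_eq le_divide_eq field_simps)
    then have 1: "t powr (real (s - 2) / ?r) \<le> t powr (real s / q)" by (rule tz)
    have 2: "t powr (real (s - 2) / ?r) \<le> 1"
      using assms r by (intro powr_le1) auto
    have "(1 + y / m) * t powr (real (s - 2) / ?r) =
        t powr (real (s - 2) / ?r) + (y * t powr (real (s - 2) / ?r)) / m"
      by (simp add: field_simps)
    also have "\<dots> \<le> 1 + z / m"
      unfolding z_def using 1 2 assms by (intro add_mono divide_right_mono mult_left_mono) auto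
    finally show "(1 + y / m) * t powr (real (s - 2) / ?r) \<le> 1 + z / m" .
  qed (use r assms in auto)
  also have "\<dots> \<le> 2 powr q * (1 + (z / m) powr q)"
  proof -
    have "(1 + z / m) powr ?r \<le> (1 + z / m) powr q"
      using r z0 assms by (intro powr_mono) auto
    also have "\<dots> \<le> 2 powr q * (1 powr q + (z / m) powr q)"
      using powr_add_le[of q 1 "z / m"] z0 assms by simp
    finally show ?thesis by simp
  qed
  finally have "m * ((1 + y / m) powr ?r * t ^ (s - 2)) \<le> m * (2 powr q * (1 + (z / m) powr q))"
    using assms by (intro mult_left_mono) auto
  also have "\<dots> = 2 powr q * (m + m powr (1 - q) * (y powr q * t ^ s))"
    using assms z0 by (simp add: powr_divide powr_diff zq field_simps)
  finally show "m * (1 + y / m) powr ?r * t ^ (s - 2) \<le>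
      2 powr q * (m + m powr (1 - q) * (y powr q * t ^ s))" by (simp add: mult.assoc)
qed

text \<open>The form is non-negative at \<open>2 * b * t * Y - c * X\<close>; division by
  \<open>4 * b\<close> gives the claim. The explicit \<open>t\<close> will be the cutoff factor that
  accompanies each copy of the gradient \<open>Y\<close>.\<close>

lemma bform_complete_square:
  assumes "psd m" "0 < b"
  shows "- b * t\<^sup>2 * bform m Y Y + c * t * bform m X Y \<le> c\<^sup>2 / (4 * b) * bform m X X"
proof -
  have "0 \<le> (2 * b * t)\<^sup>2 * bform m Y Y + 2 * (2 * b * t) * (- c) * bform m Y X + (- c)\<^sup>2 * bform m X X"
    by (rule bform_square[OF assms(1)])
  then have "4 * b * (- b * t\<^sup>2 * bform m Y Y + c * t * bform m X Y) \<le> 4 * b * (c\<^sup>2 / (4 * b) * bform m X X)"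
    using assms(2) bform_commute[OF assms(1), of Y X] by (simp add: power2_eq_square algebra_simps)
  then show ?thesis
    by (rule mult_left_le_imp_le) (use assms(2) in simp)
qed

lemma frechet_derivative_cutoff:
  fixes X \<eta> :: "'a::euclidean_space \<Rightarrow> real"
  assumes "X differentiable (at z)" "\<eta> differentiable (at z)"
  shows "frechet_derivative (\<lambda>z. X z * \<eta> z ^ s) (at z) b =
    X z * (real s * \<eta> z ^ (s - 1)) * frechet_derivative \<eta> (at z) b + frechet_derivative X (at z) b * \<eta> z ^ s"
proof -
  have d: "((\<lambda>y. y ^ s) has_real_derivative real s * \<eta> z ^ (s - 1)) (at (\<eta> z))"
    by (auto intro!: derivative_eq_intros)
  have "(\<lambda>z. \<eta> z ^ s) differentiable (at z)"
    using assms(2) by (auto intro!: derivative_intros)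
  from frechet_derivative_mult[OF assms(1) this] frechet_derivative_compose_real[OF assms(2) d]
  show ?thesis by simp
qed

text \<open>Here \<open>x\<close> and \<open>e\<close> are the values of \<open>X\<close> and
  \<open>\<eta>\<close>. The time derivative of \<open>X\<close> has the favourable sign and is
  dropped, so switching on near \<open>t = 0\<close> costs nothing. Only the decay of
  \<open>\<eta>\<close>, at rate at most \<open>k\<close>, has to be absorbed by
  \<open>weight_bounds\<close>.\<close>

lemma drift_term_bound:
  fixes m w q e x k :: real and s :: nat
  assumes q: "1 < q" and s: "4 * q / (q - 1) \<le> real s" and m: "0 < m"
    and e: "0 \<le> e" "e \<le> 1" and x: "0 \<le> x" "x \<le> 1" and w: "0 \<le> w"
    and H: "0 \<le> H" "m * H \<le> 2 * w" and d: "- k \<le> d\<eta>" "0 \<le> dX" and k: "0 \<le> k"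
  shows "- (m * H * (x * (real s * e ^ (s - 1)) * d\<eta> + dX * e ^ s)) \<le>
    2 * real s * k * (m + m powr (1 - q) * (\<bar>w\<bar> powr q * (x * e ^ s)))"
proof -
  have "- (x * (real s * e ^ (s - 1)) * d\<eta> + dX * e ^ s) \<le> x * (real s * e ^ (s - 1)) * k"
  proof -
    have "x * (real s * e ^ (s - 1)) * (- d\<eta>) \<le> x * (real s * e ^ (s - 1)) * k"
      using x e d by (intro mult_left_mono) auto
    moreover have "0 \<le> dX * e ^ s" using d e by simp
    ultimately show ?thesis by simp
  qed
  then have "m * H * - (x * (real s * e ^ (s - 1)) * d\<eta> + dX * e ^ s) \<le> m * H * (x * (real s * e ^ (s - 1)) * k)"
    using m H by (intro mult_left_mono) auto
  also have "\<dots> \<le> 2 * w * (x * (real s * e ^ (s - 1)) * k)"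
    using H x e k by (intro mult_right_mono) auto
  also have "\<dots> = 2 * real s * k * (x * (w * e ^ (s - 1)))" by (simp add: mult_ac)
  also have "\<dots> \<le> 2 * real s * k * (x * (m + m powr (1 - q) * (w powr q * e ^ s)))"
    using weight_bounds(1)[OF m w q e s] x k by (intro mult_left_mono) auto
  also have "\<dots> \<le> 2 * real s * k * (m + m powr (1 - q) * (\<bar>w\<bar> powr q * (x * e ^ s)))"
  proof (intro mult_left_mono)
    have "x * m \<le> 1 * m" using x m by (intro mult_right_mono) auto
    then show "x * (m + m powr (1 - q) * (w powr q * e ^ s)) \<le> m + m powr (1 - q) * (\<bar>w\<bar> powr q * (x * e ^ s))"
      using w by (simp add: distrib_left mult.left_commute)
  qed (use k in auto)
  finally show ?thesis unfolding mult_minus_right .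
qed

text \<open>\<open>Z\<close> is the gradient of the approximation and \<open>Y\<close> that of the
  cutoff. The square is completed with \<open>b = - hp / \<mu>\<close>; by the growth condition on
  \<open>hp\<close>, \<open>1 / b\<close> is at most
  \<open>\<mu> * L * (1 + |f| / \<mu>) powr r\<close> with \<open>r = (1 + q) / 2 < q\<close>, a
  growth that \<open>weight_bounds\<close> can absorb.\<close>

lemma diffusion_term_bound:
  fixes \<mu> w f q e x k L hy hp :: real and s :: nat
  assumes q: "1 < q" and s: "4 * q / (q - 1) \<le> real s" and m: "0 < \<mu>"
    and e: "0 \<le> e" "e \<le> 1" and x: "0 \<le> x" "x \<le> 1"
    and h: "1 \<le> hy" "hy \<le> 2" "hp < 0" "1 \<le> - hp * (L * (1 + \<bar>f / \<mu>\<bar>) powr ((1 + q) / 2))" and L: "0 < L"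
    and psd: "psd m" and k: "bform m Y Y \<le> k"
  shows "hp / \<mu> * (x * e ^ s) * bform m Z Z + hy * (x * (real s * e ^ (s - 1))) * bform m Y Z \<le>
    (real s)\<^sup>2 * L * k * (2 powr q * 2 powr q) *
      (\<mu> + \<mu> powr (1 - q) * (\<bar>w\<bar> powr q * (x * e ^ s)) + \<mu> powr (1 - q) * \<bar>f - w\<bar> powr q)"
proof -
  let ?r = "(1 + q) / 2"
  define b where "b = - hp / \<mu>"
  have b: "0 < b" using h m by (simp add: b_def divide_neg_pos)
  have k0: "0 \<le> k" using bform_nonneg[OF psd, of Y] k by linarith
  have "4 * (q - 1) < real s * (q - 1)" using s q by (simp add: divide_le_eq)
  then have "4 < real s" using q by (simp only: mult_less_cancel_right)
  then have s4: "4 < s" by simp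
  \<comment> \<open>The square consumes two factors \<open>e\<close>; what is left is the weight
    \<open>e ^ (s - 2)\<close> of the second bound in \<open>weight_bounds\<close>.\<close>
  have es: "e ^ s = e ^ (s - 2) * e\<^sup>2" "e ^ (s - 1) = e ^ (s - 2) * e"
  proof -
    have "s = (s - 2) + 2" "s - 1 = (s - 2) + 1" using s4 by auto
    then show "e ^ s = e ^ (s - 2) * e\<^sup>2" "e ^ (s - 1) = e ^ (s - 2) * e"
      by (metis power_add, metis power_add power_one_right)
  qed
  have "hp / \<mu> * (x * e ^ s) * bform m Z Z + hy * (x * (real s * e ^ (s - 1))) * bform m Y Z =
      (x * e ^ (s - 2)) * (- b * e\<^sup>2 * bform m Z Z + (hy * real s) * e * bform m Y Z)"
    unfolding es by (simp add: b_def algebra_simps)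
  also have "\<dots> \<le> (x * e ^ (s - 2)) * ((hy * real s)\<^sup>2 / (4 * b) * bform m Y Y)"
    using bform_complete_square[OF psd b] x e by (intro mult_left_mono) auto
  also have "\<dots> \<le> (x * e ^ (s - 2)) * ((real s)\<^sup>2 * (\<mu> * (L * (1 + \<bar>f\<bar> / \<mu>) powr ?r)) * k)"
  proof (intro mult_left_mono mult_mono k)
    have "hy\<^sup>2 \<le> 2\<^sup>2" using h by (intro power_mono) auto
    then have "(hy * real s)\<^sup>2 / (4 * b) \<le> (2\<^sup>2 * (real s)\<^sup>2) / (4 * b)"
      using b unfolding power_mult_distrib by (intro divide_right_mono mult_right_mono) auto
    also have "\<dots> = (real s)\<^sup>2 * (1 / b)" by simp
    also have "\<dots> \<le> (real s)\<^sup>2 * (\<mu> * (L * (1 + \<bar>f\<bar> / \<mu>) powr ?r))"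
    proof (intro mult_left_mono)
      have "1 \<le> b * (\<mu> * (L * (1 + \<bar>f\<bar> / \<mu>) powr ?r))"
        using h(4) m by (simp add: b_def)
      then show "1 / b \<le> \<mu> * (L * (1 + \<bar>f\<bar> / \<mu>) powr ?r)"
        using b by (simp add: divide_le_eq mult.commute)
    qed simp
    finally show "(hy * real s)\<^sup>2 / (4 * b) \<le> (real s)\<^sup>2 * (\<mu> * (L * (1 + \<bar>f\<bar> / \<mu>) powr ?r))" .
  qed (use x e m L bform_nonneg[OF psd] in auto)
  also have "\<dots> = (real s)\<^sup>2 * L * k * (x * (\<mu> * (1 + \<bar>f\<bar> / \<mu>) powr ?r * e ^ (s - 2)))"
    by (simp add: mult_ac)
  also have "\<dots> \<le> (real s)\<^sup>2 * L * k * (x * (2 powr q * (\<mu> + \<mu> powr (1 - q) * (\<bar>f\<bar> powr q * e ^ s))))"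
    using weight_bounds(2)[OF m abs_ge_zero q e s, of f] x k0 L by (intro mult_left_mono) auto
  \<comment> \<open>The approximation \<open>f\<close> is traded for its limit \<open>w\<close>. The
    error is kept without its cutoff, since it will vanish in the limit.\<close>
  also have "\<dots> \<le> (real s)\<^sup>2 * L * k * ((2 powr q * 2 powr q) *
      (\<mu> + \<mu> powr (1 - q) * (\<bar>w\<bar> powr q * (x * e ^ s)) + \<mu> powr (1 - q) * \<bar>f - w\<bar> powr q))"
  proof (intro mult_left_mono)
    have xe: "0 \<le> x * e ^ s" "x * e ^ s \<le> 1" using x e by (auto intro!: mult_le_one power_le_one)
    have "\<bar>f\<bar> powr q \<le> 2 powr q * (\<bar>w\<bar> powr q + \<bar>f - w\<bar> powr q)"
      using powr_add_le[of q w "f - w"] q by simp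
    then have "\<bar>f\<bar> powr q * (x * e ^ s) \<le> 2 powr q * (\<bar>w\<bar> powr q + \<bar>f - w\<bar> powr q) * (x * e ^ s)"
      using xe by (intro mult_right_mono)
    also have "\<dots> \<le> 2 powr q * (\<bar>w\<bar> powr q * (x * e ^ s) + \<bar>f - w\<bar> powr q)"
    proof -
      have "\<bar>f - w\<bar> powr q * (x * e ^ s) \<le> \<bar>f - w\<bar> powr q * 1" using xe by (intro mult_left_mono) auto
      then show ?thesis by (simp add: distrib_right mult.assoc)
    qed
    finally have 1: "\<mu> powr (1 - q) * (\<bar>f\<bar> powr q * (x * e ^ s)) \<le>
        \<mu> powr (1 - q) * (2 powr q * (\<bar>w\<bar> powr q * (x * e ^ s) + \<bar>f - w\<bar> powr q))"
      by (intro mult_left_mono) auto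
    have "1 \<le> (2::real) powr q" using q by (intro ge_one_powr_ge_zero) auto
    then have "x * \<mu> \<le> 2 powr q * \<mu>" using x m by (intro mult_right_mono) auto
    then have "x * (\<mu> + \<mu> powr (1 - q) * (\<bar>f\<bar> powr q * e ^ s)) \<le> 2 powr q *
      (\<mu> + \<mu> powr (1 - q) * (\<bar>w\<bar> powr q * (x * e ^ s)) + \<mu> powr (1 - q) * \<bar>f - w\<bar> powr q)"
      using 1 by (simp add: algebra_simps)
    then have "2 powr q * (x * (\<mu> + \<mu> powr (1 - q) * (\<bar>f\<bar> powr q * e ^ s))) \<le> 2 powr q * (2 powr q *
      (\<mu> + \<mu> powr (1 - q) * (\<bar>w\<bar> powr q * (x * e ^ s)) + \<mu> powr (1 - q) * \<bar>f - w\<bar> powr q))"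
      by (rule mult_left_mono) simp
    then show "x * (2 powr q * (\<mu> + \<mu> powr (1 - q) * (\<bar>f\<bar> powr q * e ^ s))) \<le> (2 powr q * 2 powr q) *
      (\<mu> + \<mu> powr (1 - q) * (\<bar>w\<bar> powr q * (x * e ^ s)) + \<mu> powr (1 - q) * \<bar>f - w\<bar> powr q)"
      by (simp only: mult.assoc mult.left_commute)
  qed (use L k0 in auto)
  finally show ?thesis by (simp add: mult.assoc)
qed

context degenerate_form
begin

text \<open>On finite measure \<open>young_powr\<close> bounds the mean of \<open>|f k|\<close> by
  \<open>d\<close> times the measure plus \<open>d powr (1 - q)\<close> times the mean of
  \<open>|f k| powr q\<close>. First \<open>d\<close> is fixed small, then \<open>k\<close>
  grows.\<close>

lemma Lq_tendsto_imp_L1: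
  fixes f :: "nat \<Rightarrow> _ \<Rightarrow> real"
  assumes "1 < q" "\<And>k. f k \<in> borel_measurable M" "\<And>k. integrable M (\<lambda>z. \<bar>f k z\<bar> powr q)"
    "(\<lambda>k. LINT z|M. \<bar>f k z\<bar> powr q) \<longlonglongrightarrow> 0"
  shows "integrable M (\<lambda>z. \<bar>f k z\<bar>)" "(\<lambda>k. LINT z|M. \<bar>f k z\<bar>) \<longlonglongrightarrow> 0"
proof -
  interpret finite_measure M by (rule finite_measure_M)
  have young: "\<bar>f k z\<bar> \<le> d + d powr (1 - q) * \<bar>f k z\<bar> powr q" if "0 < d" for k z d
    by (rule young_powr) (use that assms in auto)
  have int: "integrable M (\<lambda>z. d + d powr (1 - q) * \<bar>f k z\<bar> powr q)" for k d
    using assms by simp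
  show i: "integrable M (\<lambda>z. \<bar>f k z\<bar>)" for k
    by (rule Bochner_Integration.integrable_bound[OF int[of 1]])
       (use young[of 1] assms in \<open>auto intro!: AE_I2 order_trans[OF _ abs_ge_self]\<close>)
  have le: "(LINT z|M. \<bar>f k z\<bar>) \<le> d * measure M (space M) + d powr (1 - q) * (LINT z|M. \<bar>f k z\<bar> powr q)"
    if "0 < d" for k d
  proof -
    have "(LINT z|M. \<bar>f k z\<bar>) \<le> (LINT z|M. d + d powr (1 - q) * \<bar>f k z\<bar> powr q)"
      by (rule integral_mono[OF i int]) (rule young[OF that])
    then show ?thesis using assms by (simp add: mult.commute)
  qed
  show "(\<lambda>k. LINT z|M. \<bar>f k z\<bar>) \<longlonglongrightarrow> 0"
  proof (rule LIMSEQ_I)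
    fix r :: real assume "0 < r"
    define d where "d = r / (2 * (measure M (space M) + 1))"
    have d: "0 < d" using \<open>0 < r\<close> by (simp add: d_def add_nonneg_pos)
    have dm: "d * measure M (space M) \<le> r / 2"
    proof -
      define c where "c = measure M (space M)"
      have "0 \<le> c" unfolding c_def by (rule measure_nonneg)
      have "d * c \<le> d * (c + 1)" using d by (intro mult_left_mono) auto
      also have "\<dots> = r / 2" unfolding d_def c_def[symmetric] using \<open>0 \<le> c\<close> by (simp add: field_simps)
      finally show ?thesis unfolding c_def .
    qed
    have "(\<lambda>k. d powr (1 - q) * (LINT z|M. \<bar>f k z\<bar> powr q)) \<longlonglongrightarrow> d powr (1 - q) * 0"
      by (intro tendsto_mult_left assms)
    from order_tendstoD(2)[OF this, of "r / 2"] \<open>0 < r\<close>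
    have "\<forall>\<^sub>F k in sequentially. d powr (1 - q) * (LINT z|M. \<bar>f k z\<bar> powr q) < r / 2" by simp
    then have "\<forall>\<^sub>F k in sequentially. norm ((LINT z|M. \<bar>f k z\<bar>) - 0) < r"
    proof eventually_elim
      case (elim k)
      have "0 \<le> (LINT z|M. \<bar>f k z\<bar>)" by (rule Bochner_Integration.integral_nonneg) simp
      then show ?case using le[OF d, of k] dm elim by simp
    qed
    then show "\<exists>no. \<forall>k\<ge>no. norm ((LINT z|M. \<bar>f k z\<bar>) - 0) < r"
      by (simp add: eventually_sequentially)
  qed
qed

text \<open>The approximating sequence is fixed first and the test functions are quantified
  afterwards: the energy estimate builds one sequence \<open>\<phi> m\<close> from the
  approximations of both \<open>u\<close> and \<open>v\<close> and inserts it into both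
  limits.\<close>

lemma W_element_approx:
  assumes "1 < q" "W_element a q P w wt G"
  obtains F B where "\<And>j k. C_k_on j P (F k)" "\<And>k. integrable M (deriv_t (F k))"
    "\<And>k. integrable M (a_form a (F k) (F k))" "\<And>k. (LINT z|M. a_form a (F k) (F k) z) \<le> B"
    "w \<in> borel_measurable M" "integrable M (\<lambda>z. \<bar>w z\<bar> powr q)"
    "\<And>k. integrable M (\<lambda>z. \<bar>F k z - w z\<bar> powr q)"
    "(\<lambda>k. LINT z|M. \<bar>F k z - w z\<bar> powr q) \<longlonglongrightarrow> 0"
    "\<And>\<phi> C B' K. \<lbrakk>\<And>m. test_function_on \<S> (\<phi> m); \<And>m z. z \<in> P \<Longrightarrow> \<bar>\<phi> m z\<bar> \<le> C;
      \<And>m. integrable M (a_form a (\<phi> m) (\<phi> m)); \<And>m. (LINT z|M. a_form a (\<phi> m) (\<phi> m) z) \<le> B';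
      closed K; K \<subseteq> P; \<And>m z. z \<notin> K \<Longrightarrow> \<phi> m z = 0\<rbrakk> \<Longrightarrow>
      (\<forall>m. integrable M (\<lambda>z. deriv_t (F m) z * \<phi> m z) \<and> integrable M (a_form a (\<phi> m) (F m)) \<and>
        integrable M (\<lambda>z. \<bar>w z\<bar> powr (q - 1) * w z * \<phi> m z)) \<and>
      (\<lambda>m. weak_form q w wt G (\<phi> m) + (LINT z|M. \<bar>w z\<bar> powr (q - 1) * w z * \<phi> m z) -
        ((LINT z|M. deriv_t (F m) z * \<phi> m z) + (LINT z|M. a_form a (\<phi> m) (F m) z))) \<longlonglongrightarrow> 0"
proof -
  obtain F where F: "W_Cauchy a q P F" and L: "converges_Lp (qhat q) P F w"
    and wt: "converges_Lp 1 P (\<lambda>k. deriv_t (F k)) wt"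
    and G: "\<And>\<phi>. test_function_on \<S> \<phi> \<Longrightarrow>
        converges_Lp 1 P (\<lambda>k. a_form a \<phi> (F k)) (\<lambda>z. \<Sum>i\<in>UNIV. deriv_x i \<phi> z * G z $ i)"
    using assms(2) by (auto simp: W_element_def)
  obtain B where B: "\<And>k. (LINT z|M. a_form a (F k) (F k) z) \<le> B" by (rule W_Cauchy_bounded[OF F]) blast
  note FD = W_Cauchy_D[OF F]
  note w = converges_Lq[OF assms(1) L FD(1) FD(4)]
  show thesis
  proof (rule that[OF FD(1-3) B w], goal_cases)
    case (1 \<phi> C B' K)
    note terms = approx_weak_terms[where \<phi> = \<phi>, OF F wt G 1(1-4)]
    have wf: "integrable M (\<lambda>z. \<bar>w z\<bar> powr (q - 1) * w z * \<phi> m z)"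
      "weak_form q w wt G (\<phi> m) = (LINT z|M. wt z * \<phi> m z) +
        (LINT z|M. (\<Sum>i\<in>UNIV. deriv_x i (\<phi> m) z * G z $ i)) -
        (LINT z|M. \<bar>w z\<bar> powr (q - 1) * w z * \<phi> m z)" for m
      by (rule weak_form_eq[OF assms(1) w(1,2) 1(1), where C = C and K = K]; rule 1 terms; assumption)+
    show ?case
      using terms(3,4) wf(1) terms(5) unfolding wf(2) by simp
  qed
qed

section \<open>The energy estimate\<close>


text \<open>\<open>X\<close> is independent of space and non-decreasing in time, so it costs
  nothing; the unfavourable derivatives of \<open>\<eta>\<close> are bounded by
  \<open>\<kappa>\<close> and confined to \<open>D\<close>. The bound is first proved for each
  \<open>m\<close> with error terms, which disappear as \<open>m\<close> tends to infinity.\<close>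

lemma energy_estimate:
  fixes X \<eta> u v :: "real \<times> (real ^ 'n) \<Rightarrow> real" and s :: nat
  assumes q: "1 < q" and nl: "test_nonlinearity ((q - 1) / 2) h h' H L" and s: "4 * q / (q - 1) \<le> real s"
    and u: "W_element a q P u ut Gu" and v: "W_element a q P v vt Gv"
    and weak: "\<And>\<phi>. test_function_on \<S> \<phi> \<Longrightarrow> (\<And>z. z \<in> \<S> \<Longrightarrow> 0 \<le> \<phi> z) \<Longrightarrow>
      weak_form q v vt Gv \<phi> \<le> weak_form q u ut Gu \<phi>"
    and uv: "AE z in M. v z \<le> u z"
    and X: "\<And>k. C_k_on k UNIV X" "\<And>z. 0 \<le> X z" "\<And>z. X z \<le> 1" "\<And>i z. deriv_x i X z = 0"
      "\<And>z. 0 \<le> deriv_t X z"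
    and \<eta>: "\<And>k. C_k_on k UNIV \<eta>" "\<And>z. 0 \<le> \<eta> z" "\<And>z. \<eta> z \<le> 1"
    and K: "compact K" "K \<subseteq> P" "\<And>z. z \<notin> K \<Longrightarrow> X z * \<eta> z = 0"
    and D: "D \<in> sets borel" and \<kappa>: "0 \<le> \<kappa>" and \<mu>: "0 < \<mu>"
    and \<eta>t: "\<And>z. z \<in> P \<Longrightarrow> - (\<kappa> * indicator D z) \<le> deriv_t \<eta> z"
    and \<eta>x: "AE z in M. a_form a \<eta> \<eta> z \<le> \<kappa> * indicator D z"
  shows "integrable M (\<lambda>z. \<bar>u z - v z\<bar> powr q * (X z * \<eta> z ^ s))"
    and "2 powr (- q) * (LINT z|M. \<bar>u z - v z\<bar> powr q * (X z * \<eta> z ^ s)) \<le>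
      (2 * real s + (real s)\<^sup>2 * L * (2 powr q * 2 powr q)) * \<kappa> *
      (LINT z|M. indicator D z * (\<mu> + \<mu> powr (1 - q) * (\<bar>u z - v z\<bar> powr q * (X z * \<eta> z ^ s))))"
proof -
  define \<nu> where "\<nu> = (q - 1) / 2"
  \<comment> \<open>The growth exponent of \<open>1 / |h'|\<close> is thus strictly between 1 and
    \<open>q\<close>.\<close>
  have \<nu>: "1 + (q - 1) / 2 = (1 + q) / 2" by (simp add: field_simps)
  have hC: "\<And>k. C_k_on k UNIV h" and HC: "\<And>k. C_k_on k UNIV H"
    and dh: "\<And>y. (h has_real_derivative h' y) (at y)" and dH: "\<And>y. (H has_real_derivative h y) (at y)"
    and H0: "H 0 = 0" and h12: "\<And>y. 1 \<le> h y" "\<And>y. h y \<le> 2"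
    and h'b: "\<And>y. - \<nu> \<le> h' y" "\<And>y. h' y < 0"
    and hL: "\<And>y. 1 \<le> - h' y * (L * (1 + \<bar>y\<bar>) powr ((1 + q) / 2))" and L: "0 < L"
    using nl unfolding test_nonlinearity_def \<nu> \<nu>_def by auto
  have "1 \<le> 4 * q / (q - 1)" using q by (simp add: le_divide_eq)
  then have s1: "1 \<le> s" using s by simp
  obtain U BU where U: "\<And>j k. C_k_on j P (U k)" "\<And>k. integrable M (deriv_t (U k))"
      "\<And>k. integrable M (a_form a (U k) (U k))" "\<And>k. (LINT z|M. a_form a (U k) (U k) z) \<le> BU"
      "u \<in> borel_measurable M" "integrable M (\<lambda>z. \<bar>u z\<bar> powr q)"
      "\<And>k. integrable M (\<lambda>z. \<bar>U k z - u z\<bar> powr q)"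
      "(\<lambda>k. LINT z|M. \<bar>U k z - u z\<bar> powr q) \<longlonglongrightarrow> 0"
    and U_lim: "\<And>\<phi> C B' K. \<lbrakk>\<And>m. test_function_on \<S> (\<phi> m); \<And>m z. z \<in> P \<Longrightarrow> \<bar>\<phi> m z\<bar> \<le> C;
      \<And>m. integrable M (a_form a (\<phi> m) (\<phi> m)); \<And>m. (LINT z|M. a_form a (\<phi> m) (\<phi> m) z) \<le> B';
      closed K; K \<subseteq> P; \<And>m z. z \<notin> K \<Longrightarrow> \<phi> m z = 0\<rbrakk> \<Longrightarrow>
      (\<forall>m. integrable M (\<lambda>z. deriv_t (U m) z * \<phi> m z) \<and> integrable M (a_form a (\<phi> m) (U m)) \<and>
        integrable M (\<lambda>z. \<bar>u z\<bar> powr (q - 1) * u z * \<phi> m z)) \<and>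
      (\<lambda>m. weak_form q u ut Gu (\<phi> m) + (LINT z|M. \<bar>u z\<bar> powr (q - 1) * u z * \<phi> m z) -
        ((LINT z|M. deriv_t (U m) z * \<phi> m z) + (LINT z|M. a_form a (\<phi> m) (U m) z))) \<longlonglongrightarrow> 0"
    by (rule W_element_approx[OF q u]) blast
  obtain V BV where V: "\<And>j k. C_k_on j P (V k)" "\<And>k. integrable M (deriv_t (V k))"
      "\<And>k. integrable M (a_form a (V k) (V k))" "\<And>k. (LINT z|M. a_form a (V k) (V k) z) \<le> BV"
      "v \<in> borel_measurable M" "integrable M (\<lambda>z. \<bar>v z\<bar> powr q)"
      "\<And>k. integrable M (\<lambda>z. \<bar>V k z - v z\<bar> powr q)"
      "(\<lambda>k. LINT z|M. \<bar>V k z - v z\<bar> powr q) \<longlonglongrightarrow> 0"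
    and V_lim: "\<And>\<phi> C B' K. \<lbrakk>\<And>m. test_function_on \<S> (\<phi> m); \<And>m z. z \<in> P \<Longrightarrow> \<bar>\<phi> m z\<bar> \<le> C;
      \<And>m. integrable M (a_form a (\<phi> m) (\<phi> m)); \<And>m. (LINT z|M. a_form a (\<phi> m) (\<phi> m) z) \<le> B';
      closed K; K \<subseteq> P; \<And>m z. z \<notin> K \<Longrightarrow> \<phi> m z = 0\<rbrakk> \<Longrightarrow>
      (\<forall>m. integrable M (\<lambda>z. deriv_t (V m) z * \<phi> m z) \<and> integrable M (a_form a (\<phi> m) (V m)) \<and>
        integrable M (\<lambda>z. \<bar>v z\<bar> powr (q - 1) * v z * \<phi> m z)) \<and>
      (\<lambda>m. weak_form q v vt Gv (\<phi> m) + (LINT z|M. \<bar>v z\<bar> powr (q - 1) * v z * \<phi> m z) -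
        ((LINT z|M. deriv_t (V m) z * \<phi> m z) + (LINT z|M. a_form a (\<phi> m) (V m) z))) \<longlonglongrightarrow> 0"
    by (rule W_element_approx[OF q v]) blast
  interpret finite_measure M by (rule finite_measure_M)
  \<comment> \<open>\<open>F m\<close> may be negative although its limit \<open>w\<close> is not.
    As \<open>H' = h\<close>, the time derivative of \<open>\<mu> * g m\<close> contains
    \<open>deriv_t (F m) * \<phi> m\<close>, the time term of the weak form.\<close>
  define F where "F m z = U m z - V m z" for m z
  define w where "w z = u z - v z" for z
  define \<zeta> where "\<zeta> z = X z * \<eta> z ^ s" for z
  define \<phi> where "\<phi> m z = h (F m z / \<mu>) * \<zeta> z" for m z
  define g where "g m z = H (F m z / \<mu>) * \<zeta> z" for m z

  have CF: "C_k_on j P (F m)" for j m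
    unfolding F_def[abs_def] by (rule C_k_on_diff[OF open_P U(1) V(1)])
  have CF': "C_k_on j P (\<lambda>z. F m z / \<mu>)" for j m
    using C_k_on_mult[OF open_P CF C_k_on_const[OF open_P, of j "1 / \<mu>"]] by simp
  have C\<zeta>: "C_k_on j UNIV \<zeta>" for j
    unfolding \<zeta>_def[abs_def] by (intro C_k_on_mult C_k_on_power X \<eta>) auto
  have C\<zeta>P: "C_k_on j P \<zeta>" for j by (rule C_k_on_subset[OF C\<zeta>]) simp
  have \<zeta>01: "0 \<le> \<zeta> z" "\<zeta> z \<le> 1" for z
    unfolding \<zeta>_def using X(2,3)[of z] \<eta>(2,3)[of z] by (auto intro!: mult_le_one power_le_one)
  have \<zeta>K: "\<zeta> z = 0" if "z \<notin> K" for z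
    using K(3)[OF that] s1 by (auto simp: \<zeta>_def)
  have Ch\<phi>: "C_k_on j P (\<phi> m)" for j m
    unfolding \<phi>_def[abs_def]
    by (intro C_k_on_mult[OF open_P] C_k_on_compose[OF open_P _ _ CF' hC] C\<zeta>P) auto
  have Cg: "C_k_on j P (g m)" for j m
    unfolding g_def[abs_def]
    by (intro C_k_on_mult[OF open_P] C_k_on_compose[OF open_P _ _ CF' HC] C\<zeta>P) auto
  have \<phi>K: "\<phi> m z = 0" "g m z = 0" if "z \<notin> K" for m z
    using \<zeta>K[OF that] by (simp_all add: \<phi>_def g_def)
  have test: "test_function_on \<S> (\<phi> m)" for m
    by (rule test_function_onI[OF open_P _ K(1,2) P_sub \<phi>K(1)]) (simp_all add: C_infinity_on_def Ch\<phi>)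
  have \<phi>_ge: "\<zeta> z \<le> \<phi> m z" for m z
    using mult_right_mono[OF h12(1) \<zeta>01(1)] by (simp add: \<phi>_def)
  have \<phi>0: "0 \<le> \<phi> m z" for m z using \<phi>_ge \<zeta>01(1) order_trans by blast
  have \<phi>2: "\<bar>\<phi> m z\<bar> \<le> 2" for m z
    using mult_mono[OF h12(2)[of "F m z / \<mu>"] \<zeta>01(2)[of z]] \<zeta>01(1)[of z] \<phi>0[of m z] by (simp add: \<phi>_def)

  have diffF: "F m differentiable (at z)" if "z \<in> P" for m z
    by (rule C_k_on_differentiable[OF CF that])
  have diffUV: "U m differentiable (at z)" "V m differentiable (at z)" if "z \<in> P" for m z
    by (rule C_k_on_differentiable[OF U(1) that], rule C_k_on_differentiable[OF V(1) that])
  have diff\<zeta>: "\<zeta> differentiable (at z)" "X differentiable (at z)" "\<eta> differentiable (at z)" for z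
    by (rule C_k_on_differentiable[OF C\<zeta> UNIV_I] C_k_on_differentiable[OF X(1) UNIV_I]
        C_k_on_differentiable[OF \<eta>(1) UNIV_I])+
  have fdF: "frechet_derivative (F m) (at z) b = frechet_derivative (U m) (at z) b - frechet_derivative (V m) (at z) b"
    if "z \<in> P" for m z b
    unfolding F_def[abs_def] by (rule frechet_derivative_diff[OF diffUV[OF that]])
  have fd\<zeta>: "frechet_derivative \<zeta> (at z) b = X z * (real s * \<eta> z ^ (s - 1)) * frechet_derivative \<eta> (at z) b +
      frechet_derivative X (at z) b * \<eta> z ^ s" for z b
    unfolding \<zeta>_def[abs_def] by (rule frechet_derivative_cutoff[OF diff\<zeta>(2,3)])
  have fd_comp: "frechet_derivative (\<lambda>z. k (F m z / \<mu>) * \<zeta> z) (at z) b =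
      k (F m z / \<mu>) * frechet_derivative \<zeta> (at z) b + k' / \<mu> * frechet_derivative (F m) (at z) b * \<zeta> z"
    if z: "z \<in> P" and k: "(k has_real_derivative k') (at (F m z / \<mu>))" for k k' m z b
  proof -
    have 1: "((\<lambda>y. k (y / \<mu>)) has_real_derivative k' / \<mu>) (at (F m z))"
      by (rule DERIV_chain2[where f = k and g = "\<lambda>y. y / \<mu>", OF k, THEN DERIV_cong])
         (use \<mu> in \<open>auto intro!: derivative_eq_intros\<close>)
    have 2: "(\<lambda>z. k (F m z / \<mu>)) differentiable (at z)"
      using has_derivative_compose[OF diffF[OF z, of m, unfolded frechet_derivative_works]
          1[unfolded has_field_derivative_def]] by (auto simp: differentiable_def)
    show ?thesis
      using frechet_derivative_mult[OF 2 diff\<zeta>(1)] frechet_derivative_compose_real[OF diffF[OF z] 1]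
      by simp
  qed
  have dt_g: "\<mu> * deriv_t (g m) z = \<mu> * H (F m z / \<mu>) * deriv_t \<zeta> z + deriv_t (F m) z * \<phi> m z" if "z \<in> P" for m z
    using fd_comp[OF that dH, of m "(1, 0)"] \<mu> by (simp add: deriv_t_def g_def[abs_def] \<phi>_def algebra_simps)
  have grad_\<zeta>: "grad_x \<zeta> z = (X z * (real s * \<eta> z ^ (s - 1))) *\<^sub>R grad_x \<eta> z" for z
    using X(4)[of _ z] by (simp add: grad_x_def deriv_x_def fd\<zeta> vec_eq_iff)
  have grad_\<phi>: "grad_x (\<phi> m) z =
      (h' (F m z / \<mu>) / \<mu> * \<zeta> z) *\<^sub>R grad_x (F m) z +
      (h (F m z / \<mu>) * (X z * (real s * \<eta> z ^ (s - 1)))) *\<^sub>R grad_x \<eta> z" if "z \<in> P" for m z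
  proof -
    have "grad_x (\<phi> m) z = h (F m z / \<mu>) *\<^sub>R grad_x \<zeta> z + (h' (F m z / \<mu>) / \<mu> * \<zeta> z) *\<^sub>R grad_x (F m) z"
      using fd_comp[OF that dh, of m] by (simp add: grad_x_def deriv_x_def \<phi>_def[abs_def] vec_eq_iff)
    then show ?thesis by (simp add: grad_\<zeta> add.commute)
  qed

  have intF: "integrable M (a_form a (F m) (F m))" for m
    unfolding F_def[abs_def] by (rule integrable_a_form_diff[OF U(1) V(1) U(3) V(3)])
  have leF: "(LINT z|M. a_form a (F m) (F m) z) \<le> 2 * BU + 2 * BV" for m
    using integral_a_form_diff[OF U(1) V(1) U(3) V(3), of m m] U(4)[of m] V(4)[of m]
    unfolding F_def[abs_def] by linarith
  \<comment> \<open>This is \<open>2 * (2 * s)^2 * \<kappa>\<close>, the share of the gradient of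
    \<open>\<eta>\<close>. Boundedness of \<open>h'\<close> controls the share of
    \<open>F m\<close>, so the test functions have uniformly bounded energy.\<close>
  define B where "B z = 8 * (real s)\<^sup>2 * \<kappa>" for z :: "real \<times> (real ^ 'n)"
  have AE\<phi>: "AE z in M. 0 \<le> a_form a (\<phi> m) (\<phi> m) z \<and>
      a_form a (\<phi> m) (\<phi> m) z \<le> 2 * (\<nu> / \<mu>)\<^sup>2 * a_form a (F m) (F m) z + B z" for m
    using AE_P \<eta>x
  proof eventually_elim
    case (elim z)
    let ?m = "\<lambda>i j. a i j z"
    let ?a = "h' (F m z / \<mu>) / \<mu> * \<zeta> z" and ?b = "h (F m z / \<mu>) * (X z * (real s * \<eta> z ^ (s - 1)))"
    from elim have z: "z \<in> P" and p: "psd ?m" by auto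
    have "a_form a (\<phi> m) (\<phi> m) z \<le> 2 * (?a\<^sup>2 * a_form a (F m) (F m) z) + 2 * (?b\<^sup>2 * a_form a \<eta> \<eta> z)"
      using bform_add_le(1)[OF p, of "?a *\<^sub>R grad_x (F m) z" "?b *\<^sub>R grad_x \<eta> z"]
      by (simp add: a_form_eq_bform grad_\<phi>[OF z] bform_linear(5,6) power2_eq_square mult.assoc)
    also have "\<dots> \<le> 2 * ((\<nu> / \<mu>)\<^sup>2 * a_form a (F m) (F m) z) + 2 * ((2 * real s)\<^sup>2 * \<kappa>)"
    proof (intro add_mono mult_left_mono mult_mono)
      have "\<bar>h' (F m z / \<mu>)\<bar> / \<mu> \<le> \<nu> / \<mu>"
        using h'b[of "F m z / \<mu>"] \<mu> by (intro divide_right_mono) auto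
      then have "\<bar>h' (F m z / \<mu>)\<bar> / \<mu> * \<bar>\<zeta> z\<bar> \<le> \<nu> / \<mu> * 1"
        using \<zeta>01[of z] h'b[of "F m z / \<mu>"] \<mu> by (intro mult_mono) auto
      then have "\<bar>?a\<bar> \<le> \<nu> / \<mu>" using \<mu> by (simp add: abs_mult)
      also have "\<dots> \<le> \<bar>\<nu> / \<mu>\<bar>" by (rule abs_ge_self)
      finally show "?a\<^sup>2 \<le> (\<nu> / \<mu>)\<^sup>2" by (simp only: abs_le_square_iff)
      have "\<bar>?b\<bar> \<le> 2 * (1 * (real s * 1))"
        unfolding abs_mult using h12[of "F m z / \<mu>"] X(2,3)[of z] \<eta>(2,3)[of z]
        by (intro mult_mono) (auto intro!: power_le_one mult_nonneg_nonneg)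
      also have "\<dots> \<le> \<bar>2 * real s\<bar>" by simp
      finally show "?b\<^sup>2 \<le> (2 * real s)\<^sup>2" by (simp only: abs_le_square_iff)
      have "\<kappa> * indicator D z \<le> \<kappa> * 1" using \<kappa> by (intro mult_left_mono) (auto simp: indicator_def)
      then show "a_form a \<eta> \<eta> z \<le> \<kappa>" using elim(2) by linarith
    qed (use bform_nonneg[OF p] in \<open>auto simp: a_form_eq_bform\<close>)
    also have "\<dots> = 2 * (\<nu> / \<mu>)\<^sup>2 * a_form a (F m) (F m) z + B z" by (simp add: B_def power2_eq_square)
    finally show ?case using bform_nonneg[OF p] by (simp add: a_form_eq_bform)
  qed
  have intB: "integrable M (\<lambda>z. 2 * (\<nu> / \<mu>)\<^sup>2 * a_form a (F m) (F m) z + B z)" for m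
    using intF[of m] by (simp add: B_def)
  have int\<phi>: "integrable M (a_form a (\<phi> m) (\<phi> m))" for m
    by (rule Bochner_Integration.integrable_bound[OF intB[of m] measurable_a_form[OF Ch\<phi> Ch\<phi>]])
       (use AE\<phi>[of m] in \<open>eventually_elim, auto\<close>)
  define B' where "B' = 2 * (\<nu> / \<mu>)\<^sup>2 * (2 * BU + 2 * BV) + (LINT z|M. B z)"
  have le\<phi>: "(LINT z|M. a_form a (\<phi> m) (\<phi> m) z) \<le> B'" for m
  proof -
    have "(LINT z|M. a_form a (\<phi> m) (\<phi> m) z) \<le> (LINT z|M. 2 * (\<nu> / \<mu>)\<^sup>2 * a_form a (F m) (F m) z + B z)"
      by (rule integral_mono_AE[OF int\<phi> intB]) (use AE\<phi>[of m] in \<open>eventually_elim, auto\<close>)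
    also have "\<dots> = 2 * (\<nu> / \<mu>)\<^sup>2 * (LINT z|M. a_form a (F m) (F m) z) + (LINT z|M. B z)"
      using intF[of m] by (simp add: B_def)
    also have "\<dots> \<le> B'"
      unfolding B'_def by (intro add_right_mono mult_left_mono leF) simp
    finally show ?thesis .
  qed
  note lim_args = test \<phi>2 int\<phi> le\<phi> compact_imp_closed[OF K(1)] K(2) \<phi>K(1)
  have U2: "integrable M (\<lambda>z. deriv_t (U m) z * \<phi> m z)" "integrable M (a_form a (\<phi> m) (U m))"
      "integrable M (\<lambda>z. \<bar>u z\<bar> powr (q - 1) * u z * \<phi> m z)" for m
    using U_lim[of \<phi> 2 B' K, OF lim_args] by auto
  have V2: "integrable M (\<lambda>z. deriv_t (V m) z * \<phi> m z)" "integrable M (a_form a (\<phi> m) (V m))"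
      "integrable M (\<lambda>z. \<bar>v z\<bar> powr (q - 1) * v z * \<phi> m z)" for m
    using V_lim[of \<phi> 2 B' K, OF lim_args] by auto
  have lims: "(\<lambda>m. weak_form q u ut Gu (\<phi> m) + (LINT z|M. \<bar>u z\<bar> powr (q - 1) * u z * \<phi> m z) -
        ((LINT z|M. deriv_t (U m) z * \<phi> m z) + (LINT z|M. a_form a (\<phi> m) (U m) z))) \<longlonglongrightarrow> 0"
      "(\<lambda>m. weak_form q v vt Gv (\<phi> m) + (LINT z|M. \<bar>v z\<bar> powr (q - 1) * v z * \<phi> m z) -
        ((LINT z|M. deriv_t (V m) z * \<phi> m z) + (LINT z|M. a_form a (\<phi> m) (V m) z))) \<longlonglongrightarrow> 0"
    using U_lim[of \<phi> 2 B' K, OF lim_args] V_lim[of \<phi> 2 B' K, OF lim_args] by auto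

  have w_meas: "w \<in> borel_measurable M" unfolding w_def[abs_def] using U(5) V(5) by simp
  have F_meas: "F m \<in> borel_measurable M" for m
    by (rule measurable_cont[OF C_k_on_imp_continuous[OF CF]])
  have \<zeta>_meas: "\<zeta> \<in> borel_measurable M" by (rule measurable_cont[OF C_k_on_imp_continuous[OF C\<zeta>P]])
  have wq: "integrable M (\<lambda>z. \<bar>w z\<bar> powr q)"
  proof (rule Bochner_Integration.integrable_bound)
    show "integrable M (\<lambda>z. 2 powr q * (\<bar>u z\<bar> powr q + \<bar>v z\<bar> powr q))" using U(6) V(6) by simp
    show "AE z in M. norm (\<bar>w z\<bar> powr q) \<le> norm (2 powr q * (\<bar>u z\<bar> powr q + \<bar>v z\<bar> powr q))"
    proof (rule AE_I2)
      show "norm (\<bar>w z\<bar> powr q) \<le> norm (2 powr q * (\<bar>u z\<bar> powr q + \<bar>v z\<bar> powr q))" for z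
        using powr_add_le[of q "u z" "- v z"] q by (simp add: w_def)
    qed
  qed (use w_meas in measurable)
  show wq\<zeta>': "integrable M (\<lambda>z. \<bar>u z - v z\<bar> powr q * (X z * \<eta> z ^ s))"
    unfolding w_def[symmetric] \<zeta>_def[symmetric]
    by (rule integrable_mult_bounded[OF wq \<zeta>_meas, of 1]) (simp add: \<zeta>01)
  then have wq\<zeta>: "integrable M (\<lambda>z. \<bar>w z\<bar> powr q * \<zeta> z)" by (simp add: w_def \<zeta>_def)
  have Fw_le: "\<bar>F m z - w z\<bar> powr q \<le> 2 powr q * (\<bar>U m z - u z\<bar> powr q + \<bar>V m z - v z\<bar> powr q)" for m z
    using powr_add_le[of q "U m z - u z" "- (V m z - v z)"] q
    by (simp add: F_def w_def algebra_simps abs_minus_commute[of "V m z" "v z"])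
  have intUV: "integrable M (\<lambda>z. 2 powr q * (\<bar>U m z - u z\<bar> powr q + \<bar>V m z - v z\<bar> powr q))" for m
    using U(7) V(7) by simp
  have Fwq: "integrable M (\<lambda>z. \<bar>F m z - w z\<bar> powr q)" for m
  proof (rule Bochner_Integration.integrable_bound[OF intUV[of m] _ AE_I2])
    show "norm (\<bar>F m z - w z\<bar> powr q) \<le>
        norm (2 powr q * (\<bar>U m z - u z\<bar> powr q + \<bar>V m z - v z\<bar> powr q))" for z
      using Fw_le[of m z] by simp
  qed (use F_meas w_meas in measurable)
  have Fwq_lim: "(\<lambda>m. LINT z|M. \<bar>F m z - w z\<bar> powr q) \<longlonglongrightarrow> 0"
  proof (rule tendsto_sandwich[OF _ _ tendsto_const])
    have "(\<lambda>m. 2 powr q * ((LINT z|M. \<bar>U m z - u z\<bar> powr q) + (LINT z|M. \<bar>V m z - v z\<bar> powr q))) \<longlonglongrightarrow>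
        2 powr q * (0 + 0)"
      by (intro tendsto_intros U V)
    then show "(\<lambda>m. 2 powr q * ((LINT z|M. \<bar>U m z - u z\<bar> powr q) + (LINT z|M. \<bar>V m z - v z\<bar> powr q))) \<longlonglongrightarrow> 0"
      by simp
    have "(LINT z|M. \<bar>F m z - w z\<bar> powr q) \<le>
        2 powr q * ((LINT z|M. \<bar>U m z - u z\<bar> powr q) + (LINT z|M. \<bar>V m z - v z\<bar> powr q))" for m
      using integral_mono[OF Fwq intUV Fw_le, of m] U(7) V(7) by simp
    then show "\<forall>\<^sub>F m in sequentially. (LINT z|M. \<bar>F m z - w z\<bar> powr q) \<le>
        2 powr q * ((LINT z|M. \<bar>U m z - u z\<bar> powr q) + (LINT z|M. \<bar>V m z - v z\<bar> powr q))" by simp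
  qed (auto intro!: always_eventually Bochner_Integration.integral_nonneg)
  have Fw1: "integrable M (\<lambda>z. \<bar>F m z - w z\<bar>)" "(\<lambda>m. LINT z|M. \<bar>F m z - w z\<bar>) \<longlonglongrightarrow> 0" for m
    by (rule Lq_tendsto_imp_L1[of q "\<lambda>m z. F m z - w z"], use q Fwq Fwq_lim F_meas w_meas in auto)+

  have dt\<zeta>: "continuous_on UNIV (deriv_t \<zeta>)"
    by (rule C_k_on_imp_continuous_deriv[OF C\<zeta>])
  obtain Z where Z: "\<And>z. \<bar>deriv_t \<zeta> z\<bar> \<le> Z"
  proof -
    have "compact (deriv_t \<zeta> ` K)"
      by (rule compact_continuous_image[OF continuous_on_subset[OF dt\<zeta>] K(1)]) simp
    then obtain Z where Z: "\<forall>z\<in>K. \<bar>deriv_t \<zeta> z\<bar> \<le> Z"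
      by (auto dest!: compact_imp_bounded simp: bounded_iff)
    have "deriv_t \<zeta> z = 0" if "z \<notin> K" for z
      unfolding deriv_t_def
      by (rule frechet_derivative_eq_0[of "- K" _ _ 0]) (use that \<zeta>K K in \<open>auto simp: compact_imp_closed\<close>)
    then have "\<bar>deriv_t \<zeta> z\<bar> \<le> max Z 0" for z
      using Z by (cases "z \<in> K") (auto intro: max.coboundedI1)
    then show thesis by (rule that)
  qed
  have H_lip: "\<bar>H x - H y\<bar> \<le> 2 * \<bar>x - y\<bar>" for x y
  proof -
    have "norm (H x - H y) \<le> 2 * norm (x - y)"
    proof (rule field_differentiable_bound[of UNIV H h])
      show "norm (h z) \<le> 2" for z using h12[of z] by simp
    qed (use dH in auto)
    then show ?thesis by simp
  qed
  have H_nonneg: "0 \<le> H y" if "0 \<le> y" for y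
  proof -
    have "H 0 \<le> H y"
      by (rule DERIV_nonneg_imp_nondecreasing[OF that]) (meson dH h12(1) order_trans zero_le_one)
    then show ?thesis by (simp add: H0)
  qed
  define C where "C = (2 * real s + (real s)\<^sup>2 * L * (2 powr q * 2 powr q)) * \<kappa>"
  define C1 where "C1 = (real s)\<^sup>2 * L * \<kappa> * (2 powr q * 2 powr q) * \<mu> powr (1 - q)"
  define E where "E z = indicator D z * (\<mu> + \<mu> powr (1 - q) * (\<bar>w z\<bar> powr q * \<zeta> z))" for z
  \<comment> \<open>The right-hand side consists of an exact time derivative, the terms on
    \<open>D\<close>, and two errors that vanish in the mean.\<close>
  have pointwise: "AE z in M. (deriv_t (U m) z * \<phi> m z + a_form a (\<phi> m) (U m) z) -
      (deriv_t (V m) z * \<phi> m z + a_form a (\<phi> m) (V m) z) \<le>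
      \<mu> * deriv_t (g m) z + C * E z + C1 * \<bar>F m z - w z\<bar> powr q + 2 * Z * \<bar>F m z - w z\<bar>" for m
    using AE_P \<eta>x uv
  proof eventually_elim
    case (elim z)
    let ?m = "\<lambda>i j. a i j z" and ?y = "F m z / \<mu>" and ?k = "\<kappa> * indicator D z :: real"
    from elim have z: "z \<in> P" and p: "psd ?m" and w0: "0 \<le> w z" by (auto simp: w_def)
    have k0: "0 \<le> ?k" using \<kappa> by simp
    have t: "deriv_t (U m) z * \<phi> m z - deriv_t (V m) z * \<phi> m z =
        \<mu> * deriv_t (g m) z - \<mu> * H ?y * deriv_t \<zeta> z"
      using dt_g[OF z, of m] fdF[OF z, of m "(1, 0)"] by (simp add: deriv_t_def algebra_simps)
    \<comment> \<open>Dropping the time derivative of \<open>X\<close> requires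
      \<open>H \<ge> 0\<close>, which may fail at \<open>F m\<close>. So \<open>F m\<close> is
      replaced by \<open>w\<close> inside \<open>H\<close>, at the price of a Lipschitz error,
      \<open>h\<close> being at most 2.\<close>
    have "- (\<mu> * H ?y * deriv_t \<zeta> z) \<le> - (\<mu> * H (w z / \<mu>) * deriv_t \<zeta> z) + 2 * Z * \<bar>F m z - w z\<bar>"
    proof -
      have "\<mu> * (H (w z / \<mu>) - H ?y) * deriv_t \<zeta> z \<le> \<bar>\<mu> * (H (w z / \<mu>) - H ?y)\<bar> * \<bar>deriv_t \<zeta> z\<bar>"
        using abs_ge_self[of "\<mu> * (H (w z / \<mu>) - H ?y) * deriv_t \<zeta> z"] by (simp only: abs_mult)
      also have "\<dots> \<le> (2 * \<bar>F m z - w z\<bar>) * Z"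
      proof (intro mult_mono Z)
        have "\<mu> * \<bar>H (w z / \<mu>) - H ?y\<bar> \<le> \<mu> * (2 * \<bar>w z / \<mu> - ?y\<bar>)"
          using \<mu> by (intro mult_left_mono H_lip) auto
        also have "\<dots> = 2 * \<bar>F m z - w z\<bar>"
        proof -
          have "\<bar>w z / \<mu> - ?y\<bar> = \<bar>F m z - w z\<bar> / \<mu>"
            using \<mu> by (simp add: abs_minus_commute abs_divide flip: diff_divide_distrib)
          then show ?thesis using \<mu> by simp
        qed
        finally show "\<bar>\<mu> * (H (w z / \<mu>) - H ?y)\<bar> \<le> 2 * \<bar>F m z - w z\<bar>" using \<mu> by (simp add: abs_mult)
      qed auto
      finally show ?thesis by (simp add: algebra_simps)
    qed
    moreover have "- (\<mu> * H (w z / \<mu>) * deriv_t \<zeta> z) \<le>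
        2 * real s * ?k * (\<mu> + \<mu> powr (1 - q) * (\<bar>w z\<bar> powr q * \<zeta> z))"
    proof -
      have "\<mu> * H (w z / \<mu>) \<le> 2 * w z"
        using H_lip[of "w z / \<mu>" 0] H_nonneg[of "w z / \<mu>"] H0 w0 \<mu> by (simp add: field_simps)
      then show ?thesis
        unfolding deriv_t_def[of \<zeta>] fd\<zeta> \<zeta>_def
        by (intro drift_term_bound[OF q s \<mu> \<eta>(2,3) X(2,3) w0])
           (use H_nonneg[of "w z / \<mu>"] w0 \<mu> X(5)[of z] \<eta>t[OF z] k0 in \<open>auto simp: deriv_t_def\<close>)
    qed
    moreover have "a_form a (\<phi> m) (U m) z - a_form a (\<phi> m) (V m) z \<le>
        (real s)\<^sup>2 * L * ?k * (2 powr q * 2 powr q) *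
        (\<mu> + \<mu> powr (1 - q) * (\<bar>w z\<bar> powr q * \<zeta> z) + \<mu> powr (1 - q) * \<bar>F m z - w z\<bar> powr q)"
    proof -
      have "a_form a (\<phi> m) (U m) z - a_form a (\<phi> m) (V m) z = a_form a (\<phi> m) (F m) z"
        unfolding F_def[abs_def] using a_form_diff[OF U(1) V(1) z] by simp
      also have "\<dots> = h' ?y / \<mu> * (X z * \<eta> z ^ s) * bform ?m (grad_x (F m) z) (grad_x (F m) z) +
          h ?y * (X z * (real s * \<eta> z ^ (s - 1))) * bform ?m (grad_x \<eta> z) (grad_x (F m) z)"
        by (simp add: a_form_eq_bform grad_\<phi>[OF z] bform_linear \<zeta>_def)
      finally show ?thesis
        unfolding \<zeta>_def
        using diffusion_term_bound[OF q s \<mu> \<eta>(2,3) X(2,3) h12 h'b(2) hL L p, of "grad_x \<eta> z" ?k] elim(2)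
        by (simp only: a_form_eq_bform)
    qed
    \<comment> \<open>Off \<open>D\<close> the rate \<open>?k\<close> is zero and the right-hand
      side reduces to a non-negative error.\<close>
    moreover have "(real s)\<^sup>2 * L * ?k * (2 powr q * 2 powr q) *
        (\<mu> + \<mu> powr (1 - q) * (\<bar>w z\<bar> powr q * \<zeta> z) + \<mu> powr (1 - q) * \<bar>F m z - w z\<bar> powr q) +
        2 * real s * ?k * (\<mu> + \<mu> powr (1 - q) * (\<bar>w z\<bar> powr q * \<zeta> z)) \<le>
        C * E z + C1 * \<bar>F m z - w z\<bar> powr q"
    proof (cases "z \<in> D")
      case True
      then show ?thesis by (simp add: C_def C1_def E_def algebra_simps)
    next
      case False
      then show ?thesis using L \<kappa> by (simp add: C1_def E_def)
    qed
    ultimately show ?case using t by linarith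
  qed

  \<comment> \<open>The factor \<open>\<zeta>\<close> makes \<open>g m\<close> vanish off
    \<open>K\<close>, so it is smooth on the whole space and its time derivative integrates to
    zero.\<close>
  have intg: "integrable M (deriv_t (g m))" "(LINT z|M. deriv_t (g m) z) = 0" for m
  proof -
    have C1: "C_k_on 1 UNIV (g m)"
      by (rule C_k_on_extend[OF open_P Cg compact_imp_closed[OF K(1)] K(2) \<phi>K(2)])
    note ig = integral_deriv_t_eq_0[OF C1 K(1) \<phi>K(2)]
    have "deriv_t (g m) z = 0" if "z \<notin> P" for z
      unfolding deriv_t_def
      by (rule frechet_derivative_eq_0[of "- K" _ _ 0]) (use that \<phi>K(2) K in \<open>auto simp: compact_imp_closed\<close>)
    then have eq: "(\<lambda>z. indicator P z *\<^sub>R deriv_t (g m) z) = deriv_t (g m)"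
      by (auto simp: indicator_def fun_eq_iff)
    show "integrable M (deriv_t (g m))"
      using ig(1) unfolding set_integrable_iff[symmetric] set_integrable_def eq .
    show "(LINT z|M. deriv_t (g m) z) = 0"
      using ig(2) unfolding set_integral_eq[symmetric] set_lebesgue_integral_def eq .
  qed
  have intE: "integrable M E"
  proof -
    have "integrable M (\<lambda>z. (\<mu> + \<mu> powr (1 - q) * (\<bar>w z\<bar> powr q * \<zeta> z)) * indicator D z)"
    proof (rule integrable_mult_bounded[of _ _ 1])
      have "D \<in> sets lebesgue" using D by (intro sets_completionI_sets) simp
      then show "(indicator D :: _ \<Rightarrow> real) \<in> borel_measurable M"
        by (intro measurable_restrict_space1 borel_measurable_indicator)
    qed (use wq\<zeta> in \<open>auto simp: indicator_def\<close>)
    then show ?thesis unfolding E_def[abs_def] by (simp only: mult.commute)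
  qed
  let ?N = "\<lambda>u m. LINT z|M. \<bar>u z\<bar> powr (q - 1) * u z * \<phi> m z"
  let ?I = "\<lambda>U m. (LINT z|M. deriv_t (U m) z * \<phi> m z) + (LINT z|M. a_form a (\<phi> m) (U m) z)"
  \<comment> \<open>The discrepancy between the weak form and its smooth approximation; it tends to
    0 by \<open>lims\<close>, as does the one for \<open>v\<close>.\<close>
  let ?Ru = "\<lambda>m. weak_form q u ut Gu (\<phi> m) + ?N u m - ?I U m"
  let ?Rv = "\<lambda>m. weak_form q v vt Gv (\<phi> m) + ?N v m - ?I V m"
  let ?rhs = "\<lambda>m. C * (LINT z|M. E z) + C1 * (LINT z|M. \<bar>F m z - w z\<bar> powr q) +
      2 * Z * (LINT z|M. \<bar>F m z - w z\<bar>) + (?Ru m - ?Rv m)"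
  have "2 powr (- q) * (LINT z|M. \<bar>w z\<bar> powr q * \<zeta> z) \<le> ?rhs m" for m
  proof -
    have "2 powr (- q) * (LINT z|M. \<bar>w z\<bar> powr q * \<zeta> z) = (LINT z|M. 2 powr (- q) * (\<bar>w z\<bar> powr q * \<zeta> z))"
      by simp
    also have "\<dots> \<le> (LINT z|M. \<bar>u z\<bar> powr (q - 1) * u z * \<phi> m z - \<bar>v z\<bar> powr (q - 1) * v z * \<phi> m z)"
    proof (rule integral_mono_AE)
      show "AE z in M. 2 powr (- q) * (\<bar>w z\<bar> powr q * \<zeta> z) \<le>
          \<bar>u z\<bar> powr (q - 1) * u z * \<phi> m z - \<bar>v z\<bar> powr (q - 1) * v z * \<phi> m z"
        using uv
      proof eventually_elim
        case (elim z)
        have 1: "2 powr (- q) * \<bar>w z\<bar> powr q \<le> \<bar>u z\<bar> powr (q - 1) * u z - \<bar>v z\<bar> powr (q - 1) * v z"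
          using powr_diff_ge[OF q elim] elim by (simp add: w_def)
        have "2 powr (- q) * \<bar>w z\<bar> powr q * \<zeta> z \<le> 2 powr (- q) * \<bar>w z\<bar> powr q * \<phi> m z"
          using \<phi>_ge by (intro mult_left_mono) auto
        also have "\<dots> \<le> (\<bar>u z\<bar> powr (q - 1) * u z - \<bar>v z\<bar> powr (q - 1) * v z) * \<phi> m z"
          using 1 \<phi>0 by (intro mult_right_mono)
        finally show ?case by (simp add: left_diff_distrib mult.assoc)
      qed
    qed (use wq\<zeta> U2 V2 in auto)
    also have "\<dots> = ?N u m - ?N v m" using U2 V2 by simp
    \<comment> \<open>The differential inequality enters here, tested with
      \<open>\<phi> m\<close>.\<close>
    also have "\<dots> \<le> ?I U m - ?I V m + (?Ru m - ?Rv m)"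
      using weak[OF test \<phi>0] by simp
    also have "?I U m - ?I V m = (LINT z|M. (deriv_t (U m) z * \<phi> m z + a_form a (\<phi> m) (U m) z) -
        (deriv_t (V m) z * \<phi> m z + a_form a (\<phi> m) (V m) z))"
      using U2[of m] V2[of m] by simp
    also have "\<dots> \<le> (LINT z|M. \<mu> * deriv_t (g m) z + C * E z + C1 * \<bar>F m z - w z\<bar> powr q + 2 * Z * \<bar>F m z - w z\<bar>)"
      by (rule integral_mono_AE[OF _ _ pointwise]) (use U2[of m] V2[of m] intg(1)[of m] intE Fwq Fw1(1) in auto)
    also have "\<dots> = C * (LINT z|M. E z) + C1 * (LINT z|M. \<bar>F m z - w z\<bar> powr q) + 2 * Z * (LINT z|M. \<bar>F m z - w z\<bar>)"
      using intg[of m] intE Fwq[of m] Fw1(1)[of m] by simp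
    finally show ?thesis by simp
  qed
  moreover have "?rhs \<longlonglongrightarrow> C * (LINT z|M. E z) + C1 * 0 + 2 * Z * 0 + (0 - 0)"
    by (intro tendsto_intros Fwq_lim Fw1(2) lims)
  ultimately have "2 powr (- q) * (LINT z|M. \<bar>w z\<bar> powr q * \<zeta> z) \<le> C * (LINT z|M. E z) + C1 * 0 + 2 * Z * 0 + (0 - 0)"
    by (intro LIMSEQ_le_const) auto
  then show "2 powr (- q) * (LINT z|M. \<bar>u z - v z\<bar> powr q * (X z * \<eta> z ^ s)) \<le>
      (2 * real s + (real s)\<^sup>2 * L * (2 powr q * 2 powr q)) * \<kappa> *
      (LINT z|M. indicator D z * (\<mu> + \<mu> powr (1 - q) * (\<bar>u z - v z\<bar> powr q * (X z * \<eta> z ^ s))))"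
    by (simp add: w_def \<zeta>_def E_def C_def)
qed

end

section \<open>Scaling and conclusion\<close>

text \<open>The estimate is used twice. For a suitably large \<open>r\<close> its last term is
  absorbed on the left, which bounds the integrals uniformly in \<open>k\<close> and makes
  \<open>W\<close> integrable. Then that term tends to 0, since \<open>D k\<close> leaves every
  point where \<open>W\<close> is non-zero, and \<open>r\<close> is free to tend to 0.\<close>

lemma AE_eq_0_if_self_improving:
  fixes W :: "'a \<Rightarrow> real" and \<zeta> :: "nat \<Rightarrow> 'a \<Rightarrow> real" and D :: "nat \<Rightarrow> 'a set"
  assumes q: "1 < q" and C: "0 \<le> C"
    and W: "W \<in> borel_measurable M" "\<And>z. 0 \<le> W z"
    and \<zeta>: "\<And>k z. 0 \<le> \<zeta> k z" "\<And>k z. \<zeta> k z \<le> 1"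
    and D: "\<And>k. D k \<in> sets M"
    and ev: "\<And>z. W z \<noteq> 0 \<Longrightarrow> \<forall>\<^sub>F k in sequentially. \<zeta> k z = 1 \<and> z \<notin> D k"
    and int: "\<And>k. integrable M (\<lambda>z. W z * \<zeta> k z)"
    and est: "\<And>k r. 0 < r \<Longrightarrow> (LINT z|M. W z * \<zeta> k z) \<le>
        C * (r + r powr (1 - q) * (LINT z|M. indicator (D k) z * (W z * \<zeta> k z)))"
  shows "AE z in M. W z = 0"
proof -
  let ?I = "\<lambda>k. LINT z|M. W z * \<zeta> k z" and ?J = "\<lambda>k. LINT z|M. indicator (D k) z * (W z * \<zeta> k z)"
  have W\<zeta>: "0 \<le> W z * \<zeta> k z" "W z * \<zeta> k z \<le> W z" for k z
    using W(2)[of z] \<zeta>[of k z] by (auto intro: mult_left_le)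
  have intJ: "integrable M (\<lambda>z. indicator (D k) z * (W z * \<zeta> k z))" for k
    using integrable_mult_indicator[OF D int, of k k] by simp
  have JI: "?J k \<le> ?I k" for k
    by (rule integral_mono[OF intJ int]) (use W\<zeta> in \<open>auto simp: indicator_def\<close>)
  \<comment> \<open>This gives \<open>C / b \<le> 1 / 2\<close>, with \<open>b\<close> positive even
    for \<open>C = 0\<close>; \<open>r0\<close> is chosen to solve
    \<open>r0 powr (1 - q) = 1 / b\<close>.\<close>
  define b where "b = 2 * C + 1"
  have b: "0 < b" using C by (simp add: b_def)
  define r0 where "r0 = b powr (1 / (q - 1))"
  have r0: "0 < r0" using b by (simp add: r0_def)
  have "1 / (q - 1) * (1 - q) = - 1" using q by (simp add: field_simps)
  then have r0q: "r0 powr (1 - q) = 1 / b"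
    unfolding r0_def powr_powr using b by (simp add: powr_minus_divide)
  have bound: "?I k \<le> 2 * C * r0" for k
  proof -
    have I0: "0 \<le> ?I k" by (rule Bochner_Integration.integral_nonneg) (rule W\<zeta>)
    have "?I k \<le> C * (r0 + 1 / b * ?J k)" using est[OF r0, of k] by (simp only: r0q)
    also have "\<dots> \<le> C * (r0 + 1 / b * ?I k)"
      using C b JI[of k] by (intro mult_left_mono add_left_mono) auto
    also have "\<dots> = C * r0 + C / b * ?I k" by (simp add: distrib_left)
    also have "\<dots> \<le> C * r0 + 1 / 2 * ?I k"
    proof -
      have "C / b \<le> 1 / 2" using b by (simp add: b_def divide_le_eq)
      then show ?thesis using I0 by (intro add_left_mono mult_right_mono)
    qed
    finally show ?thesis by simp
  qed
  \<comment> \<open>Fatou's lemma in the extended non-negative reals, because integrability of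
    \<open>W\<close> is not yet available.\<close>
  have "(\<integral>\<^sup>+z. ennreal (W z) \<partial>M) \<le> (\<integral>\<^sup>+z. liminf (\<lambda>k. ennreal (W z * \<zeta> k z)) \<partial>M)"
  proof (rule nn_integral_mono)
    fix z
    have "(\<lambda>k. ennreal (W z * \<zeta> k z)) \<longlonglongrightarrow> ennreal (W z)"
    proof (cases "W z = 0")
      case False
      from ev[OF this] show ?thesis
        by (intro tendsto_eventually) (elim eventually_mono, auto)
    qed simp
    then show "ennreal (W z) \<le> liminf (\<lambda>k. ennreal (W z * \<zeta> k z))"
      by (simp add: lim_imp_Liminf)
  qed
  also have "\<dots> \<le> liminf (\<lambda>k. \<integral>\<^sup>+z. ennreal (W z * \<zeta> k z) \<partial>M)"
    by (rule nn_integral_liminf) (use int in auto)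
  also have "\<dots> \<le> ennreal (2 * C * r0)"
  proof -
    have "(\<integral>\<^sup>+z. ennreal (W z * \<zeta> k z) \<partial>M) \<le> ennreal (2 * C * r0)" for k
      using bound[of k] by (subst nn_integral_eq_integral[OF int]) (auto simp: W\<zeta> intro!: ennreal_leI)
    then have "liminf (\<lambda>k. \<integral>\<^sup>+z. ennreal (W z * \<zeta> k z) \<partial>M) \<le> liminf (\<lambda>k. ennreal (2 * C * r0))"
      by (intro Liminf_mono always_eventually allI)
    then show ?thesis by (simp add: Liminf_const)
  qed
  finally have intW: "integrable M W"
    using W by (intro integrableI_bounded) (auto simp: less_top[symmetric] top_unique)
  have limI: "?I \<longlonglongrightarrow> (LINT z|M. W z)"
  proof (rule integral_dominated_convergence[where w = W])
    show "AE z in M. (\<lambda>k. W z * \<zeta> k z) \<longlonglongrightarrow> W z"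
    proof (rule AE_I2)
      show "(\<lambda>k. W z * \<zeta> k z) \<longlonglongrightarrow> W z" for z
      proof (cases "W z = 0")
        case False
        from ev[OF this] show ?thesis
          by (intro tendsto_eventually) (elim eventually_mono, auto)
      qed simp
    qed
  qed (use W int W\<zeta> intW in \<open>auto intro: borel_measurable_integrable\<close>)
  have limJ: "?J \<longlonglongrightarrow> (LINT z|M. 0)"
  proof (rule integral_dominated_convergence[where w = W])
    show "AE z in M. (\<lambda>k. indicator (D k) z * (W z * \<zeta> k z)) \<longlonglongrightarrow> 0"
    proof (rule AE_I2)
      show "(\<lambda>k. indicator (D k) z * (W z * \<zeta> k z)) \<longlonglongrightarrow> 0" for z
      proof (cases "W z = 0")
        case False
        from ev[OF this] show ?thesis
          by (intro tendsto_eventually) (elim eventually_mono, auto)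
      qed simp
    qed
    show "AE z in M. norm (indicator (D k) z * (W z * \<zeta> k z)) \<le> W z" for k
      using W\<zeta> W by (auto simp: indicator_def)
  qed (use borel_measurable_integrable[OF intJ] intW in auto)
  have le: "(LINT z|M. W z) \<le> C * r" if "0 < r" for r
  proof (rule LIMSEQ_le[OF limI])
    show "(\<lambda>k. C * (r + r powr (1 - q) * ?J k)) \<longlonglongrightarrow> C * r"
      using tendsto_mult_left[OF tendsto_add[OF tendsto_const tendsto_mult_left[OF limJ]],
          of C r "r powr (1 - q)"] by simp
  qed (use est[OF that] in auto)
  have "(LINT z|M. W z) \<le> 0"
  proof (rule field_le_epsilon)
    fix e :: real assume "0 < e"
    \<comment> \<open>Taking \<open>r = e / (C + 1)\<close> avoids a division by \<open>C\<close>,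
      which may be 0.\<close>
    then have "(LINT z|M. W z) \<le> C * (e / (C + 1))" using C by (intro le) simp
    also have "\<dots> \<le> e" using C \<open>0 < e\<close> by (simp add: divide_le_eq)
    finally show "(LINT z|M. W z) \<le> 0 + e" by simp
  qed
  moreover have "0 \<le> (LINT z|M. W z)" by (rule Bochner_Integration.integral_nonneg) (rule W)
  moreover have "AE z in M. 0 \<le> W z" using W(2) by simp
  ultimately show ?thesis
    using integral_nonneg_eq_0_iff_AE[OF intW] by simp
qed

section \<open>Volume bound and space-time cutoffs\<close>

lemma measure_box_le:
  fixes T R :: real
  assumes "0 < T" "0 < R"
  shows "measure lebesgue ({0<..<2 * T} \<times> ball 0 (2 * R) :: (real \<times> (real ^ 'n)) set) \<le>
    2 * T * (4 * R) ^ CARD('n)"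
proof -
  let ?b = "(\<chi> i. 2 * R) :: real ^ 'n"
  let ?Q = "cbox (0, - ?b) (2 * T, ?b)"
  have "{0<..<2 * T} \<times> ball 0 (2 * R) \<subseteq> ?Q"
  proof
    fix z :: "real \<times> (real ^ 'n)"
    assume z: "z \<in> {0<..<2 * T} \<times> ball 0 (2 * R)"
    have "\<bar>snd z $ i\<bar> \<le> 2 * R" for i
      using component_le_norm_cart[of "snd z" i] z by auto
    then have "snd z \<in> cbox (- ?b) ?b"
      by (simp add: mem_box_cart abs_le_iff) (metis minus_le_iff)
    then show "z \<in> ?Q" using z by (auto simp: cbox_Pair_eq)
  qed
  then have "measure lebesgue ({0<..<2 * T} \<times> ball 0 (2 * R) :: (real \<times> (real ^ 'n)) set) \<le> measure lebesgue ?Q"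
    by (intro measure_mono_fmeasurable) (auto intro!: fmeasurableD lmeasurable_open bounded_Times open_Times)
  also have "\<dots> = 2 * T * (4 * R) ^ CARD('n)"
  proof -
    have "cbox (- ?b) ?b \<noteq> {}" using assms by (simp add: interval_ne_empty_cart)
    then show ?thesis
      using assms by (simp add: content_Pair content_cbox_cart)
  qed
  finally show ?thesis .
qed

lemma C_k_on_fst: "C_k_on k UNIV (fst :: real \<times> (real ^ 'n) \<Rightarrow> real)"
  by (rule C_k_on_bounded_linear) (auto simp: bounded_linear_fst)

lemma C_k_on_snd_inner: "C_k_on k UNIV (\<lambda>z :: real \<times> (real ^ 'n). snd z \<bullet> snd z)"
proof -
  have "bounded_linear (\<lambda>z :: real \<times> (real ^ 'n). snd z $ i)" for i
    by (rule bounded_linear_compose[OF bounded_linear_vec_nth bounded_linear_snd])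
  then show ?thesis
    unfolding inner_vec_def inner_real_def
    by (intro C_k_on_sum C_k_on_mult C_k_on_bounded_linear) auto
qed

text \<open>For a smooth step \<open>g\<close>, \<open>X\<close> is 0 up to time \<open>d\<close>
  and 1 from \<open>2 * d\<close> on. The time factor of \<open>\<eta>\<close> falls from 1 to 0
  between \<open>T / 2\<close> and \<open>T\<close>; the space factor falls while the squared norm
  goes from \<open>R^2 / 2\<close> to \<open>3 * R^2 / 4\<close>, inside the annulus
  \<open>R / 2 < |x| < R\<close>. The squared norm keeps it smooth at the origin.\<close>

lemma
  fixes g g' :: "real \<Rightarrow> real" and d T R :: real
  assumes g: "\<And>k. C_k_on k UNIV g" "\<And>x. (g has_real_derivative g' x) (at x)"
    and pos: "0 < d" "0 < T" "0 < R"
  defines "X \<equiv> \<lambda>z :: real \<times> (real ^ 'n). g (fst z / d - 1)"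
    and "\<eta> \<equiv> \<lambda>z :: real \<times> (real ^ 'n). g (2 - 2 * fst z / T) * g (3 - 4 * (snd z \<bullet> snd z) / R\<^sup>2)"
  shows C_k_on_time_cutoff: "C_k_on k UNIV X"
    and deriv_t_time_cutoff: "deriv_t X z = g' (fst z / d - 1) / d"
    and deriv_x_time_cutoff: "deriv_x i X z = 0"
    and C_k_on_cutoff: "C_k_on k UNIV \<eta>"
    and deriv_t_cutoff: "deriv_t \<eta> z =
      - (2 / T * g' (2 - 2 * fst z / T) * g (3 - 4 * (snd z \<bullet> snd z) / R\<^sup>2))"
    and grad_x_cutoff: "grad_x \<eta> z =
      (- (8 / R\<^sup>2 * g (2 - 2 * fst z / T) * g' (3 - 4 * (snd z \<bullet> snd z) / R\<^sup>2))) *\<^sub>R snd z"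
proof -
  have lin: "C_k_on k UNIV (\<lambda>z :: real \<times> (real ^ 'n). c * fst z + e)" for c e k
    by (intro C_k_on_add C_k_on_mult C_k_on_const C_k_on_fst) auto
  have quad: "C_k_on k UNIV (\<lambda>z :: real \<times> (real ^ 'n). c * (snd z \<bullet> snd z) + e)" for c e k
    by (intro C_k_on_add C_k_on_mult C_k_on_const C_k_on_snd_inner) auto
  have "C_k_on k UNIV (\<lambda>z :: real \<times> (real ^ 'n). g (1 / d * fst z + - 1))" for k
    by (rule C_k_on_compose[OF _ _ _ lin g(1)]) auto
  then show "C_k_on k UNIV X" by (simp add: X_def)
  have "C_k_on k UNIV (\<lambda>z :: real \<times> (real ^ 'n). g (- 2 / T * fst z + 2) * g (- 4 / R\<^sup>2 * (snd z \<bullet> snd z) + 3))" for k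
    by (intro C_k_on_mult C_k_on_compose[OF _ _ _ lin g(1)] C_k_on_compose[OF _ _ _ quad g(1)]) auto
  then show "C_k_on k UNIV \<eta>" by (simp add: \<eta>_def)
  have "(X has_derivative (\<lambda>b. g' (fst z / d - 1) * (fst b / d))) (at z)"
    unfolding X_def
    by (rule has_derivative_compose[OF _ g(2)[unfolded has_field_derivative_def]])
       (use pos in \<open>auto intro!: derivative_eq_intros\<close>)
  from frechet_derivative_at[OF this, symmetric]
  show "deriv_t X z = g' (fst z / d - 1) / d" "deriv_x i X z = 0"
    by (simp_all add: deriv_t_def deriv_x_def)
  let ?p = "2 - 2 * fst z / T" and ?q = "3 - 4 * (snd z \<bullet> snd z) / R\<^sup>2"
  have 1: "((\<lambda>z :: real \<times> (real ^ 'n). g (2 - 2 * fst z / T)) has_derivative (\<lambda>b. g' ?p * (- 2 * fst b / T))) (at z)"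
    by (rule has_derivative_compose[OF _ g(2)[unfolded has_field_derivative_def]])
       (use pos in \<open>auto intro!: derivative_eq_intros\<close>)
  have 2: "((\<lambda>z :: real \<times> (real ^ 'n). g (3 - 4 * (snd z \<bullet> snd z) / R\<^sup>2)) has_derivative
      (\<lambda>b. g' ?q * (- 8 * (snd z \<bullet> snd b) / R\<^sup>2))) (at z)"
    by (rule has_derivative_compose[OF _ g(2)[unfolded has_field_derivative_def]])
       (use pos in \<open>auto intro!: derivative_eq_intros simp: inner_commute power2_eq_square\<close>)
  have fd: "frechet_derivative \<eta> (at z) b =
      g ?p * (g' ?q * (- 8 * (snd z \<bullet> snd b) / R\<^sup>2)) + g' ?p * (- 2 * fst b / T) * g ?q" for b
    using frechet_derivative_at[OF has_derivative_mult[OF 1 2], symmetric] by (simp add: \<eta>_def)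
  show "deriv_t \<eta> z = - (2 / T * g' ?p * g ?q)"
    by (simp add: deriv_t_def fd)
  show "grad_x \<eta> z = (- (8 / R\<^sup>2 * g ?p * g' ?q)) *\<^sub>R snd z"
    by (simp add: grad_x_def deriv_x_def fd vec_eq_iff inner_axis)
qed

lemma AE_lebesgue_on_subset:
  fixes S P :: "'a::euclidean_space set"
  assumes "open S" "open P" "P \<subseteq> S" "AE z in lebesgue_on S. Q z"
  shows "AE z in lebesgue_on P. Q z"
proof -
  have "S \<in> sets lebesgue" "P \<in> sets lebesgue" using assms by (auto intro: sets_completionI_sets)
  then show ?thesis
    using assms(3,4) by (auto simp: AE_restrict_space_iff elim!: eventually_mono)
qed

text \<open>The choice \<open>T = R powr \<alpha>\<close> balances the two derivatives of
  \<open>\<eta>\<close>: the one in time has size \<open>1 / T\<close>, and the energy is at most a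
  multiple of \<open>R^(-2) * R^(2 - \<alpha>)\<close>. Both give the rate \<open>\<kappa>\<close>,
  a multiple of \<open>R powr (- \<alpha>)\<close>. With
  \<open>\<mu> = r * R powr (- \<alpha> / (q - 1))\<close> the product
  \<open>\<kappa> * \<mu> powr (1 - q)\<close> is free of \<open>R\<close>, and no constant depends
  on \<open>R\<close> or \<open>d\<close>.\<close>

lemma scaled_energy_estimate:
  fixes a :: "'n::finite \<Rightarrow> 'n \<Rightarrow> real \<times> (real ^ 'n) \<Rightarrow> real"
    and A u v :: "real \<times> (real ^ 'n) \<Rightarrow> real" and \<alpha> q c R d r :: real and s :: nat
  assumes \<alpha>: "\<alpha> > 0" and q: "1 < q" "q \<le> 1 + \<alpha> / real CARD('n)"
    and a: "\<And>i j. a i j \<in> borel_measurable (lebesgue_on \<S>)"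
    and psd: "AE z in lebesgue_on \<S>. psd (\<lambda>i j. a i j z) \<and>
      (\<forall>\<xi>. bform (\<lambda>i j. a i j z) \<xi> \<xi> \<le> A z * (norm \<xi>)\<^sup>2)"
    and c: "c > 0"
    and A: "\<And>R. R > 1 \<Longrightarrow> esssup (lebesgue_on ({0<..} \<times> {x. R / 2 < norm x \<and> norm x < R})) (\<lambda>z. ereal (A z))
        \<le> ereal (c * R powr (2 - \<alpha>))"
    and u: "W_loc a q u ut Gu" and v: "W_loc a q v vt Gv"
    and weak: "\<And>\<phi>. test_function_on \<S> \<phi> \<Longrightarrow> (\<And>z. z \<in> \<S> \<Longrightarrow> 0 \<le> \<phi> z) \<Longrightarrow>
      weak_form q v vt Gv \<phi> \<le> weak_form q u ut Gu \<phi>"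
    and uv: "AE z in lebesgue_on \<S>. v z \<le> u z"
    and g: "\<And>k. C_k_on k UNIV g" "\<And>x. x \<le> 0 \<Longrightarrow> g x = 0" "\<And>x. 0 \<le> g x" "\<And>x. g x \<le> 1"
      "\<And>x. (g has_real_derivative g' x) (at x)" "\<And>x. 0 \<le> g' x" "\<And>x. g' x \<le> G"
      "\<And>x. x \<le> 0 \<or> 1 \<le> x \<Longrightarrow> g' x = 0"
    and nl: "test_nonlinearity ((q - 1) / 2) h h' H L" and s: "4 * q / (q - 1) \<le> real s"
    and R: "1 < R" and d: "0 < d" and r: "0 < r"
  defines "T \<equiv> R powr \<alpha>"
  defines "X \<equiv> \<lambda>z :: real \<times> (real ^ 'n). g (fst z / d - 1)"
    and "\<eta> \<equiv> \<lambda>z :: real \<times> (real ^ 'n). g (2 - 2 * fst z / T) * g (3 - 4 * (snd z \<bullet> snd z) / R\<^sup>2)"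
    and "P \<equiv> {0<..<2 * T} \<times> ball 0 (2 * R)"
    and "D \<equiv> {z :: real \<times> (real ^ 'n). \<not> (fst z < T / 2 \<and> norm (snd z) < R / 2)}"
  shows "z \<notin> P \<Longrightarrow> X z * \<eta> z ^ s = 0"
    and "integrable (lebesgue_on P) (\<lambda>z. \<bar>u z - v z\<bar> powr q * (X z * \<eta> z ^ s))"
    and "2 powr (- q) * (LINT z|lebesgue_on P. \<bar>u z - v z\<bar> powr q * (X z * \<eta> z ^ s)) \<le>
      (2 * real s + (real s)\<^sup>2 * L * (2 powr q * 2 powr q)) * (2 * G + 64 * c * G\<^sup>2) *
      (2 * 4 ^ CARD('n) * r + r powr (1 - q) *
        (LINT z|lebesgue_on P. indicator D z * (\<bar>u z - v z\<bar> powr q * (X z * \<eta> z ^ s))))"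
proof -
  let ?n = "CARD('n)"
  have T: "0 < T" using R by (simp add: T_def)
  have R0: "0 < R" using R by simp
  have openP: "open P" unfolding P_def by (intro open_Times) auto
  have boundedP: "bounded P" unfolding P_def by (intro bounded_Times) auto
  have PS: "P \<subseteq> \<S>" unfolding P_def halfspace_def by auto
  have dom: "bounded_domain P"
    using openP boundedP unfolding bounded_domain_def
    by (auto simp: P_def intro!: convex_connected convex_Times)
  have psdP: "AE z in lebesgue_on P. psd (\<lambda>i j. a i j z) \<and>
      (\<forall>\<xi>. bform (\<lambda>i j. a i j z) \<xi> \<xi> \<le> A z * (norm \<xi>)\<^sup>2)"
    by (rule AE_lebesgue_on_subset[OF open_halfspace openP PS psd])
  interpret degenerate_form a P
  proof
    show "a i j \<in> borel_measurable (lebesgue_on P)" for i j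
      by (rule measurable_restrict_mono[OF a PS])
    show "AE z in lebesgue_on P. psd (\<lambda>i j. a i j z)"
      using psdP by eventually_elim simp
  qed (fact openP boundedP PS)+
  \<comment> \<open>Since \<open>d > 0\<close>, the support stays away from \<open>t = 0\<close>;
    the larger bounds \<open>2 * T\<close> and \<open>2 * R\<close> in \<open>P\<close> leave room
    around the compact set.\<close>
  define K :: "(real \<times> (real ^ 'n)) set" where "K = {d..T} \<times> cball 0 R"
  have K: "compact K" unfolding K_def by (intro compact_Times) auto
  have "T < 2 * T" "R < 2 * R" using T R0 by auto
  then have KP: "K \<subseteq> P" unfolding K_def P_def using d by auto
  have XK: "X z * \<eta> z = 0" if zK: "z \<notin> K" for z
  proof -
    consider "fst z < d" | "T < fst z" | "R < norm (snd z)"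
      using zK by (cases z) (force simp: K_def)
    then show ?thesis
    proof cases
      case 1
      then have "fst z / d - 1 \<le> 0" using d by simp
      then show ?thesis using g(2) by (simp add: X_def)
    next
      case 2
      then have "2 - 2 * fst z / T \<le> 0" using T by (simp add: field_simps)
      then show ?thesis using g(2) by (simp add: \<eta>_def)
    next
      case 3
      then have "R\<^sup>2 \<le> snd z \<bullet> snd z" using R0 by (simp add: power2_norm_eq_inner[symmetric] power_mono)
      then have "3 * R\<^sup>2 \<le> 4 * (snd z \<bullet> snd z)" using zero_le_power2[of R] by linarith
      then have "3 - 4 * (snd z \<bullet> snd z) / R\<^sup>2 \<le> 0" using R0 by (simp add: field_simps)
      then show ?thesis using g(2) by (simp add: \<eta>_def)
    qed
  qed
  have "1 \<le> 4 * q / (q - 1)" using q by (simp add: le_divide_eq)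
  then have s1: "1 \<le> s" using s by simp
  show "X z * \<eta> z ^ s = 0" if "z \<notin> P" for z
    using XK[of z] KP that s1 by auto
  have L: "0 < L" using nl by (simp add: test_nonlinearity_def)
  have G: "0 \<le> G" using g(6,7) order_trans by blast
  \<comment> \<open>The term \<open>2 * G\<close> comes from the slope of the time factor, and
    \<open>64 * c * G^2\<close> from the square of \<open>8 / R^2 * G\<close> times
    \<open>c * R powr (2 - \<alpha>) * R^2\<close>.\<close>
  define \<kappa>0 where "\<kappa>0 = 2 * G + 64 * c * G\<^sup>2"
  have \<kappa>0: "0 \<le> \<kappa>0" using G c by (simp add: \<kappa>0_def)
  define \<kappa> where "\<kappa> = \<kappa>0 * R powr (- \<alpha>)"
  have \<kappa>: "0 \<le> \<kappa>" using \<kappa>0 by (simp add: \<kappa>_def)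
  have le_\<kappa>: "x * R powr (- \<alpha>) \<le> \<kappa> * indicator D z" if "x \<le> \<kappa>0" "z \<in> D" for x z
    using that by (simp add: \<kappa>_def mult_right_mono)
  have D: "D \<in> sets borel"
  proof -
    have "D = {z. T / 2 \<le> fst z} \<union> {z. R / 2 \<le> norm (snd z)}" by (auto simp: D_def)
    moreover have "closed \<dots>" by (intro closed_Un closed_Collect_le continuous_intros)
    ultimately show ?thesis by simp
  qed
  note cut = C_k_on_time_cutoff[OF g(1,5) d T R0] deriv_t_time_cutoff[OF g(1,5) d T R0]
    deriv_x_time_cutoff[OF g(1,5) d T R0] C_k_on_cutoff[OF g(1,5) d T R0]
    deriv_t_cutoff[OF g(1,5) d T R0] grad_x_cutoff[OF g(1,5) d T R0]
  have CX: "C_k_on k UNIV X" for k unfolding X_def by (rule cut(1))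
  have X01: "0 \<le> X z" "X z \<le> 1" for z using g(3,4) by (simp_all add: X_def)
  have dxX: "deriv_x i X z = 0" for i z unfolding X_def by (rule cut(3))
  have dtX: "0 \<le> deriv_t X z" for z unfolding X_def cut(2) using g(6) d by simp
  have C\<eta>: "C_k_on k UNIV \<eta>" for k unfolding \<eta>_def by (rule cut(4))
  have \<eta>01: "0 \<le> \<eta> z" "\<eta> z \<le> 1" for z
    using g(3,4) by (simp_all add: \<eta>_def mult_le_one)
  have \<eta>t: "- (\<kappa> * indicator D z) \<le> deriv_t \<eta> z" for z
  proof (cases "g' (2 - 2 * fst z / T) = 0")
    case True
    then show ?thesis unfolding \<eta>_def cut(5) using \<kappa> by simp
  next
    case False
    \<comment> \<open>A non-zero slope means that the step is still below its plateau, that is,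
      \<open>t > T / 2\<close>; such points belong to \<open>D\<close>.\<close>
    then have "2 - 2 * fst z / T < 1" using g(8)[of "2 - 2 * fst z / T"] by force
    then have zD: "z \<in> D" using T by (simp add: D_def field_simps)
    have "2 / T * g' (2 - 2 * fst z / T) * g (3 - 4 * (snd z \<bullet> snd z) / R\<^sup>2) \<le> 2 / T * G * 1"
      using T g G by (intro mult_mono) auto
    also have "\<dots> = 2 * G * R powr (- \<alpha>)" by (simp add: T_def powr_minus_divide)
    also have "\<dots> \<le> \<kappa> * indicator D z"
      using c by (intro le_\<kappa> zD) (simp add: \<kappa>0_def)
    finally show ?thesis unfolding \<eta>_def cut(5) by simp
  qed
  have annulus: "AE z in lebesgue_on P. R / 2 < norm (snd z) \<and> norm (snd z) < R \<longrightarrow> A z \<le> c * R powr (2 - \<alpha>)"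
  proof -
    let ?O = "{0<..} \<times> {x. R / 2 < norm x \<and> norm x < R} :: (real \<times> (real ^ 'n)) set"
    have "open {x :: real ^ 'n. R / 2 < norm x \<and> norm x < R}"
      by (intro open_Collect_conj open_Collect_less continuous_intros)
    then have "open ?O" by (intro open_Times) auto
    then have O: "?O \<in> sets lebesgue" by (intro sets_completionI_sets) (simp only: sets_lborel borel_open)
    have "AE z in lebesgue_on ?O. ereal (A z) \<le> esssup (lebesgue_on ?O) (\<lambda>z. ereal (A z))"
      by (rule esssup_AE)
    then have "AE z in lebesgue_on ?O. A z \<le> c * R powr (2 - \<alpha>)"
    proof eventually_elim
      case (elim z)
      from order_trans[OF this A[OF R]] show ?case by simp
    qed
    then have "AE z in lebesgue. z \<in> ?O \<longrightarrow> A z \<le> c * R powr (2 - \<alpha>)"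
      using O by (simp add: AE_restrict_space_iff)
    moreover have "P \<in> sets lebesgue" using openP by (intro sets_completionI_sets) auto
    ultimately show ?thesis
      by (subst AE_restrict_space_iff) (auto simp: P_def elim!: eventually_mono)
  qed
  have \<eta>x: "AE z in lebesgue_on P. a_form a \<eta> \<eta> z \<le> \<kappa> * indicator D z"
    using psdP annulus
  proof eventually_elim
    case (elim z)
    let ?p = "2 - 2 * fst z / T" and ?y = "3 - 4 * (snd z \<bullet> snd z) / R\<^sup>2"
    let ?k = "8 / R\<^sup>2 * g ?p * g' ?y"
    have eq: "a_form a \<eta> \<eta> z = ?k\<^sup>2 * bform (\<lambda>i j. a i j z) (snd z) (snd z)"
      unfolding a_form_eq_bform \<eta>_def cut(6) bform_linear by (simp add: power2_eq_square)
    show ?case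
    proof (cases "g' ?y = 0")
      case True
      then show ?thesis unfolding eq using \<kappa> by simp
    next
      case False
      \<comment> \<open>A non-zero slope places the point inside the annulus on which
        \<open>A\<close> is controlled, and also in \<open>D\<close>.\<close>
      then have "0 < ?y" "?y < 1" using g(8)[of ?y] by force+
      then have 1: "R\<^sup>2 / 2 < (norm (snd z))\<^sup>2" "(norm (snd z))\<^sup>2 < R\<^sup>2 * (3 / 4)"
        using R0 by (simp_all add: power2_norm_eq_inner field_simps)
      have "(R / 2)\<^sup>2 \<le> R\<^sup>2 / 2" by (simp add: power2_eq_square)
      then have lo: "R / 2 < norm (snd z)"
        using 1(1) by (intro power2_less_imp_less[of "R / 2"]) auto
      have hi2: "(norm (snd z))\<^sup>2 \<le> R\<^sup>2" using 1(2) zero_le_power2[of R] by linarith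
      have "(norm (snd z))\<^sup>2 < R\<^sup>2" using 1(2) zero_less_power[OF R0, of 2] by linarith
      then have hi: "norm (snd z) < R" using R0 by (intro power2_less_imp_less[of "norm (snd z)" R]) auto
      have zD: "z \<in> D" using lo by (simp add: D_def)
      have k: "?k\<^sup>2 \<le> (8 / R\<^sup>2 * 1 * G)\<^sup>2"
        using g R0 G by (intro power_mono mult_mono) auto
      have "bform (\<lambda>i j. a i j z) (snd z) (snd z) \<le> A z * (norm (snd z))\<^sup>2" using elim by blast
      also have "\<dots> \<le> (c * R powr (2 - \<alpha>)) * R\<^sup>2"
        using elim lo hi hi2 c by (intro mult_mono) auto
      finally have "?k\<^sup>2 * bform (\<lambda>i j. a i j z) (snd z) (snd z) \<le> (8 / R\<^sup>2 * 1 * G)\<^sup>2 * ((c * R powr (2 - \<alpha>)) * R\<^sup>2)"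
        using k elim by (intro mult_mono bform_nonneg) auto
      also have "\<dots> = 64 * c * G\<^sup>2 * R powr (- \<alpha>)"
      proof -
        have "R powr (2 - \<alpha>) = R powr 2 * R powr (- \<alpha>)" by (simp flip: powr_add)
        then have "R powr (2 - \<alpha>) = R\<^sup>2 * R powr (- \<alpha>)" using R0 by simp
        then show ?thesis using R0 by (simp add: power2_eq_square field_simps)
      qed
      also have "\<dots> \<le> \<kappa> * indicator D z"
        using G by (intro le_\<kappa> zD) (simp add: \<kappa>0_def)
      finally show ?thesis unfolding eq .
    qed
  qed
  define \<rho> where "\<rho> = R powr (- (\<alpha> / (q - 1)))"
  have \<rho>: "0 < \<rho>" using R0 by (simp add: \<rho>_def)
  have \<mu>: "0 < r * \<rho>" using r \<rho> by simp
  have uvP: "AE z in lebesgue_on P. v z \<le> u z"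
    by (rule AE_lebesgue_on_subset[OF open_halfspace openP PS uv])
  have uP: "W_element a q P u ut Gu" and vP: "W_element a q P v vt Gv"
    using u v dom PS by (auto simp: W_loc_def)
  note energy = energy_estimate[OF q(1) nl s uP vP weak uvP CX X01 dxX dtX C\<eta> \<eta>01 K KP XK D \<kappa> \<mu> \<eta>t \<eta>x]
  let ?Y = "\<lambda>z. \<bar>u z - v z\<bar> powr q * (X z * \<eta> z ^ s)"
  show intY: "integrable (lebesgue_on P) ?Y" by (rule energy(1))
  interpret finite_measure M by (rule finite_measure_M)
  have Dm: "(indicator D :: _ \<Rightarrow> real) \<in> borel_measurable M"
    using D by (intro measurable_restrict_space1 borel_measurable_indicator sets_completionI_sets) simp
  have intDY: "integrable M (\<lambda>z. indicator D z * ?Y z)"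
    using integrable_mult_bounded[OF intY Dm, of 1] by (simp add: mult.commute indicator_def)
  have intD: "integrable M (\<lambda>z. indicator D z :: real)"
    using integrable_mult_bounded[of "\<lambda>_. 1", OF _ Dm, of 1] by (simp add: indicator_def)
  have intD_le: "(LINT z|M. indicator D z :: real) \<le> 2 * T * (4 * R) ^ ?n"
  proof -
    have "(LINT z|M. indicator D z :: real) \<le> (LINT z|M. 1)"
      by (rule integral_mono[OF intD]) (auto simp: indicator_def)
    also have "\<dots> = measure lebesgue P"
      using fmeasurableD[OF lmeasurable_P] by (simp add: measure_restrict_space space_restrict_space)
    also have "\<dots> \<le> 2 * T * (4 * R) ^ ?n"
      unfolding P_def by (rule measure_box_le[OF T R0])
    finally show ?thesis .
  qed
  have \<rho>_power: "\<rho> * R ^ ?n \<le> 1"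
  proof -
    \<comment> \<open>The bound \<open>q \<le> 1 + \<alpha> / n\<close> in equivalent form:
      \<open>\<rho>\<close> compensates the volume factor \<open>R ^ n\<close>, with equal exponents
      in the critical case.\<close>
    have "real ?n \<le> \<alpha> / (q - 1)"
      using q by (simp add: field_simps)
    have "\<rho> * R ^ ?n = R powr (- (\<alpha> / (q - 1)) + real ?n)"
      by (simp only: \<rho>_def powr_add powr_realpow[OF R0])
    also have "\<dots> \<le> R powr 0"
      using R \<open>real ?n \<le> \<alpha> / (q - 1)\<close> by (intro powr_mono) auto
    finally show ?thesis using R0 by simp
  qed
  have \<kappa>1: "\<kappa> * (r * \<rho> * (LINT z|M. indicator D z)) \<le> \<kappa>0 * (2 * 4 ^ ?n * r)"
  proof -
    have "\<kappa> * (r * \<rho> * (LINT z|M. indicator D z)) \<le> \<kappa> * (r * \<rho> * (2 * T * (4 * R) ^ ?n))"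
      using \<kappa> \<mu> by (intro mult_left_mono intD_le) auto
    also have "\<dots> = \<kappa>0 * (2 * 4 ^ ?n * r) * (R powr (- \<alpha>) * T) * (\<rho> * R ^ ?n)"
      by (simp add: \<kappa>_def power_mult_distrib mult_ac)
    \<comment> \<open>The length of the time interval cancels the decay of
      \<open>\<kappa>\<close>.\<close>
    also have "R powr (- \<alpha>) * T = 1" using R0 by (simp add: T_def powr_minus)
    also have "\<kappa>0 * (2 * 4 ^ ?n * r) * 1 * (\<rho> * R ^ ?n) \<le> \<kappa>0 * (2 * 4 ^ ?n * r) * 1 * 1"
      using \<kappa>0 r by (intro mult_left_mono \<rho>_power) auto
    finally show ?thesis by simp
  qed
  have \<kappa>2: "\<kappa> * (r * \<rho>) powr (1 - q) = \<kappa>0 * r powr (1 - q)"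
  proof -
    have "- (\<alpha> / (q - 1)) * (1 - q) = \<alpha>" using q by (simp add: field_simps)
    then have "\<rho> powr (1 - q) = R powr \<alpha>" by (simp add: \<rho>_def powr_powr)
    then show ?thesis using r \<rho> R0 by (simp add: \<kappa>_def powr_mult powr_minus)
  qed
  let ?J = "LINT z|M. indicator D z * ?Y z"
  have "(LINT z|M. indicator D z * (r * \<rho> + (r * \<rho>) powr (1 - q) * ?Y z)) =
      (LINT z|M. r * \<rho> * indicator D z + (r * \<rho>) powr (1 - q) * (indicator D z * ?Y z))"
    by (rule Bochner_Integration.integral_cong[OF refl]) (simp add: algebra_simps)
  also have "\<dots> = r * \<rho> * (LINT z|M. indicator D z) + (r * \<rho>) powr (1 - q) * ?J"
    by (subst Bochner_Integration.integral_add) (use intD intDY in auto)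
  finally have eq: "\<kappa> * (LINT z|M. indicator D z * (r * \<rho> + (r * \<rho>) powr (1 - q) * ?Y z)) =
      \<kappa> * (r * \<rho> * (LINT z|M. indicator D z)) + \<kappa> * (r * \<rho>) powr (1 - q) * ?J"
    by (simp add: distrib_left)
  have "\<kappa> * (LINT z|M. indicator D z * (r * \<rho> + (r * \<rho>) powr (1 - q) * ?Y z)) \<le>
      \<kappa>0 * (2 * 4 ^ ?n * r + r powr (1 - q) * ?J)"
    unfolding eq \<kappa>2 using \<kappa>1 by (simp add: distrib_left)
  then have "(2 * real s + (real s)\<^sup>2 * L * (2 powr q * 2 powr q)) *
      (\<kappa> * (LINT z|M. indicator D z * (r * \<rho> + (r * \<rho>) powr (1 - q) * ?Y z))) \<le>
      (2 * real s + (real s)\<^sup>2 * L * (2 powr q * 2 powr q)) * (\<kappa>0 * (2 * 4 ^ ?n * r + r powr (1 - q) * ?J))"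
    using L by (intro mult_left_mono) auto
  moreover have "2 powr (- q) * (LINT z|M. ?Y z) \<le>
      (2 * real s + (real s)\<^sup>2 * L * (2 powr q * 2 powr q)) * \<kappa> *
      (LINT z|M. indicator D z * (r * \<rho> + (r * \<rho>) powr (1 - q) * ?Y z))"
    by (rule energy(2))
  ultimately show "2 powr (- q) * (LINT z|M. ?Y z) \<le>
      (2 * real s + (real s)\<^sup>2 * L * (2 powr q * 2 powr q)) * (2 * G + 64 * c * G\<^sup>2) *
      (2 * 4 ^ ?n * r + r powr (1 - q) * ?J)"
    unfolding \<kappa>0_def[symmetric] by (simp only: mult.assoc)
qed

section \<open>Exhaustion of the half-space and conclusion\<close>

theorem theorem1:
  fixes a :: "'n::finite \<Rightarrow> 'n \<Rightarrow> real \<times> (real ^ 'n) \<Rightarrow> real"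
    and A u v :: "real \<times> (real ^ 'n) \<Rightarrow> real"
    and \<alpha> q c :: real
  assumes "\<alpha> > 0"
    and "1 < q" and "q \<le> 1 + \<alpha> / real CARD('n)"
    and "\<And>i j. a i j \<in> borel_measurable (lebesgue_on \<S>)"
    and "\<And>i j. locally_bounded_on \<S> (a i j)"
    and "\<And>i j. AE z in lebesgue_on \<S>. a i j z = a j i z"
    and "A \<in> borel_measurable (lebesgue_on \<S>)"
    and "\<And>z. z \<in> \<S> \<Longrightarrow> 0 \<le> A z"
    and "locally_bounded_on \<S> A"
    and "AE z in lebesgue_on \<S>. \<forall>\<xi> :: real ^ 'n.
           0 \<le> (\<Sum>i\<in>UNIV. \<Sum>j\<in>UNIV. a i j z * \<xi> $ i * \<xi> $ j) \<and>
           (\<Sum>i\<in>UNIV. \<Sum>j\<in>UNIV. a i j z * \<xi> $ i * \<xi> $ j) \<le> A z * (norm \<xi>)\<^sup>2"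
    and "c > 0"
    and "\<And>R. R > 1 \<Longrightarrow>
           esssup (lebesgue_on ({0<..} \<times> {x. R / 2 < norm x \<and> norm x < R})) (\<lambda>z. ereal (A z))
             \<le> ereal (c * R powr (2 - \<alpha>))"
    and "entire_weak_solution a q u v"
    and "AE z in lebesgue_on \<S>. u z \<ge> v z"
  shows "AE z in lebesgue_on \<S>. u z = v z"
proof -
  obtain ut Gu vt Gv where uW: "W_loc a q u ut Gu" and vW: "W_loc a q v vt Gv"
    and weak: "\<And>\<phi>. test_function_on \<S> \<phi> \<Longrightarrow> (\<And>z. z \<in> \<S> \<Longrightarrow> 0 \<le> \<phi> z) \<Longrightarrow>
      weak_form q v vt Gv \<phi> \<le> weak_form q u ut Gu \<phi>"
    and meas: "u \<in> borel_measurable (lebesgue_on \<S>)" "v \<in> borel_measurable (lebesgue_on \<S>)"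
    using assms(13) unfolding entire_weak_solution_def by blast
  \<comment> \<open>There are finitely many index pairs, so symmetry holds for all of them off one
    null set.\<close>
  have "AE z in lebesgue_on \<S>. \<forall>i j. a i j z = a j i z"
    by (intro eventually_all_finite assms(6))
  then have psd: "AE z in lebesgue_on \<S>. psd (\<lambda>i j. a i j z) \<and>
      (\<forall>\<xi>. bform (\<lambda>i j. a i j z) \<xi> \<xi> \<le> A z * (norm \<xi>)\<^sup>2)"
    using assms(10) by eventually_elim (simp add: psd_def bform_def)
  obtain g g' G where g: "\<And>k. C_k_on k UNIV g" "\<And>x. x \<le> 0 \<Longrightarrow> g x = 0" "\<And>x. 0 \<le> g x" "\<And>x. g x \<le> 1"
      "\<And>x. (g has_real_derivative g' x) (at x)" "\<And>x. 0 \<le> g' x" "\<And>x. g' x \<le> G"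
      "\<And>x. x \<le> 0 \<or> 1 \<le> x \<Longrightarrow> g' x = 0" and g1: "\<And>x. 1 \<le> x \<Longrightarrow> g x = 1"
    by (rule smooth_step_exists) blast
  obtain h h' H L where nl: "test_nonlinearity ((q - 1) / 2) h h' H L"
    using test_nonlinearity_exists[of "(q - 1) / 2"] assms(2) by auto
  define s where "s = nat \<lceil>4 * q / (q - 1)\<rceil>"
  have s: "4 * q / (q - 1) \<le> real s" unfolding s_def by (rule real_nat_ceiling_ge)
  \<comment> \<open>The offset 2 keeps \<open>R k\<close> above 1 from \<open>k = 0\<close> on;
    together with \<open>d k\<close> tending to 0 the cutoffs exhaust the half-space.\<close>
  define R where "R k = real k + 2" for k :: nat
  define d where "d k = 1 / (2 * (real k + 1))" for k :: nat
  have R: "1 < R k" and d: "0 < d k" for k by (simp_all add: R_def d_def)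
  define X where "X k z = g (fst z / d k - 1)" for k and z :: "real \<times> (real ^ 'n)"
  define \<eta> where "\<eta> k z = g (2 - 2 * fst z / R k powr \<alpha>) * g (3 - 4 * (snd z \<bullet> snd z) / (R k)\<^sup>2)"
    for k and z :: "real \<times> (real ^ 'n)"
  define P where "P k = {0<..<2 * R k powr \<alpha>} \<times> (ball 0 (2 * R k) :: (real ^ 'n) set)" for k
  define D where "D k = {z :: real \<times> (real ^ 'n). \<not> (fst z < R k powr \<alpha> / 2 \<and> norm (snd z) < R k / 2)}" for k
  define \<zeta> where "\<zeta> k z = X k z * \<eta> k z ^ s" for k z
  \<comment> \<open>The indicator transfers the integrals over the varying sets \<open>P k\<close>
    to one measure space.\<close>
  define W where "W z = indicator \<S> z * \<bar>u z - v z\<bar> powr q" for z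
  \<comment> \<open>The factor \<open>2 powr q\<close> cancels the constant on the left of the
    estimate; the factor \<open>2 * 4 ^ n\<close> is made common to both terms on the right.\<close>
  define C where "C = 2 powr q * ((2 * real s + (real s)\<^sup>2 * L * (2 powr q * 2 powr q)) * (2 * G + 64 * c * G\<^sup>2)) *
    (2 * 4 ^ CARD('n))"
  note est = scaled_energy_estimate[OF assms(1-4) psd assms(11,12) uW vW weak assms(14) g nl s R d]
  \<comment> \<open>This conclusion does not mention \<open>r\<close>, so the value 1 is
    inserted.\<close>
  have est1: "\<zeta> k z = 0" if "z \<notin> P k" for k z
    unfolding \<zeta>_def X_def \<eta>_def
    by (rule est(1)[OF _ _ _ _ _ zero_less_one]; (assumption | rule that[unfolded P_def]))
  have est2: "integrable (lebesgue_on (P k)) (\<lambda>z. \<bar>u z - v z\<bar> powr q * \<zeta> k z)" for k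
    unfolding \<zeta>_def X_def \<eta>_def P_def
    by (rule est(2)[OF _ _ _ _ _ zero_less_one]; assumption)
  have est3: "2 powr (- q) * (LINT z|lebesgue_on (P k). \<bar>u z - v z\<bar> powr q * \<zeta> k z) \<le>
      (2 * real s + (real s)\<^sup>2 * L * (2 powr q * 2 powr q)) * (2 * G + 64 * c * G\<^sup>2) *
      (2 * 4 ^ CARD('n) * r + r powr (1 - q) *
        (LINT z|lebesgue_on (P k). indicator (D k) z * (\<bar>u z - v z\<bar> powr q * \<zeta> k z)))" if "0 < r" for k r
    unfolding \<zeta>_def X_def \<eta>_def P_def D_def
    by (rule est(3)[OF _ _ _ _ _ that]; assumption)
  have P: "P k \<in> sets lebesgue" for k
  proof -
    have "open (P k)" unfolding P_def by (intro open_Times) auto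
    then show ?thesis by (intro sets_completionI_sets) (simp only: sets_lborel borel_open)
  qed
  have S: "(\<S> :: (real \<times> (real ^ 'n)) set) \<in> sets lebesgue"
    by (intro sets_completionI_sets) (simp only: sets_lborel borel_open open_halfspace)
  have PS: "z \<in> \<S>" if "z \<in> P k" for z k using that by (auto simp: P_def halfspace_def)
  have W\<zeta>: "W z * \<zeta> k z = indicator (P k) z *\<^sub>R (\<bar>u z - v z\<bar> powr q * \<zeta> k z)" for k z
  proof (cases "z \<in> P k")
    case True
    then show ?thesis using PS by (auto simp: W_def)
  next
    case False
    then show ?thesis using est1[OF False] by simp
  qed
  have L: "0 < L" using nl by (simp add: test_nonlinearity_def)
  have G: "0 \<le> G" using g(6,7) order_trans by blast
  have "AE z in lebesgue. W z = 0"
  proof (rule AE_eq_0_if_self_improving[where q = q and C = C and \<zeta> = \<zeta> and D = D])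
    show "1 < q" by fact
    show "0 \<le> C" using L G assms(11) by (simp add: C_def)
    have "(\<lambda>z. \<bar>u z - v z\<bar> powr q) \<in> borel_measurable (lebesgue_on \<S>)" using meas by measurable
    then show "W \<in> borel_measurable lebesgue"
      using S unfolding W_def[abs_def] by (subst (asm) borel_measurable_restrict_space_iff) auto
    show "0 \<le> W z" for z by (simp add: W_def)
    show "0 \<le> \<zeta> k z" "\<zeta> k z \<le> 1" for k z
      using g(3,4) by (auto simp: \<zeta>_def X_def \<eta>_def intro!: mult_le_one power_le_one)
    show "D k \<in> sets lebesgue" for k
    proof -
      have "D k = {z. R k powr \<alpha> / 2 \<le> fst z} \<union> {z. R k / 2 \<le> norm (snd z)}" by (auto simp: D_def)
      moreover have "closed \<dots>" by (intro closed_Un closed_Collect_le continuous_intros)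
      ultimately have "D k \<in> sets borel" by (simp only: borel_closed)
      then show ?thesis using sets_completionI_sets[of "D k" lborel] by simp
    qed
    show "\<forall>\<^sub>F k in sequentially. \<zeta> k z = 1 \<and> z \<notin> D k" if "W z \<noteq> 0" for z
    proof -
      \<comment> \<open>A non-zero \<open>W z\<close> forces positive time; this is what lets the
        cutoff near \<open>t = 0\<close> reach 1 eventually.\<close>
      have t: "0 < fst z" using that by (auto simp: W_def halfspace_def indicator_def split: if_splits)
      have R_lim: "filterlim R at_top sequentially"
        unfolding R_def[abs_def] by real_asymp
      have R\<alpha>_lim: "filterlim (\<lambda>k. R k powr \<alpha>) at_top sequentially"
        unfolding R_def[abs_def] using assms(1) by real_asymp
      have d_lim: "d \<longlonglongrightarrow> 0" unfolding d_def[abs_def] by real_asymp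
      have "\<forall>\<^sub>F k in sequentially. 2 * norm (snd z) < R k"
        using R_lim by (simp add: filterlim_at_top_dense)
      moreover have "\<forall>\<^sub>F k in sequentially. 2 * fst z < R k powr \<alpha>"
        using R\<alpha>_lim by (simp add: filterlim_at_top_dense)
      moreover have "\<forall>\<^sub>F k in sequentially. d k < fst z / 2"
        using order_tendstoD(2)[OF d_lim, of "fst z / 2"] t by simp
      ultimately show ?thesis
      proof eventually_elim
        case (elim k)
        have "(norm (snd z))\<^sup>2 \<le> (R k / 2)\<^sup>2" using elim by (intro power_mono) auto
        then have "4 * (snd z \<bullet> snd z) \<le> (R k)\<^sup>2"
          by (simp add: power2_norm_eq_inner power_divide)
        then have "4 * (snd z \<bullet> snd z) \<le> 2 * (R k)\<^sup>2"
          using zero_le_power2[of "R k"] by linarith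
        then have "1 \<le> 3 - 4 * (snd z \<bullet> snd z) / (R k)\<^sup>2"
          using R[of k] by (simp add: field_simps)
        moreover have "1 \<le> 2 - 2 * fst z / R k powr \<alpha>" using elim R[of k] by (simp add: field_simps)
        moreover have "1 \<le> fst z / d k - 1" using elim d[of k] by (simp add: field_simps)
        ultimately have "\<zeta> k z = 1" using g1 by (simp add: \<zeta>_def X_def \<eta>_def)
        then show ?case using elim by (simp add: D_def)
      qed
    qed
    show "integrable lebesgue (\<lambda>z. W z * \<zeta> k z)" for k
      unfolding W\<zeta> using est2[of k] P by (simp add: integrable_restrict_space)
    show "(LINT z|lebesgue. W z * \<zeta> k z) \<le>
        C * (r + r powr (1 - q) * (LINT z|lebesgue. indicator (D k) z * (W z * \<zeta> k z)))" if r: "0 < r" for k r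
    proof -
      define J where "J = (LINT z|lebesgue. indicator (D k) z * (W z * \<zeta> k z))"
      define B where "B = (2 * real s + (real s)\<^sup>2 * L * (2 powr q * 2 powr q)) * (2 * G + 64 * c * G\<^sup>2)"
      have J: "J = (LINT z|lebesgue_on (P k). indicator (D k) z * (\<bar>u z - v z\<bar> powr q * \<zeta> k z))"
        unfolding J_def W\<zeta> using P by (simp add: integral_restrict_space mult.left_commute)
      have J0: "0 \<le> J" unfolding J_def
        by (rule Bochner_Integration.integral_nonneg)
           (use g(3) in \<open>simp add: W_def \<zeta>_def X_def \<eta>_def\<close>)
      have B0: "0 \<le> B" using L G assms(11) by (simp add: B_def)
      have "2 powr (- q) * (LINT z|lebesgue. W z * \<zeta> k z) \<le> B * (2 * 4 ^ CARD('n) * r + r powr (1 - q) * J)"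
        using est3[OF r, of k] unfolding J[symmetric] B_def[symmetric]
        unfolding W\<zeta> using P by (simp add: integral_restrict_space)
      then have "2 powr q * (2 powr (- q) * (LINT z|lebesgue. W z * \<zeta> k z)) \<le>
          2 powr q * (B * (2 * 4 ^ CARD('n) * r + r powr (1 - q) * J))"
        by (rule mult_left_mono) simp
      also have "2 powr q * (2 powr (- q) * (LINT z|lebesgue. W z * \<zeta> k z)) = (LINT z|lebesgue. W z * \<zeta> k z)"
        by (simp add: powr_minus)
      also have "2 powr q * (B * (2 * 4 ^ CARD('n) * r + r powr (1 - q) * J)) \<le>
          2 powr q * (B * (2 * 4 ^ CARD('n) * (r + r powr (1 - q) * J)))"
      proof (intro mult_left_mono B0)
        have "1 \<le> (4::real) ^ CARD('n)" by (rule one_le_power) simp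
        then have "1 \<le> 2 * (4::real) ^ CARD('n)" by linarith
        then have "1 * (r powr (1 - q) * J) \<le> 2 * 4 ^ CARD('n) * (r powr (1 - q) * J)"
          using J0 by (intro mult_right_mono) auto
        then show "2 * 4 ^ CARD('n) * r + r powr (1 - q) * J \<le> 2 * 4 ^ CARD('n) * (r + r powr (1 - q) * J)"
          by (simp add: distrib_left)
      qed simp
      also have "\<dots> = C * (r + r powr (1 - q) * J)" by (simp add: C_def B_def mult.assoc)
      finally show ?thesis unfolding J_def .
    qed
  qed
  then have "AE z in lebesgue. z \<in> \<S> \<longrightarrow> u z = v z"
    by eventually_elim (auto simp: W_def)
  then show ?thesis
    using S by (simp add: AE_restrict_space_iff)
qed

end
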